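(* Let $N\ge 2$, let $\Omega\subset\mathbb R^N$ be a domain, and let $p,q,\sigma\in\mathbb R$ satisfy $$0<\sigma<\frac{1}{4}\left(\sqrt{\frac{N+8}{N}}-1\right)\qquad\text{and}\qquad p+(1+\sigma)q<\frac{N+2}{N}+\sigma .$$ Let $u$ be a positive solution of $-\Delta u=u^p|\nabla u|^q$ in $\Omega$ that satisfies $u\ge m$ for some constant $m>0$. Then there exists a constant $C=C(N,p,q,\sigma)>0$ (depending only on $N,p,q,\sigma$) such that $$\left|\nabla u^{-\sigma}(x)\right|\le C\,m^{-\sigma}\,\mathrm{dist}^{-1}(x,\partial\Omega),\qquad x\in\Omega.$$
   Context: A (weak) solution of $-\Delta u=u^p|\nabla u|^q$ in $\Omega$ is a function $u\in C^1(\Omega)$ such that $u^p|\nabla u|^q\in L^1_{loc}(\Omega)$ and $\int_\Omega\langle\nabla u,\nabla\psi\rangle=\int_\Omega u^p|\nabla u|^q\psi$ for all $\psi\in C_0^\infty(\Omega)$. The exponents $p,q$ are real and may be negative; for $q<0$ the term $u^p|\nabla u|^q$ is singular (equal to $+\infty$) where $\nabla u=0$; for $q=0$ the equation is $-\Delta u=u^p$. Here $\nabla u^{-\sigma}$ is the gradient of the function $u^{-\sigma}$, and $\mathrm{dist}^{-1}(x,\partial\Omega)=1/\mathrm{dist}(x,\partial\Omega)$, read as $0$ if $\Omega=\mathbb R^N$. *)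

theory Defs
  imports "HOL-Analysis.Analysis"
begin

definition gradient :: "('a::real_inner \<Rightarrow> real) \<Rightarrow> 'a \<Rightarrow> 'a" where
  "gradient f x = (THE D. gderiv f x D)"

definition C1_on :: "'a::euclidean_space set \<Rightarrow> ('a \<Rightarrow> real) \<Rightarrow> bool" where
  "C1_on \<Omega> u \<longleftrightarrow> (\<forall>x\<in>\<Omega>. u differentiable (at x)) \<and> continuous_on \<Omega> (gradient u)"

primrec Ck :: "nat \<Rightarrow> ('a::euclidean_space \<Rightarrow> real) \<Rightarrow> bool" where
  "Ck 0 f \<longleftrightarrow> continuous_on UNIV f"
| "Ck (Suc k) f \<longleftrightarrow> (\<forall>x. f differentiable (at x)) \<and>
     (\<forall>v. Ck k (\<lambda>x. frechet_derivative f (at x) v))"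

text \<open>Elements of \<open>C\<^sub>0\<^sup>\<infinity>(\<Omega>)\<close> are represented by their extension by zero to the whole space.\<close>

definition test_function :: "'a::euclidean_space set \<Rightarrow> ('a \<Rightarrow> real) \<Rightarrow> bool" where
  "test_function \<Omega> \<psi> \<longleftrightarrow> (\<forall>k. Ck k \<psi>) \<and>
     compact (closure {x. \<psi> x \<noteq> 0}) \<and> closure {x. \<psi> x \<noteq> 0} \<subseteq> \<Omega>"

text \<open>The power \<open>s\<^sup>q\<close> of \<open>s \<ge> 0\<close> with values in \<open>[0,\<infinity>]\<close>. The case distinction is needed because
  \<open>0 powr q = 0\<close> for every \<open>q\<close>, whereas here \<open>s\<^sup>0 = 1\<close>, and \<open>0\<^sup>q = \<infinity>\<close> for \<open>q < 0\<close>.\<close>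

definition epow :: "real \<Rightarrow> real \<Rightarrow> ennreal" where
  "epow s q = (if q = 0 then 1 else if s = 0 \<and> q < 0 then \<infinity> else ennreal (s powr q))"

definition source :: "real \<Rightarrow> real \<Rightarrow> ('a::euclidean_space \<Rightarrow> real) \<Rightarrow> 'a \<Rightarrow> ennreal" where
  "source p q u x = epow (u x) p * epow (norm (gradient u x)) q"

definition L1_loc :: "'a::euclidean_space set \<Rightarrow> ('a \<Rightarrow> ennreal) \<Rightarrow> bool" where
  "L1_loc \<Omega> f \<longleftrightarrow> f \<in> borel_measurable (lebesgue_on \<Omega>) \<and>
     (\<forall>K. compact K \<and> K \<subseteq> \<Omega> \<longrightarrow> (\<integral>\<^sup>+x\<in>K. f x \<partial>lebesgue) < \<infinity>)"

text \<open>Positive weak solutions of \<open>-\<Delta>u = u\<^sup>p |\<nabla>u|\<^sup>q\<close>. By local integrability the source term is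
  finite almost everywhere in \<open>\<Omega>\<close>, so that \<open>enn2real\<close> (which sends \<open>\<infinity>\<close> to \<open>0\<close>) changes it only on
  a null set.\<close>

definition positive_solution ::
  "'a::euclidean_space set \<Rightarrow> real \<Rightarrow> real \<Rightarrow> ('a \<Rightarrow> real) \<Rightarrow> bool" where
  "positive_solution \<Omega> p q u \<longleftrightarrow>
     C1_on \<Omega> u \<and> (\<forall>x\<in>\<Omega>. u x > 0) \<and> L1_loc \<Omega> (source p q u) \<and>
     (\<forall>\<psi>. test_function \<Omega> \<psi> \<longrightarrow>
        (LINT x:\<Omega>|lebesgue. gradient u x \<bullet> gradient \<psi> x) =
        (LINT x:\<Omega>|lebesgue. enn2real (source p q u x) * \<psi> x))"

definition inv_dist_boundary :: "'a::euclidean_space set \<Rightarrow> 'a \<Rightarrow> real" where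
  "inv_dist_boundary \<Omega> x = (if \<Omega> = UNIV then 0 else 1 / infdist x (frontier \<Omega>))"

end

theory Submission
  imports Defs
begin

text \<open>
  Bernstein's method is applied to \<open>v = u\<^sup>-\<^sup>\<sigma>\<close>, which solves \<open>\<Delta>v = F(v, |\<nabla>v|\<^sup>2)\<close> with
  \<open>F(v, z) = (1 + 1/\<sigma>) z/v + c v\<^sup>s z\<^sup>q\<^sup>/\<^sup>2\<close>. With a cutoff \<open>\<eta>\<close> of a ball of radius \<open>R\<close>, the hypotheses
  on \<open>\<sigma>\<close>, \<open>p\<close>, \<open>q\<close> make the terms of \<open>\<Delta>(\<eta>|\<nabla>v|\<^sup>2)\<close> without derivatives of \<open>w = \<eta>|\<nabla>v|\<^sup>2\<close> positive
  wherever \<open>w\<close> is large compared with \<open>(sup v / R)\<^sup>2\<close>.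

  As \<open>u\<close> is only \<open>C\<^sup>1\<close>, elliptic regularity is replaced by mollification: the mollified functions
  solve the equation up to an error \<open>e\<close> that tends to \<open>0\<close> uniformly, but with no control on \<open>\<nabla>e\<close>.
  The Bernstein inequality is therefore integrated against \<open>(w - k)\<^sub>+\<^sup>2\<close>, with \<open>k\<close> slightly below the
  maximum of \<open>w\<close>. Integration by parts removes the derivative of \<open>e\<close>, the gradient terms are absorbed
  because \<open>(w - k)\<^sub>+\<close> is small, and letting \<open>e \<rightarrow> 0\<close> contradicts the positivity.
\<close>

section \<open>Calculus of \<open>C\<^sup>k\<close> functions on open sets\<close>

text \<open>Write a = 1 + 1/\<sigma>, z = |\<nabla>v|^2 and N for the dimension. Since |D^2 v|^2
  \<ge> (\<Delta>v)^2 / N, the main terms of Bochner's formula dominate a quadratic form in P = z/v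
  and Q = c v^s z^(q/2), with coefficients a^2/N - a of P^2, 2a/N + s of PQ and 1/N of Q^2. The
  bound on \<sigma> gives \<sigma> < 1/N, so a > N and the first coefficient is positive; the bound
  on p + (1 + \<sigma>) q makes the second one nonnegative. The hypothesis u \<ge> m enters as v
  \<le> m^(-\<sigma>): it makes P^2 = z^2/v^2 beat the cutoff errors, which are of size z/R^2, as
  soon as w is large.

  F is smooth only where \<nabla>v does not vanish. All the analysis therefore takes place on the
  set where w is at least half its maximum: it is compact, \<nabla>u has no zero on it, and the
  source is a smooth function of u and \<nabla>u there, whatever the sign of q.

  The order in which constants are chosen matters: bounds uniform in the approximation come before
  the level k, which comes before the admissible size of e, and the approximating function is picked
  last.\<close>

definition pd :: "('a::euclidean_space \<Rightarrow> real) \<Rightarrow> 'a \<Rightarrow> 'a \<Rightarrow> real" where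
  "pd f b x = frechet_derivative f (at x) b"

text \<open>A local form of \<open>Ck\<close>, because the functions that matter later, such as
  negative powers, are smooth only where their argument is positive. Derivatives are full ones at
  the points of \<open>G\<close>, and nothing is asked of the values outside it.\<close>

primrec Ck_on :: "nat \<Rightarrow> 'a::euclidean_space set \<Rightarrow> ('a \<Rightarrow> real) \<Rightarrow> bool" where
  "Ck_on 0 G f \<longleftrightarrow> continuous_on G f"
| "Ck_on (Suc k) G f \<longleftrightarrow> (\<forall>x\<in>G. f differentiable (at x)) \<and> (\<forall>v. Ck_on k G (pd f v))"

lemma Ck_on_UNIV: "Ck_on k UNIV f \<longleftrightarrow> Ck k f"
  by (induction k arbitrary: f) (auto simp: pd_def[abs_def])

lemma has_derivative_pd:
  "f differentiable (at x) \<Longrightarrow> (f has_derivative (\<lambda>h. pd f h x)) (at x)"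
  by (simp add: frechet_derivative_works pd_def)

lemma pd_eqI: "(f has_derivative f') (at x) \<Longrightarrow> pd f b x = f' b"
  by (metis frechet_derivative_at pd_def)

text \<open>\<open>frechet_derivative\<close> is a choice made from the predicate
  \<open>has_derivative\<close>, and functions that agree near \<open>x\<close> share this
  predicate. Hence the second claim holds even where neither function is differentiable.\<close>

lemma pd_cong_open:
  assumes "open G" "x \<in> G" "\<And>y. y \<in> G \<Longrightarrow> f y = g y"
  shows "f differentiable (at x) \<longleftrightarrow> g differentiable (at x)" "pd f b x = pd g b x"
proof -
  have iff: "(f has_derivative F) (at x) \<longleftrightarrow> (g has_derivative F) (at x)" for F
    using assms has_derivative_transform_within_open[of f F x UNIV G g]
      has_derivative_transform_within_open[of g F x UNIV G f] by auto
  then show "f differentiable (at x) \<longleftrightarrow> g differentiable (at x)"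
    by (simp add: differentiable_def)
  show "pd f b x = pd g b x"
    by (simp add: pd_def frechet_derivative_def iff)
qed

lemma Ck_on_cong:
  assumes "open G" "\<And>y. y \<in> G \<Longrightarrow> f y = g y"
  shows "Ck_on k G f \<longleftrightarrow> Ck_on k G g"
  using assms(2)
proof (induction k arbitrary: f g)
  case 0
  then show ?case using continuous_on_cong[of G G f g] by simp
next
  case (Suc k)
  have "Ck_on k G (pd f v) \<longleftrightarrow> Ck_on k G (pd g v)" for v
    by (rule Suc.IH[OF pd_cong_open(2)[OF assms(1) _ Suc.prems]])
  moreover have "f differentiable (at x) \<longleftrightarrow> g differentiable (at x)" if "x \<in> G" for x
    using pd_cong_open(1)[OF assms(1) that] Suc.prems by blast
  ultimately show ?case by simp
qed

lemma Ck_on_imp_continuous: "Ck_on k G f \<Longrightarrow> continuous_on G f"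
  by (cases k)
    (auto intro!: differentiable_imp_continuous_on simp: differentiable_on_def differentiable_at_withinI)

lemma Ck_on_SucD: "Ck_on (Suc k) G f \<Longrightarrow> Ck_on k G f"
proof (induction k arbitrary: f)
  case 0
  then have "continuous_on G f" by (rule Ck_on_imp_continuous)
  then show ?case by simp
next
  case (Suc k)
  have "Ck_on k G (pd f v)" for v
    using Suc.prems by (intro Suc.IH) simp
  then show ?case using Suc.prems by simp
qed

lemma Ck_on_le:
  assumes "Ck_on k G f" "j \<le> k"
  shows "Ck_on j G f"
  using assms(2,1) by (induction rule: dec_induct) (blast dest: Ck_on_SucD)+

lemma Ck_on_subset: "Ck_on k G f \<Longrightarrow> H \<subseteq> G \<Longrightarrow> Ck_on k H f"
  by (induction k arbitrary: f) (auto intro: continuous_on_subset)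

lemma pd_const: "pd (\<lambda>x. c) b x = 0"
  by (rule pd_eqI[THEN trans]) auto

lemma pd_inner: "pd (\<lambda>x. x \<bullet> a) b x = b \<bullet> a"
  by (rule pd_eqI[of _ "\<lambda>h. h \<bullet> a"]) (auto intro!: derivative_eq_intros)

lemma pd_add:
  assumes "f differentiable (at x)" "g differentiable (at x)"
  shows "pd (\<lambda>x. f x + g x) b x = pd f b x + pd g b x"
  by (rule pd_eqI[OF has_derivative_add[OF assms[THEN has_derivative_pd]]])

lemma pd_diff:
  assumes "f differentiable (at x)" "g differentiable (at x)"
  shows "pd (\<lambda>x. f x - g x) b x = pd f b x - pd g b x"
  by (rule pd_eqI[OF has_derivative_diff[OF assms[THEN has_derivative_pd]]])

lemma pd_mult:
  assumes "f differentiable (at x)" "g differentiable (at x)"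
  shows "pd (\<lambda>x. f x * g x) b x = f x * pd g b x + pd f b x * g x"
  by (rule pd_eqI[OF has_derivative_mult[OF assms[THEN has_derivative_pd]]])

lemma pd_sum:
  assumes "\<And>i. i \<in> I \<Longrightarrow> f i differentiable (at x)"
  shows "pd (\<lambda>x. \<Sum>i\<in>I. f i x) b x = (\<Sum>i\<in>I. pd (f i) b x)"
  by (rule pd_eqI[OF has_derivative_sum]) (use assms has_derivative_pd in blast)

lemma has_derivative_compose_real:
  assumes "f differentiable (at x)" "(\<phi> has_real_derivative d) (at (f x))"
  shows "((\<lambda>x. \<phi> (f x)) has_derivative (\<lambda>h. d * pd f h x)) (at x)"
  using has_derivative_compose[OF has_derivative_pd[OF assms(1)] 
      assms(2)[unfolded has_field_derivative_def]] by simp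

lemma pd_compose:
  assumes "f differentiable (at x)" "(\<phi> has_real_derivative d) (at (f x))"
  shows "pd (\<lambda>x. \<phi> (f x)) b x = d * pd f b x"
  by (rule pd_eqI[OF has_derivative_compose_real[OF assms]])

lemma Ck_on_const: "Ck_on k G (\<lambda>x. c)"
  by (induction k arbitrary: c) (auto simp: pd_const[abs_def])

lemma Ck_on_inner: "Ck_on k G (\<lambda>x. x \<bullet> a)"
  by (cases k) (auto simp: pd_inner[abs_def] Ck_on_const intro!: continuous_intros derivative_intros)

lemma Ck_on_add:
  assumes "open G"
  shows "Ck_on k G f \<Longrightarrow> Ck_on k G g \<Longrightarrow> Ck_on k G (\<lambda>x. f x + g x)"
proof (induction k arbitrary: f g)
  case 0
  then show ?case by (simp add: continuous_on_add)
next
  case (Suc k)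
  have "Ck_on k G (pd (\<lambda>x. f x + g x) v)" for v
    using Suc.IH[of "pd f v" "pd g v"] Suc.prems
    by (subst Ck_on_cong[OF assms, of _ "\<lambda>x. pd f v x + pd g v x"]) (auto simp: pd_add)
  then show ?case using Suc.prems by auto
qed

lemma Ck_on_mult:
  assumes "open G"
  shows "Ck_on k G f \<Longrightarrow> Ck_on k G g \<Longrightarrow> Ck_on k G (\<lambda>x. f x * g x)"
proof (induction k arbitrary: f g)
  case 0
  then show ?case by (simp add: continuous_on_mult)
next
  case (Suc k)
  have "Ck_on k G f" "Ck_on k G g" using Suc.prems Ck_on_SucD by blast+
  then have "Ck_on k G (pd (\<lambda>x. f x * g x) v)" for v
    using Suc.IH[of "pd f v" g] Suc.IH[of f "pd g v"] Suc.prems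
    by (subst Ck_on_cong[OF assms, of _ "\<lambda>x. f x * pd g v x + pd f v x * g x"])
      (auto simp: pd_mult intro!: Ck_on_add[OF assms])
  then show ?case using Suc.prems by (simp add: differentiable_mult)
qed

lemma Ck_on_diff:
  assumes "open G" "Ck_on k G f" "Ck_on k G g"
  shows "Ck_on k G (\<lambda>x. f x - g x)"
  using Ck_on_add[OF assms(1,2) Ck_on_mult[OF assms(1) Ck_on_const[of k G "-1"] assms(3)]] by simp

lemma Ck_on_sum:
  assumes "open G" "finite I" "\<And>i. i \<in> I \<Longrightarrow> Ck_on k G (f i)"
  shows "Ck_on k G (\<lambda>x. \<Sum>i\<in>I. f i x)"
  using assms(2,3) by (induction I rule: finite_induct) (auto intro: Ck_on_const Ck_on_add[OF assms(1)])

lemma Ck_on_powr: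
  assumes "open G" "\<And>x. x \<in> G \<Longrightarrow> f x > 0"
  shows "Ck_on k G f \<Longrightarrow> Ck_on k G (\<lambda>x. f x powr a)"
proof (induction k arbitrary: a)
  case 0
  then show ?case using assms(2) by (auto intro!: continuous_intros simp: less_le)
next
  case (Suc k)
  have dd: "((\<lambda>t. t powr a) has_real_derivative (a * f x powr (a - 1))) (at (f x))" if "x \<in> G" for x
    using assms(2)[OF that] by (auto intro!: derivative_eq_intros simp: )
  have "Ck_on k G (pd (\<lambda>x. f x powr a) v)" for v
  proof (subst Ck_on_cong[OF assms(1), of _ "\<lambda>x. (a * f x powr (a - 1)) * pd f v x"])
    show "pd (\<lambda>x. f x powr a) v y = a * f y powr (a - 1) * pd f v y" if "y \<in> G" for y
      using pd_compose[where \<phi> = "\<lambda>t. t powr a" and f = f, OF _ dd[OF that]] Suc.prems that by simp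
    show "Ck_on k G (\<lambda>x. a * f x powr (a - 1) * pd f v x)"
      using Suc.prems Ck_on_SucD[OF Suc.prems]
      by (intro Ck_on_mult[OF assms(1)] Ck_on_const Suc.IH) auto
  qed
  moreover have "(\<lambda>x. f x powr a) differentiable (at x)" if "x \<in> G" for x
    using has_derivative_compose_real[where \<phi> = "\<lambda>t. t powr a" and f = f, OF _ dd[OF that]] Suc.prems that
    by (auto intro: differentiableI)
  ultimately show ?case by simp
qed

lemma Ck_on_glue:
  assumes "open G" "open H" "Ck_on k G f" "Ck_on k H f"
  shows "Ck_on k (G \<union> H) f"
  using assms(3,4)
  by (induction k arbitrary: f) (auto intro: continuous_on_open_Un assms)

text \<open>\<open>G\<close> and the complement of \<open>K\<close> are open and cover the space,
  and \<open>f\<close> is zero on the latter. This turns locally defined test fields into global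
  ones that can be integrated.\<close>

lemma Ck_on_extend:
  assumes "open G" "closed K" "K \<subseteq> G" "\<And>x. x \<notin> K \<Longrightarrow> f x = 0" "Ck_on k G f"
  shows "Ck_on k UNIV f"
proof -
  have "Ck_on k (-K) f"
    using Ck_on_cong[of "-K" f "\<lambda>x. 0" k] assms(2,4) Ck_on_const by (auto simp: open_Compl)
  then have "Ck_on k (G \<union> -K) f"
    by (intro Ck_on_glue) (use assms in \<open>auto simp: open_Compl\<close>)
  moreover have "G \<union> -K = UNIV" using assms(3) by auto
  ultimately show ?thesis by simp
qed

lemma pd_zero_outside:
  assumes "closed K" "\<And>x. x \<notin> K \<Longrightarrow> f x = 0" "x \<notin> K"
  shows "pd f b x = 0"
  using pd_cong_open(2)[of "-K" x f "\<lambda>x. 0"] assms by (auto simp: pd_const open_Compl)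

lemma has_real_derivative_along_line:
  assumes "f differentiable (at (x + t *\<^sub>R b))"
  shows "((\<lambda>s. f (x + s *\<^sub>R b)) has_real_derivative pd f b (x + t *\<^sub>R b)) (at t)"
proof -
  have "((\<lambda>s. x + s *\<^sub>R b) has_derivative (\<lambda>h. h *\<^sub>R b)) (at t)"
    by (auto intro!: derivative_eq_intros)
  from has_derivative_compose[OF this has_derivative_pd[OF assms]]
  have "((\<lambda>s. f (x + s *\<^sub>R b)) has_derivative (\<lambda>h. pd f (h *\<^sub>R b) (x + t *\<^sub>R b))) (at t)" .
  moreover have "pd f (h *\<^sub>R b) (x + t *\<^sub>R b) = h * pd f b (x + t *\<^sub>R b)" for h
    using has_derivative_pd[OF assms] linear_cmul[of "\<lambda>h. pd f h (x + t *\<^sub>R b)"]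
    by (simp add: has_derivative_linear)
  ultimately show ?thesis
    by (simp add: has_field_derivative_def mult_commute_abs)
qed

lemma mvt_along_line:
  assumes "t > 0" "\<And>s. 0 \<le> s \<Longrightarrow> s \<le> t \<Longrightarrow> f differentiable (at (x + s *\<^sub>R b))"
  obtains s where "0 < s" "s < t" "f (x + t *\<^sub>R b) - f x = t * pd f b (x + s *\<^sub>R b)"
proof -
  have "\<exists>z>0. z < t \<and> f (x + t *\<^sub>R b) - f (x + 0 *\<^sub>R b) = (t - 0) * pd f b (x + z *\<^sub>R b)"
    using assms by (intro MVT2) (auto intro!: has_real_derivative_along_line)
  with that show thesis by auto
qed

text \<open>The second difference of \<open>f\<close> in the directions \<open>a\<close> and
  \<open>b\<close> is symmetric. Two applications of the mean value theorem, in either order,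
  express it by a mixed derivative at a nearby point; continuity of the mixed derivatives gives the
  claim as the step tends to zero.\<close>

lemma pd_commute:
  assumes "open G" "Ck_on (Suc (Suc 0)) G f" "x \<in> G"
  shows "pd (pd f a) b x = pd (pd f b) a x"
proof -
  obtain r where r: "r > 0" "cball x r \<subseteq> G"
    using assms(1,3) open_contains_cball by blast
  \<comment> \<open>With steps of size at most \<open>r / M\<close> in both directions one stays in
    \<open>cball x r\<close>; the summand 1 keeps \<open>M\<close> positive when both directions
    vanish.\<close>
  define M where "M = norm a + norm b + 1"
  have M: "M > 0" by (simp add: M_def add_nonneg_pos)
  have inG: "x + s *\<^sub>R a + t *\<^sub>R b \<in> G" if "\<bar>s\<bar> \<le> r / M" "\<bar>t\<bar> \<le> r / M" for s t
  proof -
    have "norm (s *\<^sub>R a + t *\<^sub>R b) \<le> (r/M) * norm a + (r/M) * norm b"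
      using mult_right_mono[OF that(1), of "norm a"] mult_right_mono[OF that(2), of "norm b"]
      by (intro norm_triangle_le add_mono) auto
    also have "\<dots> = (r/M) * (norm a + norm b)" by (simp add: algebra_simps)
    also have "\<dots> \<le> (r/M) * M" by (intro mult_left_mono) (use r M in \<open>auto simp: M_def\<close>)
    also have "\<dots> = r" using M by simp
    finally show ?thesis using r(2) by (auto simp: dist_norm add.assoc subset_iff norm_minus_commute)
  qed
  have diff: "f differentiable (at y)" "pd f v differentiable (at y)" if "y \<in> G" for y v
    using assms(2) that by auto
  have key: "\<exists>s1 t1 s2 t2. 0 < s1 \<and> s1 < h \<and> 0 < t1 \<and> t1 < h \<and> 0 < s2 \<and> s2 < h \<and> 0 < t2 \<and> t2 < h \<and>
     pd (pd f a) b (x + s1 *\<^sub>R a + t1 *\<^sub>R b) = pd (pd f b) a (x + s2 *\<^sub>R a + t2 *\<^sub>R b)"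
    if h: "0 < h" "h \<le> r / M" for h
  proof -
    have step: "\<exists>s1 t1. 0 < s1 \<and> s1 < h \<and> 0 < t1 \<and> t1 < h \<and>
       f (x + h *\<^sub>R c + h *\<^sub>R d) - f (x + h *\<^sub>R c) - f (x + h *\<^sub>R d) + f x
         = h * (h * pd (pd f c) d (x + s1 *\<^sub>R c + t1 *\<^sub>R d))"
      if inG': "\<And>s t. \<bar>s\<bar> \<le> r / M \<Longrightarrow> \<bar>t\<bar> \<le> r / M \<Longrightarrow> x + s *\<^sub>R c + t *\<^sub>R d \<in> G" for c d
    proof -
      \<comment> \<open>The mean value theorem along \<open>c\<close> is applied to the difference
        of \<open>f\<close> in direction \<open>d\<close>, and then along \<open>d\<close> to
        \<open>pd f c\<close>.\<close>
      define g where "g = (\<lambda>y. f (y + h *\<^sub>R d) - f y)"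
      have hd: "(g has_derivative (\<lambda>k. pd f k (x + s *\<^sub>R c + h *\<^sub>R d) - pd f k (x + s *\<^sub>R c))) (at (x + s *\<^sub>R c))"
        if "0 \<le> s" "s \<le> h" for s
      proof -
        have "((\<lambda>y. y + h *\<^sub>R d) has_derivative (\<lambda>k. k)) (at (x + s *\<^sub>R c))"
          by (auto intro!: derivative_eq_intros)
        moreover have "f differentiable (at (x + s *\<^sub>R c + h *\<^sub>R d))"
          using that h by (intro diff inG') auto
        ultimately have "((\<lambda>y. f (y + h *\<^sub>R d)) has_derivative (\<lambda>k. pd f k (x + s *\<^sub>R c + h *\<^sub>R d))) (at (x + s *\<^sub>R c))"
          by (rule has_derivative_compose[OF _ has_derivative_pd])
        moreover have "f differentiable (at (x + s *\<^sub>R c))"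
          using that h diff inG'[of s 0] by auto
        ultimately show ?thesis unfolding g_def
          by (intro has_derivative_diff has_derivative_pd) auto
      qed
      obtain s where s: "0 < s" "s < h" "g (x + h *\<^sub>R c) - g x = h * pd g c (x + s *\<^sub>R c)"
      proof (rule mvt_along_line[OF h(1)])
        show "g differentiable (at (x + s *\<^sub>R c))" if "0 \<le> s" "s \<le> h" for s
          using hd[OF that] by (rule differentiableI)
      qed
      have "pd g c (x + s *\<^sub>R c) = pd f c (x + s *\<^sub>R c + h *\<^sub>R d) - pd f c (x + s *\<^sub>R c)"
        using pd_eqI[OF hd] s by simp
      moreover obtain t where t: "0 < t" "t < h"
         "pd f c (x + s *\<^sub>R c + h *\<^sub>R d) - pd f c (x + s *\<^sub>R c) = h * pd (pd f c) d (x + s *\<^sub>R c + t *\<^sub>R d)"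
      proof (rule mvt_along_line[OF h(1)])
        show "pd f c differentiable (at (x + s *\<^sub>R c + t *\<^sub>R d))" if "0 \<le> t" "t \<le> h" for t
          using that h s by (intro diff inG') auto
      qed
      ultimately show ?thesis using s t unfolding g_def by (intro exI[of _ s] exI[of _ t]) (auto simp: algebra_simps)
    qed
    from step[of a b] inG obtain s1 t1 where 1: "0 < s1" "s1 < h" "0 < t1" "t1 < h"
       "f (x + h *\<^sub>R a + h *\<^sub>R b) - f (x + h *\<^sub>R a) - f (x + h *\<^sub>R b) + f x
         = h * (h * pd (pd f a) b (x + s1 *\<^sub>R a + t1 *\<^sub>R b))" by blast
    have inG': "x + s *\<^sub>R b + t *\<^sub>R a \<in> G" if "\<bar>s\<bar> \<le> r / M" "\<bar>t\<bar> \<le> r / M" for s t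
      using inG[OF that(2,1)] by (simp add: algebra_simps)
    from step[of b a] inG' obtain s2 t2 where 2: "0 < s2" "s2 < h" "0 < t2" "t2 < h"
       "f (x + h *\<^sub>R b + h *\<^sub>R a) - f (x + h *\<^sub>R b) - f (x + h *\<^sub>R a) + f x
         = h * (h * pd (pd f b) a (x + s2 *\<^sub>R b + t2 *\<^sub>R a))" by blast
    have "h * (h * pd (pd f a) b (x + s1 *\<^sub>R a + t1 *\<^sub>R b)) = h * (h * pd (pd f b) a (x + s2 *\<^sub>R b + t2 *\<^sub>R a))"
      unfolding 1(5)[symmetric] 2(5)[symmetric] by (simp add: algebra_simps)
    then have "pd (pd f a) b (x + s1 *\<^sub>R a + t1 *\<^sub>R b) = pd (pd f b) a (x + t2 *\<^sub>R a + s2 *\<^sub>R b)"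
      using h by (simp add: algebra_simps)
    then show ?thesis using 1 2 by blast
  qed
  define h where "h n = (r / M) / real (Suc n)" for n
  have rM: "0 < r / M" using r M by simp
  have h: "0 < h n" "h n \<le> r / M" for n
  proof -
    show "0 < h n" unfolding h_def using rM by (rule divide_pos_pos) simp
    have "(r / M) / real (Suc n) \<le> (r / M) / 1"
      by (rule divide_left_mono) (use rM in auto)
    then show "h n \<le> r / M" by (simp add: h_def)
  qed
  have hlim: "h \<longlonglongrightarrow> 0"
    unfolding h_def using lim_const_over_n[of "r/M", THEN LIMSEQ_Suc] by simp 
  have "\<forall>n. \<exists>\<tau>::real \<times> real \<times> real \<times> real. case \<tau> of (s1, t1, s2, t2) \<Rightarrow> 0 < s1 \<and> s1 < h n \<and> 0 < t1 \<and> t1 < h n \<and>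
      0 < s2 \<and> s2 < h n \<and> 0 < t2 \<and> t2 < h n \<and>
     pd (pd f a) b (x + s1 *\<^sub>R a + t1 *\<^sub>R b) = pd (pd f b) a (x + s2 *\<^sub>R a + t2 *\<^sub>R b)"
    using key[OF h] by simp
  then obtain \<tau> :: "nat \<Rightarrow> real \<times> real \<times> real \<times> real" where "\<And>n. case \<tau> n of (s1, t1, s2, t2) \<Rightarrow> 0 < s1 \<and> s1 < h n \<and> 0 < t1 \<and> t1 < h n \<and>
      0 < s2 \<and> s2 < h n \<and> 0 < t2 \<and> t2 < h n \<and>
     pd (pd f a) b (x + s1 *\<^sub>R a + t1 *\<^sub>R b) = pd (pd f b) a (x + s2 *\<^sub>R a + t2 *\<^sub>R b)"
    by (rule choice[THEN exE]) blast
  moreover define s1 t1 s2 t2 where "s1 n = fst (\<tau> n)" "t1 n = fst (snd (\<tau> n))"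
    "s2 n = fst (snd (snd (\<tau> n)))" "t2 n = snd (snd (snd (\<tau> n)))" for n
  ultimately have st: "0 < s1 n \<and> s1 n < h n \<and> 0 < t1 n \<and> t1 n < h n \<and> 
      0 < s2 n \<and> s2 n < h n \<and> 0 < t2 n \<and> t2 n < h n \<and>
     pd (pd f a) b (x + s1 n *\<^sub>R a + t1 n *\<^sub>R b) = pd (pd f b) a (x + s2 n *\<^sub>R a + t2 n *\<^sub>R b)" for n
    by (simp add: case_prod_beta)
  have lim: "s \<longlonglongrightarrow> 0" if "\<And>n. 0 < s n \<and> s n < h n" for s :: "nat \<Rightarrow> real"
    by (rule tendsto_sandwich[OF _ _ tendsto_const hlim]) (use that in \<open>auto intro!: always_eventually less_imp_le\<close>)
  have L: "(\<lambda>n. pd (pd f c) d (x + s n *\<^sub>R a + t n *\<^sub>R b)) \<longlonglongrightarrow> pd (pd f c) d x"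
    if "\<And>n. 0 < s n \<and> s n < h n" "\<And>n. 0 < t n \<and> t n < h n" for c d s t
  proof -
    have "isCont (pd (pd f c) d) x"
      using assms by (auto simp: continuous_on_eq_continuous_at)
    moreover have "(\<lambda>n. x + s n *\<^sub>R a + t n *\<^sub>R b) \<longlonglongrightarrow> x + 0 *\<^sub>R a + 0 *\<^sub>R b"
      by (intro tendsto_intros lim that)
    ultimately show ?thesis using isCont_tendsto_compose by fastforce
  qed
  from L[of s1 t1 a b] L[of s2 t2 b a] st show ?thesis
    using LIMSEQ_unique by simp
qed

section \<open>Gradients, integration by parts and convolution\<close>

text \<open>\<open>gradient\<close> is a definite description, so existence and uniqueness are both
  due: the vector of partial derivatives is a gradient, and pairing with the basis vectors shows
  that there is no other.\<close>

lemma gderiv_gradient: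
  assumes "f differentiable (at x)"
  shows "gderiv f x (gradient f x)" "pd f b x = gradient f x \<bullet> b"
proof -
  let ?D = "\<Sum>c\<in>Basis. pd f c x *\<^sub>R c"
  have "pd f h x = h \<bullet> ?D" for h
  proof -
    have "linear (\<lambda>h. pd f h x)"
      using has_derivative_linear[OF has_derivative_pd[OF assms]] .
    then have "pd f (\<Sum>c\<in>Basis. (h \<bullet> c) *\<^sub>R c) x = (\<Sum>c\<in>Basis. (h \<bullet> c) * pd f c x)"
      by (simp add: linear_sum[OF \<open>linear (\<lambda>h. pd f h x)\<close>] linear_cmul[OF \<open>linear (\<lambda>h. pd f h x)\<close>])
    then show ?thesis unfolding euclidean_representation by (simp add: inner_sum_right mult.commute)
  qed
  then have "(\<lambda>h. pd f h x) = (\<lambda>h. h \<bullet> ?D)" by (rule ext)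
  then have gD: "gderiv f x ?D"
    unfolding gderiv_def using has_derivative_pd[OF assms] by (simp only:)
  moreover have "D = ?D" if "gderiv f x D" for D
  proof (rule euclidean_eqI)
    fix c :: 'a assume "c \<in> Basis"
    show "D \<bullet> c = ?D \<bullet> c"
      using pd_eqI[OF that[unfolded gderiv_def], of c] pd_eqI[OF gD[unfolded gderiv_def], of c]
      by (metis inner_commute)
  qed
  ultimately have g: "gderiv f x (gradient f x)"
    unfolding gradient_def using gD by (rule_tac theI)
  then show "gderiv f x (gradient f x)" .
  show "pd f b x = gradient f x \<bullet> b"
    using pd_eqI[OF g[unfolded gderiv_def]] by (simp add: inner_commute)
qed

lemma gradient_eqI:
  assumes "f differentiable (at x)" "\<And>b. b \<in> Basis \<Longrightarrow> pd f b x = D \<bullet> b"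
  shows "gradient f x = D"
  by (rule euclidean_eqI) (simp add: gderiv_gradient(2)[OF assms(1), symmetric] assms(2))

lemma C1_on_imp_Ck_on:
  assumes "C1_on \<Omega> u"
  shows "Ck_on (Suc 0) \<Omega> u"
proof -
  have "continuous_on \<Omega> (pd u v)" for v
    using assms continuous_on_cong[of \<Omega> \<Omega> "pd u v" "\<lambda>x. gradient u x \<bullet> v"]
    by (auto simp: C1_on_def gderiv_gradient(2) intro!: continuous_intros)
  then show ?thesis using assms by (simp add: C1_on_def)
qed

lemma pd_linear:
  assumes "f differentiable (at x)"
  shows "pd f h x = (\<Sum>b\<in>Basis. (h \<bullet> b) * pd f b x)"
  unfolding gderiv_gradient(2)[OF assms]
  by (subst euclidean_inner) (simp add: mult.commute)

lemma inner_gradient: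
  assumes "f differentiable (at x)" "g differentiable (at x)"
  shows "gradient f x \<bullet> gradient g x = (\<Sum>b\<in>Basis. pd f b x * pd g b x)"
  unfolding gderiv_gradient(2)[OF assms(1)] gderiv_gradient(2)[OF assms(2)]
  by (rule euclidean_inner)

section \<open>Integrals of compactly supported functions and of their derivatives\<close>

lemma integrable_compact_support:
  fixes f :: "'a::euclidean_space \<Rightarrow> real"
  assumes "open G" "compact K" "K \<subseteq> G" "\<And>x. x \<notin> K \<Longrightarrow> f x = 0" "continuous_on G f"
  shows "integrable lborel f"
proof -
  have "set_integrable lborel K f"
    unfolding set_integrable_def using assms continuous_on_subset borel_integrable_compact by blast
  moreover have "(\<lambda>x. indicator K x *\<^sub>R f x) = f"
    using assms(4) by (intro ext) (auto simp: indicator_def)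
  ultimately show ?thesis by (simp add: set_integrable_def)
qed

lemma lborel_integral_shift:
  fixes f :: "'a::euclidean_space \<Rightarrow> real"
  assumes "f \<in> borel_measurable borel"
  shows "(\<integral>x. f (c + x) \<partial>lborel) = (\<integral>x. f x \<partial>lborel)"
proof -
  have "(\<integral>x. f x \<partial>lborel) = (\<integral>x. f x \<partial>(distr lborel borel ((+) c)))"
    by (simp add: lborel_distr_plus)
  also have "\<dots> = (\<integral>x. f (c + x) \<partial>lborel)"
    using assms by (subst integral_distr) auto
  finally show ?thesis by simp
qed

lemma lborel_integrable_shift:
  fixes f :: "'a::euclidean_space \<Rightarrow> real"
  assumes "integrable lborel f"
  shows "integrable lborel (\<lambda>x. f (c + x))"
proof -
  have "integrable (distr lborel borel ((+) c)) f"
    using assms by (simp add: lborel_distr_plus)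
  then show ?thesis
    by (subst (asm) integrable_distr_eq) (use assms in auto)
qed

lemma continuous_compact_support_bounded:
  fixes f :: "'a::euclidean_space \<Rightarrow> real"
  assumes "continuous_on UNIV f" "compact K" "\<And>x. x \<notin> K \<Longrightarrow> f x = 0"
  shows "\<exists>M>0. \<forall>x. \<bar>f x\<bar> \<le> M"
proof -
  have "bounded (f ` K)"
    by (intro compact_imp_bounded compact_continuous_image continuous_on_subset[OF assms(1)] assms(2)) simp
  then obtain M where M: "M > 0" "\<And>x. x \<in> K \<Longrightarrow> norm (f x) \<le> M"
    unfolding bounded_pos by blast
  have "\<bar>f x\<bar> \<le> M" for x
  proof (cases "x \<in> K")
    case True
    then show ?thesis using M(2)[of x] by simp
  next
    case False
    then show ?thesis using M(1) assms(3)[of x] by simp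
  qed
  with M(1) show ?thesis by blast
qed

text \<open>The form of the divergence theorem on which every integration by parts rests.
  Translation invariance makes the integral of each difference quotient vanish, and dominated
  convergence, with the bound on \<open>pd f b\<close> given by the mean value theorem, passes this
  on to the derivative.\<close>

lemma integral_pd_eq_0:
  fixes f :: "'a::euclidean_space \<Rightarrow> real"
  assumes f: "Ck_on (Suc 0) UNIV f" and K: "compact K" and out: "\<And>x. x \<notin> K \<Longrightarrow> f x = 0"
  shows "integrable lborel (pd f b)" "(\<integral>x. pd f b x \<partial>lborel) = 0"
proof -
  have cont: "continuous_on UNIV f" "continuous_on UNIV (pd f b)"
    using f Ck_on_imp_continuous[OF f] by auto
  have pd0: "pd f b x = 0" if "x \<notin> K" for x
    by (rule pd_zero_outside[OF compact_imp_closed[OF K] out that])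
  show int: "integrable lborel (pd f b)"
    by (rule integrable_compact_support[OF open_UNIV K _ pd0 cont(2)]) auto
  have intf: "integrable lborel f"
    by (rule integrable_compact_support[OF open_UNIV K _ out cont(1)]) auto
  obtain M where M: "M > 0" "\<And>x. \<bar>pd f b x\<bar> \<le> M"
    using continuous_compact_support_bounded[OF cont(2) K pd0] by auto
  obtain r where r: "r > 0" "K \<subseteq> cball 0 r"
    using K bounded_subset_ballD[OF compact_imp_bounded, of _ 0] ball_subset_cball by (metis subset_trans)
  define t where "t n = 1 / real (Suc n)" for n
  have t: "0 < t n" "t n \<le> 1" for n by (auto simp: t_def)
  have tlim: "t \<longlonglongrightarrow> 0" unfolding t_def using lim_const_over_n[of 1, THEN LIMSEQ_Suc] by simp
  define s where "s n x = (f (t n *\<^sub>R b + x) - f x) / t n" for n x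
  \<comment> \<open>As \<open>t n\<close> is at most 1, a point outside \<open>B\<close> and its
    translate by \<open>t n *\<^sub>R b\<close> both lie outside \<open>K\<close>, so one ball
    supports all the quotients.\<close>
  define B where "B = cball (0::'a) (r + norm b)"
  have df: "f differentiable (at x)" for x using f by auto
  have bound: "norm (s n x) \<le> indicator B x *\<^sub>R M" for n x
  proof (cases "x \<in> B")
    case True
    obtain \<tau> where "f (x + t n *\<^sub>R b) - f x = t n * pd f b (x + \<tau> *\<^sub>R b)"
      using mvt_along_line[OF t(1) df] by blast
    then have "s n x = pd f b (x + \<tau> *\<^sub>R b)"
      using t(1)[of n] by (simp add: s_def add.commute)
    then show ?thesis using M(2) True by simp
  next
    case False
    have "norm x - norm (t n *\<^sub>R b) \<le> norm (t n *\<^sub>R b + x)"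
      by (metis add.commute norm_diff_ineq)
    moreover have "norm (t n *\<^sub>R b) \<le> norm b"
      using t[of n] by (simp add: mult_left_le_one_le)
    moreover have "r + norm b < norm x" using False by (simp add: B_def)
    ultimately have "r < norm (t n *\<^sub>R b + x)" "r < norm x"
      using norm_ge_zero[of b] by linarith+
    then have "t n *\<^sub>R b + x \<notin> K" "x \<notin> K" using r(2) by fastforce+
    then show ?thesis using out False by (simp add: s_def)
  qed
  have "(\<lambda>n. \<integral>x. s n x \<partial>lborel) \<longlonglongrightarrow> (\<integral>x. pd f b x \<partial>lborel)"
  proof (rule integral_dominated_convergence[where w = "\<lambda>x. indicator B x *\<^sub>R M"])
    show "pd f b \<in> borel_measurable lborel" using int by auto
    show "s n \<in> borel_measurable lborel" for n
      unfolding s_def using borel_measurable_continuous_onI[OF cont(1)] by measurable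
    show "integrable lborel (\<lambda>x. indicator B x *\<^sub>R M)"
      unfolding B_def by (intro borel_integrable_compact) auto
    show "AE x in lborel. norm (s n x) \<le> indicator B x *\<^sub>R M" for n using bound by auto
    show "AE x in lborel. (\<lambda>n. s n x) \<longlonglongrightarrow> pd f b x"
    proof (intro AE_I2)
      fix x
      have "((\<lambda>h. (f (x + h *\<^sub>R b) - f x) / h) \<longlongrightarrow> pd f b x) (at 0)"
        using has_real_derivative_along_line[of f x 0 b] df by (simp add: DERIV_def)
      moreover have "filterlim t (at 0) sequentially"
        using tlim t(1) by (auto simp: filterlim_at less_imp_neq[symmetric] intro!: always_eventually) 
      ultimately show "(\<lambda>n. s n x) \<longlonglongrightarrow> pd f b x"
        unfolding s_def by (auto dest: filterlim_compose simp: add.commute)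
    qed
  qed
  moreover have "(\<integral>x. s n x \<partial>lborel) = 0" for n
    unfolding s_def using lborel_integral_shift[of f "t n *\<^sub>R b"] intf lborel_integrable_shift[OF intf, of "t n *\<^sub>R b"]
    by simp
  ultimately show "(\<integral>x. pd f b x \<partial>lborel) = 0"
    by (simp add: LIMSEQ_const_iff)
qed

section \<open>Convolution with a compactly supported kernel\<close>

lemma uniformly_continuous_compact_support:
  fixes f :: "'a::euclidean_space \<Rightarrow> 'b::euclidean_space"
  assumes f: "continuous_on UNIV f" and S: "compact S" "\<And>x. x \<notin> S \<Longrightarrow> f x = 0"
  shows "uniformly_continuous_on UNIV f"
  unfolding uniformly_continuous_on_def
proof (intro allI impI)
  fix e :: real assume e: "e > 0"
  obtain r where r: "r > 0" "S \<subseteq> cball 0 r"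
    using S(1) bounded_subset_ballD[OF compact_imp_bounded, of _ 0] ball_subset_cball by (metis subset_trans)
  have "uniformly_continuous_on (cball 0 (r + 1)) f"
    using f by (intro compact_uniformly_continuous) (auto intro: continuous_on_subset)
  then obtain d where d: "d > 0" 
    "\<And>x y. x \<in> cball 0 (r + 1) \<Longrightarrow> y \<in> cball 0 (r + 1) \<Longrightarrow> dist y x < d \<Longrightarrow> dist (f y) (f x) < e"
    using e unfolding uniformly_continuous_on_def by metis
  have "dist (f y) (f x) < e" if "dist y x < min d 1" for x y
  proof (cases "x \<in> S \<or> y \<in> S")
    case True
    have "norm x \<le> norm y + dist y x" "norm y \<le> norm x + dist y x"
      by (metis dist_norm norm_minus_commute norm_triangle_sub add.commute)+
    then have "x \<in> cball 0 (r + 1)" "y \<in> cball 0 (r + 1)" using True r that by auto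
    then show ?thesis using d(2) that by simp
  next
    case False
    then show ?thesis using S(2) e by simp
  qed
  then show "\<exists>d>0. \<forall>x\<in>UNIV. \<forall>y\<in>UNIV. dist y x < d \<longrightarrow> dist (f y) (f x) < e"
    using d(1) by (intro exI[of _ "min d 1"]) auto
qed

definition convol :: "('a::euclidean_space \<Rightarrow> real) \<Rightarrow> ('a \<Rightarrow> real) \<Rightarrow> 'a \<Rightarrow> real" where
  "convol K U x = (\<integral>y. K (x - y) * U y \<partial>lborel)"

lemma convol_integrable:
  fixes K U :: "'a::euclidean_space \<Rightarrow> real"
  assumes "continuous_on UNIV K" "compact S" "\<And>x. x \<notin> S \<Longrightarrow> K x = 0" "integrable lborel U"
  shows "integrable lborel (\<lambda>y. K (x - y) * U y)"
proof -
  obtain M where M: "M > 0" "\<And>x. \<bar>K x\<bar> \<le> M"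
    using continuous_compact_support_bounded[OF assms(1-3)] by auto
  show ?thesis
  proof (rule Bochner_Integration.integrable_bound)
    show "integrable lborel (\<lambda>y. M * U y)" using assms(4) by simp
    show "(\<lambda>y. K (x - y) * U y) \<in> borel_measurable lborel"
      using borel_measurable_continuous_onI[OF assms(1)] assms(4) by measurable
    have "norm (K (x - y) * U y) \<le> norm (M * U y)" for y
      using mult_right_mono[OF M(2)[of "x - y"], of "\<bar>U y\<bar>"] M(1) by (simp add: abs_mult)
    then show "AE y in lborel. norm (K (x - y) * U y) \<le> norm (M * U y)"
      by simp
  qed
qed

text \<open>The gradient of \<open>K\<close> is uniformly continuous because its support is compact.
  Hence the first-order remainder of \<open>K\<close> is small relative to the increment, uniformly
  in the base point, and can be integrated against |U|, where \<open>U\<close> is merely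
  integrable.\<close>

lemma convol_has_derivative:
  fixes K U :: "'a::euclidean_space \<Rightarrow> real"
  assumes K: "Ck_on (Suc 0) UNIV K" and S: "compact S" "\<And>x. x \<notin> S \<Longrightarrow> K x = 0" and U: "integrable lborel U"
  shows "(convol K U has_derivative (\<lambda>h. convol (pd K h) U x)) (at x)"
proof -
  have cont: "continuous_on UNIV K" "continuous_on UNIV (pd K b)" and dK: "K differentiable (at z)" for b z
    using K Ck_on_imp_continuous[OF K] by auto
  have pd0: "pd K b z = 0" if "z \<notin> S" for z b
    by (rule pd_zero_outside[OF compact_imp_closed[OF S(1)] S(2) that])
  note int = convol_integrable[OF cont(2) S(1) pd0 U] convol_integrable[OF cont(1) S U]
  have lin: "convol (pd K h) U x = (\<Sum>b\<in>Basis. (h \<bullet> b) * convol (pd K b) U x)" for h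
  proof -
    have "pd K h (x - y) * U y = (\<Sum>b\<in>Basis. (h \<bullet> b) * (pd K b (x - y) * U y))" for y
      by (subst pd_linear[OF dK]) (simp add: sum_distrib_right mult.assoc)
    then show ?thesis using int(1) by (simp add: convol_def)
  qed
  have bl: "bounded_linear (\<lambda>h. convol (pd K h) U x)"
  proof -
    have "(\<lambda>h. convol (pd K h) U x) = (\<lambda>h. \<Sum>b\<in>Basis. (h \<bullet> b) * convol (pd K b) U x)"
      by (rule ext) (rule lin)
    moreover have "bounded_linear (\<lambda>h::'a. \<Sum>b\<in>Basis. (h \<bullet> b) * convol (pd K b) U x)"
      by (intro bounded_linear_sum bounded_linear_mult_const bounded_linear_inner_left)
    ultimately show ?thesis by (simp only:)
  qed
  have unif: "uniformly_continuous_on UNIV (gradient K)"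
  proof (rule uniformly_continuous_compact_support[OF _ S(1)])
    show "gradient K z = 0" if "z \<notin> S" for z
      by (rule euclidean_eqI) (simp add: gderiv_gradient(2)[OF dK, symmetric] pd0[OF that])
    show "continuous_on UNIV (gradient K)"
      by (subst continuous_on_componentwise) (simp add: gderiv_gradient(2)[OF dK, symmetric] cont)
  qed
  define I where "I = (\<integral>y. \<bar>U y\<bar> \<partial>lborel)"
  have I: "I \<ge> 0" unfolding I_def by simp
  show ?thesis unfolding has_derivative_at_alt
  proof (intro conjI allI impI bl)
    fix e :: real assume e: "e > 0"
    \<comment> \<open>The summand 1 avoids a division by zero when \<open>U\<close> vanishes almost
      everywhere.\<close>
    define e' where "e' = e / (I + 1)"
    have e': "e' > 0" "e' * I \<le> e" using e I by (auto simp: e'_def field_simps)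
    obtain d where d: "d > 0" "\<And>z z'. dist z' z < d \<Longrightarrow> dist (gradient K z') (gradient K z) < e'"
      using unif e'(1) unfolding uniformly_continuous_on_def by (metis UNIV_I)
    show "\<exists>d>0. \<forall>y. norm (y - x) < d \<longrightarrow>
            norm (convol K U y - convol K U x - convol (pd K (y - x)) U x) \<le> e * norm (y - x)"
    proof (intro exI[of _ d] conjI allI impI d(1))
      fix x' assume x': "norm (x' - x) < d"
      define h where "h = x' - x"
      have est: "\<bar>K (z + h) - K z - pd K h z\<bar> \<le> e' * norm h" for z
      proof -
        obtain s where s: "0 < s" "s < 1" "K (z + 1 *\<^sub>R h) - K z = 1 * pd K h (z + s *\<^sub>R h)"
          using mvt_along_line[OF zero_less_one dK] by blast
        have "K (z + h) - K z - pd K h z = (gradient K (z + s *\<^sub>R h) - gradient K z) \<bullet> h"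
          using s(3) by (simp add: gderiv_gradient(2)[OF dK] inner_diff_left)
        then have "\<bar>K (z + h) - K z - pd K h z\<bar> \<le> dist (gradient K (z + s *\<^sub>R h)) (gradient K z) * norm h"
          by (simp add: dist_norm Cauchy_Schwarz_ineq2)
        also have "\<dots> \<le> e' * norm h"
        proof (rule mult_right_mono[OF less_imp_le[OF d(2)]])
          have "s * norm h \<le> 1 * norm h" using s by (intro mult_right_mono) auto
          then show "dist (z + s *\<^sub>R h) z < d" using s x' by (simp add: dist_norm h_def)
        qed simp
        finally show ?thesis .
      qed
      have ptw: "\<bar>(K (x' - y) - K (x - y) - pd K h (x - y)) * U y\<bar> \<le> e' * norm h * \<bar>U y\<bar>" for y
      proof -
        have "x - y + h = x' - y" by (simp add: h_def)
        then show ?thesis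
          using mult_right_mono[OF est[of "x - y"], of "\<bar>U y\<bar>"] by (simp only: abs_mult abs_ge_zero simp_thms)
      qed
      have "convol K U x' - convol K U x - convol (pd K h) U x =
         (\<integral>y. (K (x' - y) - K (x - y) - pd K h (x - y)) * U y \<partial>lborel)"
        unfolding convol_def using int by (simp add: left_diff_distrib)
      also have "\<bar>\<dots>\<bar> \<le> (\<integral>y. \<bar>(K (x' - y) - K (x - y) - pd K h (x - y)) * U y\<bar> \<partial>lborel)"
        by (rule integral_abs_bound)
      also have "\<dots> \<le> (\<integral>y. e' * norm h * \<bar>U y\<bar> \<partial>lborel)"
        using int U ptw by (intro integral_mono) (auto simp: left_diff_distrib)
      also have "\<dots> = (e' * I) * norm h" by (simp add: I_def)
      also have "\<dots> \<le> e * norm h" using e' by (intro mult_right_mono) auto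
      finally show "norm (convol K U x' - convol K U x - convol (pd K (x' - x)) U x) \<le> e * norm (x' - x)"
        by (simp add: h_def)
    qed
  qed
qed

text \<open>One order is given away: in the base case continuity of the convolution is read off from
  its differentiability. This costs nothing for smooth kernels.\<close>

lemma Ck_on_convol:
  fixes K U :: "'a::euclidean_space \<Rightarrow> real"
  assumes "Ck_on (Suc k) UNIV K" "compact S" "\<And>x. x \<notin> S \<Longrightarrow> K x = 0" "integrable lborel U"
  shows "Ck_on k UNIV (convol K U)"
  using assms(1,3)
proof (induction k arbitrary: K)
  case 0
  have "\<And>x. convol K U differentiable (at x)"
    using convol_has_derivative[OF 0(1) assms(2) 0(2) assms(4)] differentiableI by blast
  then show ?case
    by (auto intro!: differentiable_imp_continuous_on simp: differentiable_on_def differentiable_at_withinI)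
next
  case (Suc k)
  have K: "Ck_on (Suc 0) UNIV K" using Ck_on_le[OF Suc.prems(1), of "Suc 0"] by simp
  note der = convol_has_derivative[OF K assms(2) Suc.prems(2) assms(4)]
  have "Ck_on k UNIV (convol (pd K v) U)" for v
    using Suc.prems by (intro Suc.IH pd_zero_outside[OF compact_imp_closed[OF assms(2)]]) auto
  moreover have "pd (convol K U) v = convol (pd K v) U" for v
    using pd_eqI[OF der] by blast
  ultimately show ?case using differentiableI[OF der] by simp
qed

lemma pd_convol:
  fixes K U :: "'a::euclidean_space \<Rightarrow> real"
  assumes "Ck_on (Suc 0) UNIV K" "compact S" "\<And>x. x \<notin> S \<Longrightarrow> K x = 0" "integrable lborel U"
  shows "pd (convol K U) b = convol (pd K b) U"
  using pd_eqI[OF convol_has_derivative[OF assms]] by blast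

lemma pd_reflect:
  assumes "K differentiable (at (x - y))"
  shows "(\<lambda>y. K (x - y)) differentiable (at y)" "pd (\<lambda>y. K (x - y)) b y = - pd K b (x - y)"
proof -
  have "((\<lambda>y. x - y) has_derivative (\<lambda>h. - h)) (at y)" by (auto intro!: derivative_eq_intros)
  from has_derivative_compose[OF this has_derivative_pd[OF assms]]
  have *: "((\<lambda>y. K (x - y)) has_derivative (\<lambda>h. pd K (- h) (x - y))) (at y)" .
  show "(\<lambda>y. K (x - y)) differentiable (at y)" using * by (rule differentiableI)
  show "pd (\<lambda>y. K (x - y)) b y = - pd K b (x - y)"
    using pd_eqI[OF *] gderiv_gradient(2)[OF assms] by simp
qed

lemma Ck_on_reflect: "Ck_on k UNIV K \<Longrightarrow> Ck_on k UNIV (\<lambda>y. K (x - y))"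
proof (induction k arbitrary: K)
  case 0
  have "continuous_on UNIV (\<lambda>y. x - y)" by (intro continuous_intros)
  then show ?case using 0 continuous_on_compose2[of UNIV K UNIV "\<lambda>y. x - y"] by simp
next
  case (Suc k)
  have "pd (\<lambda>y. K (x - y)) v = (\<lambda>y. -1 * pd K v (x - y))" for v
    using pd_reflect(2)[of K x] Suc.prems by auto
  moreover have "Ck_on k UNIV (\<lambda>y. -1 * pd K v (x - y))" for v
    using Suc.prems by (intro Ck_on_mult Ck_on_const Suc.IH) auto
  ultimately show ?case using pd_reflect(1)[of K x] Suc.prems by simp
qed

text \<open>The product of the reflected kernel and \<open>u\<close> is supported in a ball inside
  \<Omega>, so its extension by zero is globally C^1 and its derivative integrates to zero. The sign
  of the integration by parts cancels against the one produced by the reflection.\<close>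

lemma integral_by_parts_kernel:
  fixes K u :: "'a::euclidean_space \<Rightarrow> real"
  assumes K: "Ck_on (Suc 0) UNIV K" "\<And>x. x \<notin> cball 0 \<epsilon> \<Longrightarrow> K x = 0"
    and u: "open \<Omega>" "Ck_on (Suc 0) \<Omega> u" and x: "cball x \<epsilon> \<subseteq> \<Omega>"
  shows "(\<integral>y. pd K b (x - y) * u y \<partial>lborel) = (\<integral>y. K (x - y) * pd u b y \<partial>lborel)"
    "integrable lborel (\<lambda>y. K (x - y) * pd u b y)" "integrable lborel (\<lambda>y. pd K b (x - y) * u y)"
proof -
  have K': "K (x - y) = 0" "pd K b (x - y) = 0" if "y \<notin> cball x \<epsilon>" for y
  proof -
    have "x - y \<notin> cball 0 \<epsilon>" using that by (simp add: dist_norm norm_minus_commute)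
    then show "K (x - y) = 0" "pd K b (x - y) = 0"
      using K(2) pd_zero_outside[of "cball 0 \<epsilon>" K] by auto
  qed
  note R = Ck_on_reflect[OF K(1), of x]
  have Rc: "continuous_on \<Omega> (\<lambda>y. K (x - y))" "continuous_on \<Omega> (\<lambda>y. pd K b (x - y))"
    using Ck_on_imp_continuous[OF R] Ck_on_reflect[of 0 "pd K b" x] K(1)
    by (auto intro: continuous_on_subset)
  have uc: "continuous_on \<Omega> u" "continuous_on \<Omega> (pd u b)"
    using Ck_on_imp_continuous[OF u(2)] u(2) by auto
  define f where "f y = K (x - y) * u y" for y
  have "Ck_on (Suc 0) \<Omega> f" unfolding f_def
    by (intro Ck_on_mult u Ck_on_subset[OF R]) auto
  then have f: "Ck_on (Suc 0) UNIV f"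
    using K' by (intro Ck_on_extend[OF u(1) closed_cball x]) (auto simp: f_def)
  show i1: "integrable lborel (\<lambda>y. K (x - y) * pd u b y)"
    by (rule integrable_compact_support[OF u(1) compact_cball x]) (auto simp: K' intro!: continuous_intros Rc uc)
  show i2: "integrable lborel (\<lambda>y. pd K b (x - y) * u y)"
    by (rule integrable_compact_support[OF u(1) compact_cball x]) (auto simp: K' intro!: continuous_intros Rc uc)
  have "pd f b y = K (x - y) * pd u b y - pd K b (x - y) * u y" for y
  proof (cases "y \<in> \<Omega>")
    case True
    then show ?thesis using pd_mult[of "\<lambda>y. K (x - y)" y u b] pd_reflect(1)[of K x y] pd_reflect(2)[of K x y b] K(1) u(2)
      by (simp add: f_def[abs_def])
  next
    case False
    then have "y \<notin> cball x \<epsilon>" using x by blast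
    moreover have "pd f b y = 0"
      by (rule pd_zero_outside[of "cball x \<epsilon>"]) (use K' \<open>y \<notin> cball x \<epsilon>\<close> in \<open>auto simp: f_def\<close>)
    ultimately show ?thesis using K' by simp
  qed
  moreover have "(\<integral>y. pd f b y \<partial>lborel) = 0"
    by (rule integral_pd_eq_0(2)[OF f compact_cball[of x \<epsilon>]]) (simp add: f_def K')
  ultimately have "(\<integral>y. K (x - y) * pd u b y - pd K b (x - y) * u y \<partial>lborel) = 0"
    by simp
  then show "(\<integral>y. pd K b (x - y) * u y \<partial>lborel) = (\<integral>y. K (x - y) * pd u b y \<partial>lborel)"
    using i1 i2 by simp
qed

section \<open>Mollifiers\<close>

text \<open>The derivative of \<open>flat j\<close> is a combination of \<open>flat (j + 2)\<close> and \<open>flat (j + 1)\<close>, so that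
  smoothness of the whole family follows by one induction on the order of differentiability.\<close>

definition flat :: "nat \<Rightarrow> real \<Rightarrow> real" where
  "flat j t = (if t > 0 then exp (- 1 / t) / t ^ j else 0)"

text \<open>exp (1/t) is at least (1 + 1/(n t))^n, hence at least (1/(n t))^n, with n = j + 2. Of
  these n powers, \<open>j\<close> compensate the denominator of \<open>flat j\<close>, and the
  remaining two make the difference quotient at 0 tend to 0.\<close>

lemma flat_bound: "\<bar>flat j t\<bar> \<le> real (j + 2) ^ (j + 2) * t\<^sup>2"
proof (cases "t > 0")
  case True
  let ?n = "j + 2"
  have "(1 / t / real ?n) ^ ?n \<le> (1 + (1 / t) / real ?n) ^ ?n"
    using True by (intro power_mono) auto
  also have "\<dots> \<le> exp (1 / t)"
    using True by (intro exp_ge_one_plus_x_over_n_power_n) (auto intro: order_trans[of _ 0])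
  finally have "inverse (exp (1 / t)) \<le> inverse ((1 / t / real ?n) ^ ?n)"
    using True by (intro le_imp_inverse_le) auto
  moreover have "inverse ((1 / t / real ?n) ^ ?n) = t ^ ?n * real ?n ^ ?n"
    by (simp only: power_divide power_one) (simp add: inverse_eq_divide del: power_Suc power_add)
  ultimately have "exp (- 1 / t) \<le> t ^ ?n * real ?n ^ ?n"
    by (simp add: exp_minus del: power_Suc)
  then have "exp (- 1 / t) / t ^ j \<le> (t ^ ?n * real ?n ^ ?n) / t ^ j"
    using True by (intro divide_right_mono) auto
  also have "\<dots> = real ?n ^ ?n * t\<^sup>2" using True by (simp add: power_add power2_eq_square)
  finally show ?thesis using True by (simp add: flat_def)
qed (simp add: flat_def)

lemma flat_has_real_derivative:
  "(flat j has_real_derivative (flat (j + 2) t - real j * flat (j + 1) t)) (at t)"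
proof -
  consider "t > 0" | "t < 0" | "t = 0" by linarith
  then show ?thesis
  proof cases
    case 1
    have "((\<lambda>t. exp (- 1 / t) / t ^ j) has_real_derivative 
       (exp (- 1 / t) * (1 / t\<^sup>2) * t ^ j - exp (- 1 / t) * (real j * t ^ (j - 1))) / (t ^ j * t ^ j)) (at t)"
      using 1 by (auto intro!: derivative_eq_intros simp: power2_eq_square)
    moreover have "(exp (- 1 / t) * (1 / t\<^sup>2) * t ^ j - exp (- 1 / t) * (real j * t ^ (j - 1))) / (t ^ j * t ^ j)
        = flat (j + 2) t - real j * flat (j + 1) t"
      using 1 by (cases j) (auto simp: flat_def field_simps power2_eq_square)
    ultimately have "((\<lambda>t. exp (- 1 / t) / t ^ j) has_real_derivative (flat (j + 2) t - real j * flat (j + 1) t)) (at t)"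
      by simp
    then show ?thesis
      by (rule has_field_derivative_transform_within_open[of _ _ _ "{0<..}"]) (use 1 in \<open>auto simp: flat_def\<close>)
  next
    case 2
    have "((\<lambda>t. 0) has_real_derivative (flat (j + 2) t - real j * flat (j + 1) t)) (at t)"
      using 2 by (simp add: flat_def)
    then show ?thesis
      by (rule has_field_derivative_transform_within_open[of _ _ _ "{..<0}"]) (use 2 in \<open>auto simp: flat_def\<close>)
  next
    case 3
    define M where "M = real (j + 2) ^ (j + 2)"
    have "(\<lambda>h. flat j h / h) \<midarrow>0\<rightarrow> 0"
    proof (rule Lim_null_comparison)
      show "\<forall>\<^sub>F h in at 0. norm (flat j h / h) \<le> M * \<bar>h\<bar>"
      proof (rule always_eventually, rule allI)
        fix h :: real
        show "norm (flat j h / h) \<le> M * \<bar>h\<bar>"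
        proof (cases "h = 0")
          case False
          have "\<bar>flat j h\<bar> / \<bar>h\<bar> \<le> (M * h\<^sup>2) / \<bar>h\<bar>"
            using flat_bound[of j h] by (intro divide_right_mono) (auto simp: M_def)
          also have "\<dots> = M * \<bar>h\<bar>" using False by (simp add: power2_eq_square abs_if)
          finally show ?thesis by simp
        qed simp
      qed
      show "(\<lambda>h. M * \<bar>h\<bar>) \<midarrow>0\<rightarrow> 0" by (auto intro!: tendsto_eq_intros)
    qed
    then have "(flat j has_real_derivative 0) (at 0)"
      by (simp add: DERIV_def flat_def)
    then show ?thesis using 3 by (simp add: flat_def)
  qed
qed

text \<open>The squared norm is a polynomial, so no problem arises at the origin. A derivative is a
  combination of functions of the same kind times a linear function, which is why \<open>j\<close>
  is generalised in the induction.\<close>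

lemma Ck_on_flat_radial: "Ck_on k UNIV (\<lambda>x::'a::euclidean_space. flat j (a - x \<bullet> x))"
proof (induction k arbitrary: j)
  case 0
  have "continuous_on UNIV (flat j)"
    by (auto intro!: DERIV_continuous_on flat_has_real_derivative)
  then show ?case
    by (auto intro!: continuous_on_compose2[of UNIV "flat j" UNIV "\<lambda>x::'a. a - x \<bullet> x"] continuous_intros)
next
  case (Suc k)
  have d: "((\<lambda>x::'a. a - x \<bullet> x) has_derivative (\<lambda>h. - 2 * (x \<bullet> h))) (at x)" for x
    by (auto intro!: derivative_eq_intros simp: inner_commute)
  have der: "((\<lambda>x::'a. flat j (a - x \<bullet> x)) has_derivative
     (\<lambda>h. (flat (j + 2) (a - x \<bullet> x) - real j * flat (j + 1) (a - x \<bullet> x)) * (- 2 * (x \<bullet> h)))) (at x)" for x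
    using has_derivative_compose[OF d flat_has_real_derivative[unfolded has_field_derivative_def]] by simp
  have "pd (\<lambda>x::'a. flat j (a - x \<bullet> x)) v = 
     (\<lambda>x. (flat (j + 2) (a - x \<bullet> x) - real j * flat (j + 1) (a - x \<bullet> x)) * (- 2 * (x \<bullet> v)))" for v
    using pd_eqI[OF der] by blast
  moreover have "Ck_on k UNIV (\<lambda>x::'a. (flat (j + 2) (a - x \<bullet> x) - real j * flat (j + 1) (a - x \<bullet> x)) * (- 2 * (x \<bullet> v)))" for v
    by (intro Ck_on_mult Ck_on_diff Ck_on_const Ck_on_inner Suc.IH open_UNIV)
  ultimately show ?case using differentiableI[OF der] by simp
qed

lemma integral_ge_ball:
  fixes f :: "'a::euclidean_space \<Rightarrow> real"
  assumes "integrable lborel f" "\<And>y. f y \<ge> 0" "\<And>y. y \<in> ball x r \<Longrightarrow> f y \<ge> c"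
  shows "(\<integral>y. f y \<partial>lborel) \<ge> c * measure lborel (ball x r)"
proof -
  have "c * measure lborel (ball x r) = (\<integral>y. c * indicator (ball x r) y \<partial>lborel)"
    by simp
  also have "\<dots> \<le> (\<integral>y. f y \<partial>lborel)"
  proof (intro integral_mono)
    show "integrable lborel (\<lambda>y. c * indicator (ball x r) y)"
      by (intro integrable_mult_right integrable_real_indicator) (use emeasure_bounded_finite[OF bounded_ball, of x r] in auto)
  qed (use assms in \<open>auto simp: indicator_def\<close>)
  finally show ?thesis .
qed

definition mollifier :: "real \<Rightarrow> 'a::euclidean_space \<Rightarrow> real" where
  "mollifier \<epsilon> x = flat 0 (\<epsilon>\<^sup>2 - x \<bullet> x) * (1 / (\<integral>y. flat 0 (\<epsilon>\<^sup>2 - y \<bullet> (y::'a)) \<partial>lborel))"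

lemma flat_nonneg: "flat 0 t \<ge> 0" by (simp add: flat_def)

lemma flat_radial_outside: "\<epsilon> > 0 \<Longrightarrow> x \<notin> cball 0 \<epsilon> \<Longrightarrow> flat 0 (\<epsilon>\<^sup>2 - x \<bullet> x) = 0"
proof -
  assume "\<epsilon> > 0" "x \<notin> cball 0 \<epsilon>"
  then have "\<epsilon>\<^sup>2 \<le> (norm x)\<^sup>2" by (intro power_mono) auto
  then show ?thesis by (simp add: flat_def dot_square_norm)
qed

lemma Ck_on_mollifier: "Ck_on k UNIV (mollifier \<epsilon>)"
  unfolding mollifier_def by (intro Ck_on_mult Ck_on_flat_radial Ck_on_const open_UNIV)

lemma mollifier_outside: "\<epsilon> > 0 \<Longrightarrow> x \<notin> cball 0 \<epsilon> \<Longrightarrow> mollifier \<epsilon> x = 0"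
  unfolding mollifier_def by (subst flat_radial_outside) auto

lemma flat_radial_integral_pos:
  assumes "\<epsilon> > 0"
  shows "integrable lborel (\<lambda>y::'a::euclidean_space. flat 0 (\<epsilon>\<^sup>2 - y \<bullet> y))"
    "(\<integral>y. flat 0 (\<epsilon>\<^sup>2 - y \<bullet> (y::'a)) \<partial>lborel) > 0"
proof -
  show int: "integrable lborel (\<lambda>y::'a. flat 0 (\<epsilon>\<^sup>2 - y \<bullet> y))"
    by (rule integrable_compact_support[OF open_UNIV compact_cball[of 0 \<epsilon>] subset_UNIV flat_radial_outside[OF assms]])
      (use Ck_on_flat_radial[of 0 0 "\<epsilon>\<^sup>2"] in auto)
  \<comment> \<open>The value on the sphere of radius \<epsilon>/2; by monotonicity it bounds the
    bump from below on the ball inside.\<close>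
  define c where "c = exp (- 1 / (\<epsilon>\<^sup>2 - (\<epsilon>/2)\<^sup>2))"
  have "flat 0 (\<epsilon>\<^sup>2 - y \<bullet> y) \<ge> c" if "y \<in> ball 0 (\<epsilon>/2)" for y :: 'a
  proof -
    have "(norm y)\<^sup>2 \<le> (\<epsilon>/2)\<^sup>2" using that by (intro power_mono) auto
    moreover have "0 < \<epsilon>\<^sup>2 - (\<epsilon>/2)\<^sup>2" using assms by (simp add: power2_eq_square)
    ultimately show ?thesis
      by (auto simp: flat_def c_def dot_square_norm intro!: divide_left_mono)
  qed
  then have "(\<integral>y. flat 0 (\<epsilon>\<^sup>2 - y \<bullet> (y::'a)) \<partial>lborel) \<ge> c * measure lborel (ball (0::'a) (\<epsilon>/2))"
    by (intro integral_ge_ball int flat_nonneg)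
  moreover have "c * measure lborel (ball (0::'a) (\<epsilon>/2)) > 0"
    using assms content_ball_pos[of "\<epsilon>/2" "0::'a"] by (simp add: c_def)
  ultimately show "(\<integral>y. flat 0 (\<epsilon>\<^sup>2 - y \<bullet> (y::'a)) \<partial>lborel) > 0" by linarith
qed

lemma mollifier_nonneg: "\<epsilon> > 0 \<Longrightarrow> mollifier \<epsilon> (x::'a::euclidean_space) \<ge> 0"
  using flat_radial_integral_pos(2)[of \<epsilon>, where 'a='a] by (simp add: mollifier_def flat_nonneg)

lemma mollifier_integral:
  fixes x :: "'a::euclidean_space"
  assumes "\<epsilon> > 0"
  shows "integrable lborel (\<lambda>y. mollifier \<epsilon> (x - y))" "(\<integral>y. mollifier \<epsilon> (x - y) \<partial>lborel) = 1"
proof -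
  have int: "integrable lborel (mollifier \<epsilon> :: 'a \<Rightarrow> real)"
    unfolding mollifier_def by (intro integrable_mult_left flat_radial_integral_pos assms)
  have sym: "mollifier \<epsilon> (x - y) = mollifier \<epsilon> (- x + y)" for y
  proof -
    have "(x - y) \<bullet> (x - y) = (- x + y) \<bullet> (- x + y)" by (simp add: algebra_simps inner_commute)
    then show ?thesis by (simp add: mollifier_def)
  qed
  show "integrable lborel (\<lambda>y. mollifier \<epsilon> (x - y))"
    unfolding sym by (rule lborel_integrable_shift[OF int])
  have "(\<integral>y. mollifier \<epsilon> (x - y) \<partial>lborel) = (\<integral>y. mollifier \<epsilon> (y::'a) \<partial>lborel)"
    unfolding sym by (rule lborel_integral_shift) (use int in auto)
  also have "\<dots> = 1"
    using flat_radial_integral_pos[OF assms, where 'a='a] by (simp add: mollifier_def)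
  finally show "(\<integral>y. mollifier \<epsilon> (x - y) \<partial>lborel) = 1" .
qed

lemma test_function_mollifier:
  assumes "\<epsilon> > 0" "cball x \<epsilon> \<subseteq> \<Omega>"
  shows "test_function \<Omega> (\<lambda>y. mollifier \<epsilon> (x - y))"
proof -
  have out: "mollifier \<epsilon> (x - y) = 0" if "y \<notin> cball x \<epsilon>" for y
    using that by (intro mollifier_outside[OF assms(1)]) (simp add: dist_norm norm_minus_commute)
  have "closure {y. mollifier \<epsilon> (x - y) \<noteq> 0} \<subseteq> cball x \<epsilon>"
    by (intro closure_minimal subsetI closed_cball) (use out in blast)
  moreover have "compact (closure {y. mollifier \<epsilon> (x - y) \<noteq> 0})"
    using calculation bounded_cball bounded_subset compact_eq_bounded_closed closed_closure by metis
  ultimately show ?thesis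
    using assms(2) Ck_on_reflect[OF Ck_on_mollifier, where x = x]
    by (auto simp: test_function_def Ck_on_UNIV)
qed

text \<open>The kernel is nonnegative with mass one, and its support shrinks to a point, so the
  error is at most the oscillation of \<open>g\<close> over small balls. Since \<open>g\<close> is
  controlled only on \<open>D\<close>, uniform continuity is taken on a compact neighbourhood of
  \<open>K\<close> inside \<open>D\<close>.\<close>

lemma mollifier_uniform_limit:
  fixes g :: "'a::euclidean_space \<Rightarrow> real"
  assumes D: "open D" "continuous_on D g" and K: "compact K" "K \<subseteq> D"
  shows "uniform_limit K (\<lambda>n x. \<integral>y. mollifier (1 / real (Suc n)) (x - y) * g y \<partial>lborel) g sequentially"
    "\<forall>\<^sub>F n in sequentially. \<forall>x\<in>K. cball x (1 / real (Suc n)) \<subseteq> D"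
proof -
  obtain r where r: "r > 0" "(\<Union>x\<in>K. cball x r) \<subseteq> D"
    using compact_subset_open_imp_cball_epsilon_subset[OF K(1) D(1) K(2)] by blast
  have small: "\<forall>\<^sub>F n in sequentially. 1 / real (Suc n) < d" if "d > 0" for d
    using lim_const_over_n[of 1, THEN LIMSEQ_Suc] that by (auto intro: order_tendstoD)
  from small[OF r(1)] show "\<forall>\<^sub>F n in sequentially. \<forall>x\<in>K. cball x (1 / real (Suc n)) \<subseteq> D"
  proof eventually_elim
    case (elim n)
    then have "cball x (1 / real (Suc n)) \<subseteq> cball x r" for x :: 'a by (intro subset_cball) simp
    then show ?case using r(2) by blast
  qed
  have "compact (\<Union>x\<in>K. cball x r)"
    by (rule compact_minkowski_sum_cball[OF K(1)])
  then have uc: "uniformly_continuous_on (\<Union>x\<in>K. cball x r) g"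
    using D(2) r(2) by (intro compact_uniformly_continuous) (auto intro: continuous_on_subset)
  show "uniform_limit K (\<lambda>n x. \<integral>y. mollifier (1 / real (Suc n)) (x - y) * g y \<partial>lborel) g sequentially"
    unfolding uniform_limit_iff
  proof (intro allI impI)
    fix e :: real assume e: "e > 0"
    obtain d where d: "d > 0" "\<And>x y. x \<in> (\<Union>x\<in>K. cball x r) \<Longrightarrow> y \<in> (\<Union>x\<in>K. cball x r) \<Longrightarrow> dist y x < d \<Longrightarrow> dist (g y) (g x) < e / 2"
      using uc half_gt_zero[OF e] unfolding uniformly_continuous_on_def by metis
    from small[of "min d r"] d(1) r(1)
    have "\<forall>\<^sub>F n in sequentially. 1 / real (Suc n) < min d r" by simp
    then show "\<forall>\<^sub>F n in sequentially. \<forall>x\<in>K. dist (\<integral>y. mollifier (1 / real (Suc n)) (x - y) * g y \<partial>lborel) (g x) < e"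
    proof (eventually_elim, intro ballI)
      case (elim n)
      fix x assume x: "x \<in> K"
      define \<epsilon> where "\<epsilon> = 1 / real (Suc n)"
      have \<epsilon>: "\<epsilon> > 0" "\<epsilon> < d" "\<epsilon> < r" using elim by (auto simp: \<epsilon>_def)
      have sub: "cball x \<epsilon> \<subseteq> D" using r(2) x \<epsilon>(3) subset_cball[of \<epsilon> r x] by fastforce
      have out: "mollifier \<epsilon> (x - y) = 0" if "y \<notin> cball x \<epsilon>" for y
        using that by (intro mollifier_outside[OF \<epsilon>(1)]) (simp add: dist_norm norm_minus_commute)
      have mc: "continuous_on D (\<lambda>y. mollifier \<epsilon> (x - y))"
        using Ck_on_reflect[OF Ck_on_mollifier, of 0 \<epsilon> x] by (auto intro: continuous_on_subset)
      have int: "integrable lborel (\<lambda>y. mollifier \<epsilon> (x - y) * g y)"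
        by (rule integrable_compact_support[OF D(1) compact_cball sub]) 
          (auto simp: out intro!: continuous_intros mc D(2))
      note mi = mollifier_integral[OF \<epsilon>(1), of x]
      have ptw: "\<bar>mollifier \<epsilon> (x - y) * g y - mollifier \<epsilon> (x - y) * g x\<bar> \<le> mollifier \<epsilon> (x - y) * (e / 2)" for y
      proof (cases "y \<in> cball x \<epsilon>")
        case True
        have "dist (g y) (g x) < e / 2"
          using True \<epsilon> x r(1) by (intro d(2)) (auto simp: dist_commute intro!: bexI[of _ x])
        then have "mollifier \<epsilon> (x - y) * \<bar>g y - g x\<bar> \<le> mollifier \<epsilon> (x - y) * (e / 2)"
          by (intro mult_left_mono mollifier_nonneg \<epsilon>) (simp add: dist_real_def)
        then show ?thesis
          using mollifier_nonneg[OF \<epsilon>(1), of "x - y"] by (simp add: abs_mult right_diff_distrib[symmetric])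
      qed (simp add: out)
      have "(\<integral>y. mollifier \<epsilon> (x - y) * g y \<partial>lborel) - g x 
          = (\<integral>y. mollifier \<epsilon> (x - y) * g y - mollifier \<epsilon> (x - y) * g x \<partial>lborel)"
        using int mi by simp
      also have "\<bar>\<dots>\<bar> \<le> (\<integral>y. \<bar>mollifier \<epsilon> (x - y) * g y - mollifier \<epsilon> (x - y) * g x\<bar> \<partial>lborel)"
        by (rule integral_abs_bound)
      also have "\<dots> \<le> (\<integral>y. mollifier \<epsilon> (x - y) * (e / 2) \<partial>lborel)"
        using int mi ptw by (intro integral_mono) auto
      also have "\<dots> = e / 2" using mi by simp
      finally show "dist (\<integral>y. mollifier (1 / real (Suc n)) (x - y) * g y \<partial>lborel) (g x) < e"
        using e by (simp add: dist_real_def \<epsilon>_def)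
    qed
  qed
qed

section \<open>Smooth approximation of weak solutions\<close>

text \<open>At points with nonzero gradient the conventions of \<open>epow\<close> coincide with
  \<open>powr\<close>, and the singular case does not occur.\<close>

lemma source_eq:
  assumes "u x > 0" "gradient u x \<noteq> 0"
  shows "enn2real (source p q u x) = u x powr p * norm (gradient u x) powr q"
proof -
  have "epow (u x) p = ennreal (u x powr p)" "epow (norm (gradient u x)) q = ennreal (norm (gradient u x) powr q)"
    using assms by (auto simp: epow_def)
  then show ?thesis by (simp add: source_def ennreal_mult[symmetric])
qed

text \<open>The weak equation is tested with the reflected mollifier centred at \<open>x\<close>.
  The left side is the Laplacian of the mollified \<open>u\<close>, with one derivative on the
  kernel and the other left on \<open>u\<close>, which has only one to offer. As the ball avoids the
  zeros of the gradient, the source is continuous on it.\<close>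

lemma mollified_equation:
  fixes u :: "'a::euclidean_space \<Rightarrow> real"
  assumes \<Omega>: "open \<Omega>" and sol: "positive_solution \<Omega> p q u"
    and \<epsilon>: "\<epsilon> > 0" "cball x \<epsilon> \<subseteq> {y \<in> \<Omega>. gradient u y \<noteq> 0}"
  shows "(\<integral>y. (\<Sum>b\<in>Basis. pd (mollifier \<epsilon>) b (x - y) * pd u b y) \<partial>lborel)
       = - (\<integral>y. mollifier \<epsilon> (x - y) * (u y powr p * norm (gradient u y) powr q) \<partial>lborel)"
proof -
  define D where "D = {y \<in> \<Omega>. gradient u y \<noteq> 0}"
  define K where "K = (mollifier \<epsilon> :: 'a \<Rightarrow> real)"
  have C1: "C1_on \<Omega> u" and pos: "\<And>y. y \<in> \<Omega> \<Longrightarrow> u y > 0" using sol by (auto simp: positive_solution_def)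
  have u1: "Ck_on (Suc 0) \<Omega> u" by (rule C1_on_imp_Ck_on[OF C1])
  have du: "u differentiable (at y)" if "y \<in> \<Omega>" for y using u1 that by simp
  have K1: "Ck_on (Suc 0) UNIV K" and dK: "K differentiable (at z)" for z
    using Ck_on_mollifier[of "Suc 0" \<epsilon>, where 'a='a] by (simp_all add: K_def)
  have Kout: "K z = 0" if "z \<notin> cball 0 \<epsilon>" for z
    using mollifier_outside[OF \<epsilon>(1) that] by (simp add: K_def)
  have xO: "cball x \<epsilon> \<subseteq> \<Omega>" using \<epsilon>(2) by auto
  have out: "K (x - y) = 0" "pd K b (x - y) = 0" if "y \<notin> cball x \<epsilon>" for y b
  proof -
    have "x - y \<notin> cball 0 \<epsilon>" using that by (simp add: dist_norm norm_minus_commute)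
    then show "K (x - y) = 0" "pd K b (x - y) = 0"
      using Kout pd_zero_outside[where f = K, OF closed_cball Kout] by blast+
  qed
  define \<psi> where "\<psi> y = K (x - y)" for y
  have "test_function \<Omega> \<psi>"
    unfolding \<psi>_def K_def by (rule test_function_mollifier[OF \<epsilon>(1) xO])
  then have weak: "(LINT x:\<Omega>|lebesgue. gradient u x \<bullet> gradient \<psi> x) = (LINT x:\<Omega>|lebesgue. enn2real (source p q u x) * \<psi> x)"
    using sol by (simp add: positive_solution_def)
  have d\<psi>: "\<psi> differentiable (at y)" "pd \<psi> b y = - pd K b (x - y)" for y b
    unfolding \<psi>_def[abs_def] by (rule pd_reflect[OF dK])+
  define G where "G y = - (\<Sum>b\<in>Basis. pd K b (x - y) * pd u b y)" for y
  have L: "indicator \<Omega> y *\<^sub>R (gradient u y \<bullet> gradient \<psi> y) = G y" for y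
  proof (cases "y \<in> \<Omega>")
    case True
    then show ?thesis
      by (simp add: G_def inner_gradient[OF du d\<psi>(1)] d\<psi>(2) sum_negf mult.commute)
  next
    case False
    then have "y \<notin> cball x \<epsilon>" using xO by blast
    then show ?thesis using False by (simp add: G_def out(2))
  qed
  have f: "indicator \<Omega> y *\<^sub>R (enn2real (source p q u y) * \<psi> y) = K (x - y) * (u y powr p * norm (gradient u y) powr q)" for y
  proof (cases "y \<in> cball x \<epsilon>")
    case True
    then have "y \<in> \<Omega>" "gradient u y \<noteq> 0" using \<epsilon>(2) by auto
    then show ?thesis using source_eq[of u y p q] pos by (simp add: \<psi>_def)
  qed (simp add: \<psi>_def out)
  have gc: "continuous_on \<Omega> (gradient u)" "continuous_on \<Omega> u"
    using C1 Ck_on_imp_continuous[OF u1] by (auto simp: C1_on_def)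
  have "D = \<Omega> \<inter> gradient u -` (- {0})" by (auto simp: D_def)
  then have Do: "open D" using continuous_open_preimage[OF gc(1) \<Omega>, of "-{0}"] by auto
  \<comment> \<open>Both sides of the weak equation are first written with integrands that are
    integrable for \<open>lborel\<close>; \<open>integral_completion\<close> then replaces
    \<open>lebesgue\<close> by \<open>lborel\<close>.\<close>
  have "integrable lborel G"
  proof (rule integrable_compact_support[OF \<Omega> compact_cball xO])
    show "continuous_on \<Omega> G" unfolding G_def
      using u1 Ck_on_reflect[of 0 "pd K b" x for b] K1 
      by (intro continuous_intros) (auto intro: continuous_on_subset)
  qed (simp add: G_def out)
  then have 1: "(LINT x:\<Omega>|lebesgue. gradient u x \<bullet> gradient \<psi> x) = (\<integral>y. G y \<partial>lborel)"
    unfolding set_lebesgue_integral_def L by (intro integral_completion) auto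
  have "integrable lborel (\<lambda>y. K (x - y) * (u y powr p * norm (gradient u y) powr q))"
  proof (rule integrable_compact_support[OF Do compact_cball \<epsilon>(2)[folded D_def]])
    have "continuous_on D (\<lambda>y. K (x - y))"
      using Ck_on_imp_continuous[OF Ck_on_reflect[OF K1]] by (auto intro: continuous_on_subset)
    moreover have "continuous_on D u" "continuous_on D (gradient u)"
      using gc by (auto intro: continuous_on_subset simp: D_def)
    ultimately show "continuous_on D (\<lambda>y. K (x - y) * (u y powr p * norm (gradient u y) powr q))"
      using pos by (intro continuous_intros) (auto simp: D_def less_imp_neq[symmetric])
  qed (simp add: out)
  then have 2: "(LINT x:\<Omega>|lebesgue. enn2real (source p q u x) * \<psi> x)
     = (\<integral>y. K (x - y) * (u y powr p * norm (gradient u y) powr q) \<partial>lborel)"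
    unfolding set_lebesgue_integral_def f by (intro integral_completion) auto
  show ?thesis using weak unfolding 1 2 by (simp add: G_def[abs_def] K_def)
qed

text \<open>As \<open>u\<close> is only C^1, nothing is claimed about the convergence of individual
  second derivatives. The Laplacian does converge, because by the equation it is the mollification
  of the continuous source term.\<close>

lemma smooth_approximation:
  fixes u :: "'a::euclidean_space \<Rightarrow> real"
  assumes \<Omega>: "open \<Omega>" and sol: "positive_solution \<Omega> p q u"
    and K: "compact K" "K \<subseteq> {y \<in> \<Omega>. gradient u y \<noteq> 0}"
  obtains U where "\<And>n k. Ck_on k UNIV (U n)" "uniform_limit K U u sequentially"
    "\<And>b. uniform_limit K (\<lambda>n. pd (U n) b) (pd u b) sequentially"
    "uniform_limit K (\<lambda>n x. \<Sum>b\<in>Basis. pd (pd (U n) b) b x) 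
       (\<lambda>x. - (u x powr p * norm (gradient u x) powr q)) sequentially"
proof -
  define D where "D = {y \<in> \<Omega>. gradient u y \<noteq> 0}"
  have C1: "C1_on \<Omega> u" and pos: "\<And>y. y \<in> \<Omega> \<Longrightarrow> u y > 0" using sol by (auto simp: positive_solution_def)
  have u1: "Ck_on (Suc 0) \<Omega> u" by (rule C1_on_imp_Ck_on[OF C1])
  have gc: "continuous_on \<Omega> (gradient u)" "continuous_on \<Omega> u"
    using C1 Ck_on_imp_continuous[OF u1] by (auto simp: C1_on_def)
  have "D = \<Omega> \<inter> gradient u -` (- {0})" by (auto simp: D_def)
  then have Do: "open D" using continuous_open_preimage[OF gc(1) \<Omega>, of "-{0}"] by auto
  have D\<Omega>: "D \<subseteq> \<Omega>" by (auto simp: D_def)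
  note uD = Ck_on_subset[OF u1 D\<Omega>]
  obtain r where r: "r > 0" "(\<Union>x\<in>K. cball x r) \<subseteq> D"
    using compact_subset_open_imp_cball_epsilon_subset[OF K(1) Do K(2)[folded D_def]] by blast
  \<comment> \<open>\<open>u\<close> is cut off to the compact set \<open>K2\<close>, which makes it
    integrable on the whole space; the open set \<open>B\<close> between \<open>K\<close> and
    \<open>K2\<close> is where kernels with small support do not notice the cut.\<close>
  define K2 where "K2 = (\<Union>x\<in>K. cball x r)"
  define B where "B = (\<Union>x\<in>K. ball x r)"
  have K2: "compact K2" "K2 \<subseteq> D" using compact_minkowski_sum_cball[OF K(1)] r(2) by (auto simp: K2_def)
  have B: "open B" "K \<subseteq> B" "B \<subseteq> K2" using r(1) by (auto simp: B_def K2_def)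
  define W where "W y = indicator K2 y *\<^sub>R u y" for y
  have W: "integrable lborel W"
    unfolding W_def[abs_def] using gc(2) K2 D\<Omega> by (intro borel_integrable_compact) (auto intro: continuous_on_subset)
  define \<epsilon> where "\<epsilon> n = 1 / real (Suc n)" for n
  have \<epsilon>: "\<epsilon> n > 0" for n by (simp add: \<epsilon>_def)
  define \<rho> :: "nat \<Rightarrow> 'a \<Rightarrow> real" where "\<rho> n = mollifier (\<epsilon> n)" for n
  have \<rho>: "Ck_on k UNIV (\<rho> n)" for k n unfolding \<rho>_def by (rule Ck_on_mollifier)
  have \<rho>0: "\<rho> n z = 0" if "z \<notin> cball 0 (\<epsilon> n)" for n z
    using mollifier_outside[OF \<epsilon> that] by (simp add: \<rho>_def)
  have \<rho>1: "Ck_on k UNIV (pd (\<rho> n) b)" for k n b using \<rho>[of "Suc k" n] by simp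
  have \<rho>10: "pd (\<rho> n) b z = 0" if "z \<notin> cball 0 (\<epsilon> n)" for n z b
    by (rule pd_zero_outside[OF closed_cball \<rho>0 that])
  have \<rho>20: "pd (pd (\<rho> n) b) b z = 0" if "z \<notin> cball 0 (\<epsilon> n)" for n z b
    by (rule pd_zero_outside[OF closed_cball \<rho>10 that])
  define U where "U n = convol (\<rho> n) W" for n
  have ev: "\<forall>\<^sub>F n in sequentially. \<forall>x\<in>K. cball x (\<epsilon> n) \<subseteq> B"
    \<comment> \<open>Only the inclusion of small balls is wanted here, so the function to be
      mollified is taken to be zero.\<close>
    unfolding \<epsilon>_def by (rule mollifier_uniform_limit(2)[OF B(1) _ K(1) B(2), of "\<lambda>x. 0"]) simp
  have conv: "convol \<kappa> W x = (\<integral>y. \<kappa> (x - y) * u y \<partial>lborel)"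
    if "cball x (\<epsilon> n) \<subseteq> B" "\<And>z. z \<notin> cball 0 (\<epsilon> n) \<Longrightarrow> \<kappa> z = 0" for \<kappa> x n
  proof -
    have "\<kappa> (x - y) * W y = \<kappa> (x - y) * u y" for y
    proof (cases "y \<in> cball x (\<epsilon> n)")
      case True
      then have "y \<in> K2" using that(1) B(3) by blast
      then show ?thesis by (simp add: W_def)
    next
      case False
      then have "x - y \<notin> cball 0 (\<epsilon> n)" by (simp add: dist_norm norm_minus_commute)
      then show ?thesis using that(2) by simp
    qed
    then show ?thesis unfolding convol_def by (intro Bochner_Integration.integral_cong) auto
  qed
  have pdU: "pd (U n) b = convol (pd (\<rho> n) b) W" for n b
    unfolding U_def by (rule pd_convol[OF \<rho> compact_cball \<rho>0 W])
  have pdpdU: "pd (pd (U n) b) b = convol (pd (pd (\<rho> n) b) b) W" for n b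
    unfolding pdU by (rule pd_convol[OF \<rho>1 compact_cball \<rho>10 W])
  show thesis
  proof
    show "Ck_on k UNIV (U n)" for k n
      unfolding U_def by (rule Ck_on_convol[OF \<rho> compact_cball \<rho>0 W])
    show "uniform_limit K U u sequentially"
    proof (subst uniform_limit_cong[of K U "\<lambda>n x. \<integral>y. mollifier (1 / real (Suc n)) (x - y) * u y \<partial>lborel" _ u u])
      show "\<forall>\<^sub>F n in sequentially. \<forall>x\<in>K. U n x = (\<integral>y. mollifier (1 / real (Suc n)) (x - y) * u y \<partial>lborel)"
        using ev
      proof (eventually_elim, intro ballI)
        fix n x assume *: "\<forall>x\<in>K. cball x (\<epsilon> n) \<subseteq> B" "x \<in> K"
        have "U n x = (\<integral>y. \<rho> n (x - y) * u y \<partial>lborel)"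
          unfolding U_def by (rule conv[OF _ \<rho>0]) (use * in auto)
        then show "U n x = (\<integral>y. mollifier (1 / real (Suc n)) (x - y) * u y \<partial>lborel)"
          by (simp add: \<rho>_def \<epsilon>_def)
      qed
      show "uniform_limit K (\<lambda>n x. \<integral>y. mollifier (1 / real (Suc n)) (x - y) * u y \<partial>lborel) u sequentially"
        using gc(2) D\<Omega> K by (intro mollifier_uniform_limit(1)[OF Do]) (auto intro: continuous_on_subset simp: D_def)
    qed auto
    show "uniform_limit K (\<lambda>n. pd (U n) b) (pd u b) sequentially" for b
    proof (subst uniform_limit_cong[of K _ "\<lambda>n x. \<integral>y. mollifier (1 / real (Suc n)) (x - y) * pd u b y \<partial>lborel" _ "pd u b" "pd u b"])
      show "\<forall>\<^sub>F n in sequentially. \<forall>x\<in>K. pd (U n) b x = (\<integral>y. mollifier (1 / real (Suc n)) (x - y) * pd u b y \<partial>lborel)"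
        using ev
      proof (eventually_elim, intro ballI)
        fix n x assume *: "\<forall>x\<in>K. cball x (\<epsilon> n) \<subseteq> B" "x \<in> K"
        have "pd (U n) b x = (\<integral>y. pd (\<rho> n) b (x - y) * u y \<partial>lborel)"
          unfolding pdU by (rule conv[OF _ \<rho>10]) (use * in auto)
        also have "\<dots> = (\<integral>y. \<rho> n (x - y) * pd u b y \<partial>lborel)"
          by (rule integral_by_parts_kernel(1)[OF \<rho> \<rho>0 Do uD]) (use * B(3) K2(2) in auto)
        finally show "pd (U n) b x = (\<integral>y. mollifier (1 / real (Suc n)) (x - y) * pd u b y \<partial>lborel)"
          by (simp add: \<rho>_def \<epsilon>_def)
      qed
      show "uniform_limit K (\<lambda>n x. \<integral>y. mollifier (1 / real (Suc n)) (x - y) * pd u b y \<partial>lborel) (pd u b) sequentially"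
        using uD K by (intro mollifier_uniform_limit(1)[OF Do]) (auto simp: D_def)
    qed auto
    let ?f = "\<lambda>x. - (u x powr p * norm (gradient u x) powr q)"
    show "uniform_limit K (\<lambda>n x. \<Sum>b\<in>Basis. pd (pd (U n) b) b x) ?f sequentially"
    proof (subst uniform_limit_cong[of K _ "\<lambda>n x. \<integral>y. mollifier (1 / real (Suc n)) (x - y) * ?f y \<partial>lborel" _ ?f ?f])
      show "\<forall>\<^sub>F n in sequentially. \<forall>x\<in>K. (\<Sum>b\<in>Basis. pd (pd (U n) b) b x) = (\<integral>y. mollifier (1 / real (Suc n)) (x - y) * ?f y \<partial>lborel)"
        using ev
      proof (eventually_elim, intro ballI)
        fix n x assume *: "\<forall>x\<in>K. cball x (\<epsilon> n) \<subseteq> B" "x \<in> K"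
        then have sub: "cball x (\<epsilon> n) \<subseteq> D" using B(3) K2(2) by blast
        have "pd (pd (U n) b) b x = (\<integral>y. pd (\<rho> n) b (x - y) * pd u b y \<partial>lborel)" for b
        proof -
          have "pd (pd (U n) b) b x = (\<integral>y. pd (pd (\<rho> n) b) b (x - y) * u y \<partial>lborel)"
            unfolding pdpdU by (rule conv[OF _ \<rho>20]) (use * in auto)
          also have "\<dots> = (\<integral>y. pd (\<rho> n) b (x - y) * pd u b y \<partial>lborel)"
            by (rule integral_by_parts_kernel(1)[OF \<rho>1 \<rho>10 Do uD sub])
          finally show ?thesis .
        qed
        then have "(\<Sum>b\<in>Basis. pd (pd (U n) b) b x) = (\<integral>y. (\<Sum>b\<in>Basis. pd (\<rho> n) b (x - y) * pd u b y) \<partial>lborel)"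
          using integral_by_parts_kernel(2)[OF \<rho>1 \<rho>10 Do uD sub] by simp
        also have "\<dots> = - (\<integral>y. mollifier (\<epsilon> n) (x - y) * (u y powr p * norm (gradient u y) powr q) \<partial>lborel)"
          unfolding \<rho>_def by (rule mollified_equation[OF \<Omega> sol \<epsilon> sub[unfolded D_def]])
        finally show "(\<Sum>b\<in>Basis. pd (pd (U n) b) b x) = (\<integral>y. mollifier (1 / real (Suc n)) (x - y) * ?f y \<partial>lborel)"
          by (simp add: \<epsilon>_def)
      qed
      have "continuous_on D u" "continuous_on D (gradient u)"
        using gc D\<Omega> by (auto intro: continuous_on_subset)
      then have "continuous_on D ?f"
        using pos by (intro continuous_intros) (auto simp: D_def less_imp_neq[symmetric])
      then show "uniform_limit K (\<lambda>n x. \<integral>y. mollifier (1 / real (Suc n)) (x - y) * ?f y \<partial>lborel) ?f sequentially"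
        using K by (intro mollifier_uniform_limit(1)[OF Do]) (auto simp: D_def)
    qed auto
  qed
qed

section \<open>The Bernstein inequality\<close>

definition laplacian :: "('a::euclidean_space \<Rightarrow> real) \<Rightarrow> 'a \<Rightarrow> real" where
  "laplacian f x = (\<Sum>b\<in>Basis. pd (pd f b) b x)"

lemma pd_cmult:
  assumes "f differentiable (at x)"
  shows "pd (\<lambda>x. c * f x) b x = c * pd f b x"
  using pd_mult[of "\<lambda>x. c" x f b] assms by (simp add: pd_const)

text \<open>The positive part itself has a corner at \<open>k\<close>; its square is C^1, as
  integration by parts against it demands.\<close>

lemma DERIV_positive_part_sq:
  "((\<lambda>t::real. (max 0 (t - k))\<^sup>2) has_real_derivative 2 * max 0 (t - k)) (at t)"
proof -
  consider "t > k" | "t < k" | "t = k" by linarith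
  then show ?thesis
  proof cases
    case 1
    have "((\<lambda>t. (t - k)\<^sup>2) has_real_derivative 2 * max 0 (t - k)) (at t)"
      using 1 by (auto intro!: derivative_eq_intros)
    then show ?thesis
      by (rule has_field_derivative_transform_within_open[of _ _ _ "{k<..}"]) (use 1 in auto)
  next
    case 2
    have "((\<lambda>t. 0) has_real_derivative 2 * max 0 (t - k)) (at t)"
      using 2 by auto
    then show ?thesis
      by (rule has_field_derivative_transform_within_open[of _ _ _ "{..<k}"]) (use 2 in auto)
  next
    case 3
    have "(\<lambda>h. ((max 0 h)\<^sup>2) / h) \<midarrow>0\<rightarrow> (0::real)"
    proof (rule Lim_null_comparison)
      show "\<forall>\<^sub>F h in at 0. norm ((max 0 h)\<^sup>2 / h) \<le> \<bar>h::real\<bar>"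
        by (intro always_eventually allI) (auto simp: power2_eq_square max_def)
      show "(\<lambda>h::real. \<bar>h\<bar>) \<midarrow>0\<rightarrow> 0" by (auto intro!: tendsto_eq_intros)
    qed
    then show ?thesis using 3 by (simp add: DERIV_def)
  qed
qed

text \<open>Bochner's formula in Euclidean space. Third derivatives occur because the Laplacian has
  to be commuted with one derivative of \<open>v\<close>.\<close>

lemma laplacian_gradient_sq:
  fixes v :: "'a::euclidean_space \<Rightarrow> real"
  assumes G: "open G" and v: "Ck_on (Suc (Suc (Suc 0))) G v" and x: "x \<in> G"
  defines "z \<equiv> \<lambda>x. \<Sum>c\<in>Basis. pd v c x * pd v c x"
  shows "pd z b x = (\<Sum>c\<in>Basis. 2 * (pd v c x * pd (pd v c) b x))"
    "laplacian z x = 2 * (\<Sum>b\<in>Basis. \<Sum>c\<in>Basis. (pd (pd v c) b x)\<^sup>2)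
        + 2 * (\<Sum>c\<in>Basis. pd v c x * pd (laplacian v) c x)"
proof -
  have d1: "pd v c differentiable (at y)" and d2: "pd (pd v c) b differentiable (at y)" if "y \<in> G" for c b y
    using v that by simp_all
  have z1: "pd z b y = (\<Sum>c\<in>Basis. 2 * (pd v c y * pd (pd v c) b y))" if "y \<in> G" for y b
    unfolding z_def using d1[OF that]
    by (subst pd_sum) (auto simp: pd_mult mult.commute intro!: sum.cong)
  then show "pd z b x = (\<Sum>c\<in>Basis. 2 * (pd v c x * pd (pd v c) b x))" using x by blast
  have z2: "pd (pd z b) b x = (\<Sum>c\<in>Basis. 2 * ((pd (pd v c) b x)\<^sup>2 + pd v c x * pd (pd (pd v c) b) b x))" for b
  proof -
    have "pd (pd z b) b x = pd (\<lambda>y. \<Sum>c\<in>Basis. 2 * (pd v c y * pd (pd v c) b y)) b x"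
      by (rule pd_cong_open(2)[OF G x z1])
    also have "\<dots> = (\<Sum>c\<in>Basis. pd (\<lambda>y. 2 * (pd v c y * pd (pd v c) b y)) b x)"
      using d1[OF x] d2[OF x] by (intro pd_sum) simp
    also have "\<dots> = (\<Sum>c\<in>Basis. 2 * ((pd (pd v c) b x)\<^sup>2 + pd v c x * pd (pd (pd v c) b) b x))"
      using d1[OF x] d2[OF x] by (intro sum.cong refl) (simp add: pd_cmult pd_mult power2_eq_square)
    finally show ?thesis .
  qed
  \<comment> \<open>Two transpositions move \<open>c\<close> from the innermost to the outermost
    place: the first is applied to \<open>v\<close> and then differentiated, the second is applied
    to \<open>pd v b\<close>.\<close>
  have swap: "pd (pd (pd v c) b) b x = pd (pd (pd v b) b) c x" for b c
  proof -
    have "Ck_on (Suc (Suc 0)) G v" using Ck_on_SucD[OF v] .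
    then have "pd (pd (pd v c) b) b x = pd (pd (pd v b) c) b x"
      by (intro pd_cong_open(2)[OF G x] pd_commute[OF G])
    also have "\<dots> = pd (pd (pd v b) b) c x"
      using v by (intro pd_commute[OF G _ x]) simp
    finally show ?thesis .
  qed
  have "pd (laplacian v) c x = (\<Sum>b\<in>Basis. pd (pd (pd v b) b) c x)" for c
    unfolding laplacian_def[abs_def] using d2[OF x] by (rule pd_sum)
  then have l: "pd (laplacian v) c x = (\<Sum>b\<in>Basis. pd (pd (pd v c) b) b x)" for c
    by (simp add: swap)
  have "laplacian z x = 2 * (\<Sum>b\<in>Basis. \<Sum>c\<in>Basis. (pd (pd v c) b x)\<^sup>2)
        + 2 * (\<Sum>b\<in>Basis. \<Sum>c\<in>Basis. pd v c x * pd (pd (pd v c) b) b x)"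
    unfolding laplacian_def z2 by (simp add: sum.distrib sum_distrib_left distrib_left)
  also have "(\<Sum>b\<in>Basis. \<Sum>c\<in>Basis. pd v c x * pd (pd (pd v c) b) b x) = (\<Sum>c\<in>Basis. pd v c x * pd (laplacian v) c x)"
    by (subst sum.swap) (simp add: l sum_distrib_left)
  finally show "laplacian z x = 2 * (\<Sum>b\<in>Basis. \<Sum>c\<in>Basis. (pd (pd v c) b x)\<^sup>2)
        + 2 * (\<Sum>c\<in>Basis. pd v c x * pd (laplacian v) c x)" .
qed

lemma laplacian_mult:
  fixes f g :: "'a::euclidean_space \<Rightarrow> real"
  assumes G: "open G" and f: "Ck_on (Suc (Suc 0)) G f" "Ck_on (Suc (Suc 0)) G g" and x: "x \<in> G"
  shows "laplacian (\<lambda>x. f x * g x) x = laplacian f x * g x + 2 * (gradient f x \<bullet> gradient g x) + f x * laplacian g x"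
proof -
  have d: "f differentiable (at y)" "g differentiable (at y)" "pd f b differentiable (at y)" "pd g b differentiable (at y)"
    if "y \<in> G" for y b using f that by simp_all
  have "pd (pd (\<lambda>x. f x * g x) b) b x = pd (pd f b) b x * g x + 2 * (pd f b x * pd g b x) + f x * pd (pd g b) b x" for b
  proof -
    have "pd (pd (\<lambda>x. f x * g x) b) b x = pd (\<lambda>y. f y * pd g b y + pd f b y * g y) b x"
      by (rule pd_cong_open(2)[OF G x]) (use d in \<open>simp add: pd_mult\<close>)
    also have "\<dots> = pd (pd f b) b x * g x + 2 * (pd f b x * pd g b x) + f x * pd (pd g b) b x"
      using d[OF x] by (simp add: pd_add pd_mult)
    finally show ?thesis .
  qed
  then show ?thesis
    using d[OF x] by (simp add: laplacian_def inner_gradient sum.distrib sum_distrib_left sum_distrib_right)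
qed

text \<open>The term containing \<open>e\<close> in the vector field is there to cancel the derivative of \<open>e\<close> that
  occurs in \<open>laplacian w\<close>.\<close>

lemma divergence_test_field:
  fixes w v e \<eta> :: "'a::euclidean_space \<Rightarrow> real" and k :: real
  assumes G: "open G" and w: "Ck_on (Suc (Suc 0)) G w" and v: "Ck_on (Suc (Suc 0)) G v"
    and e: "Ck_on (Suc 0) G e" and \<eta>: "Ck_on (Suc 0) G \<eta>" and x: "x \<in> G"
  defines "X \<equiv> \<lambda>b x. (max 0 (w x - k))\<^sup>2 * (pd w b x - 2 * (e x * (\<eta> x * pd v b x)))"
    and "h \<equiv> max 0 (w x - k)"
  shows "(\<Sum>b\<in>Basis. pd (X b) b x) = 2 * h * (gradient w x \<bullet> gradient w x)
      + h\<^sup>2 * (laplacian w x - 2 * \<eta> x * (gradient v x \<bullet> gradient e x))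
      - 2 * e x * (h\<^sup>2 * \<eta> x * laplacian v x + h\<^sup>2 * (gradient \<eta> x \<bullet> gradient v x) + 2 * h * \<eta> x * (gradient w x \<bullet> gradient v x))"
    "Ck_on (Suc 0) G (X b)"
proof -
  have d: "w differentiable (at y)" "v differentiable (at y)" "e differentiable (at y)" "\<eta> differentiable (at y)"
    "pd w b differentiable (at y)" "pd v b differentiable (at y)" if "y \<in> G" for y b
    using w v e \<eta> that by simp_all
  define H where "H y = (max 0 (w y - k))\<^sup>2" for y
  have H: "(H has_derivative (\<lambda>b. 2 * max 0 (w y - k) * pd w b y)) (at y)" if "y \<in> G" for y
    unfolding H_def[abs_def]
    by (rule has_derivative_compose_real[where \<phi> = "\<lambda>t. (max 0 (t - k))\<^sup>2" and f = w, OF d(1)[OF that] DERIV_positive_part_sq])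
  have Hpd: "pd H b y = 2 * max 0 (w y - k) * pd w b y" if "y \<in> G" for y b
    using pd_eqI[OF H[OF that]] .
  have dH: "H differentiable (at y)" if "y \<in> G" for y using H[OF that] by (rule differentiableI)
  have "continuous_on G (pd H b)" for b
  proof (subst continuous_on_cong[OF refl Hpd])
    have "Ck_on (Suc 0) G (pd w b)" using w by simp
    from Ck_on_imp_continuous[OF w] Ck_on_imp_continuous[OF this]
    show "continuous_on G (\<lambda>y. 2 * max 0 (w y - k) * pd w b y)"
      by (intro continuous_intros)
  qed
  then have HC: "Ck_on (Suc 0) G H" using dH by simp
  have XH: "X b = (\<lambda>y. H y * (pd w b y - 2 * (e y * (\<eta> y * pd v b y))))" for b
    by (simp add: X_def H_def)
  show "Ck_on (Suc 0) G (X b)"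
    unfolding XH using w v e \<eta> by (intro Ck_on_mult Ck_on_diff Ck_on_const G HC) auto
  have "pd (X b) b x = h\<^sup>2 * (pd (pd w b) b x - 2 * (e x * (\<eta> x * pd (pd v b) b x + pd \<eta> b x * pd v b x) + pd e b x * (\<eta> x * pd v b x)))
     + 2 * h * pd w b x * (pd w b x - 2 * (e x * (\<eta> x * pd v b x)))" for b
    unfolding XH using d[OF x] dH[OF x]
    by (simp add: pd_mult pd_diff pd_const Hpd[OF x]) (simp add: H_def h_def)
  then have "(\<Sum>b\<in>Basis. pd (X b) b x) = (\<Sum>b\<in>Basis. 
      2 * h * (pd w b x * pd w b x) + h\<^sup>2 * pd (pd w b) b x - 2 * h\<^sup>2 * \<eta> x * (pd v b x * pd e b x)
     - 2 * e x * h\<^sup>2 * \<eta> x * pd (pd v b) b x - 2 * e x * h\<^sup>2 * (pd \<eta> b x * pd v b x) 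
     - 4 * e x * h * \<eta> x * (pd w b x * pd v b x))"
    by (intro sum.cong) (auto simp: algebra_simps)
  also have "\<dots> = 2 * h * (gradient w x \<bullet> gradient w x) + h\<^sup>2 * laplacian w x - 2 * h\<^sup>2 * \<eta> x * (gradient v x \<bullet> gradient e x)
     - 2 * e x * h\<^sup>2 * \<eta> x * laplacian v x - 2 * e x * h\<^sup>2 * (gradient \<eta> x \<bullet> gradient v x) 
     - 4 * e x * h * \<eta> x * (gradient w x \<bullet> gradient v x)"
    unfolding laplacian_def using d[OF x]
    by (simp add: sum.distrib sum_subtractf sum_distrib_left inner_gradient)
  finally show "(\<Sum>b\<in>Basis. pd (X b) b x) = 2 * h * (gradient w x \<bullet> gradient w x)
      + h\<^sup>2 * (laplacian w x - 2 * \<eta> x * (gradient v x \<bullet> gradient e x))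
      - 2 * e x * (h\<^sup>2 * \<eta> x * laplacian v x + h\<^sup>2 * (gradient \<eta> x \<bullet> gradient v x) + 2 * h * \<eta> x * (gradient w x \<bullet> gradient v x))"
    by (simp add: algebra_simps)
qed

text \<open>The pointwise algebra of the Bernstein argument, with y = \<nabla>w, n = \<nabla>\<eta>,
  g = \<nabla>v, \<zeta> = \<nabla>z, T = |D^2 v|^2, L = \<Delta>\<eta>, f + e = \<Delta>v and h =
  (w - k)_+. The vector \<zeta> is eliminated by \<eta>\<zeta> = y - z n, which leaves terms without
  derivatives of w, terms linear in y and terms containing e. The good term 2 h |y|^2, which stems
  from differentiating h^2, absorbs the linear ones.\<close>

lemma divergence_lower_bound:
  fixes n g y \<zeta> :: "'a::real_inner" and z \<eta> h e f Fv Fz T L N B \<delta>0 :: real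
  assumes y: "y = z *\<^sub>R n + \<eta> *\<^sub>R \<zeta>" and \<eta>: "\<eta> > 0" and h: "h \<ge> 0" and N: "N > 0"
    and T: "T \<ge> (f + e)\<^sup>2 / N"
    and zero_order: "z * L - 2 * z * (n \<bullet> n) / \<eta> + 2 * \<eta> * (f\<^sup>2 / N + Fv * z) - 2 * z * Fz * (g \<bullet> n) \<ge> \<delta>0"
    and B: "norm ((2 / \<eta>) *\<^sub>R n + (2 * Fz) *\<^sub>R g) \<le> B" 
       "\<bar>4 * \<eta> * f / N - 2 * \<eta> * (f + e) - 2 * (n \<bullet> g)\<bar> \<le> B" "4 * \<eta> * norm g \<le> B"
    and small: "B\<^sup>2 * h \<le> \<delta>0" "4 * B * \<bar>e\<bar> \<le> \<delta>0"
  shows "2 * h * (y \<bullet> y) + h\<^sup>2 * (z * L + 2 * (n \<bullet> \<zeta>) + 2 * \<eta> * T + 2 * \<eta> * Fv * z + 2 * \<eta> * Fz * (g \<bullet> \<zeta>))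
     - 2 * e * (h\<^sup>2 * \<eta> * (f + e) + h\<^sup>2 * (n \<bullet> g) + 2 * h * \<eta> * (y \<bullet> g))
    \<ge> \<delta>0 / 2 * h\<^sup>2 - \<delta>0 / 4 * e\<^sup>2" (is "?D \<ge> _")
proof -
  define V where "V = (2 / \<eta>) *\<^sub>R n + (2 * Fz) *\<^sub>R g"
  define q where "q = 4 * \<eta> * f / N - 2 * \<eta> * (f + e) - 2 * (n \<bullet> g)"
  have \<zeta>: "\<eta> *\<^sub>R \<zeta> = y - z *\<^sub>R n" using y by simp
  have "2 * (n \<bullet> \<zeta>) = (2 / \<eta>) * (n \<bullet> (\<eta> *\<^sub>R \<zeta>))" using \<eta> by simp
  then have 1: "2 * (n \<bullet> \<zeta>) = (2 / \<eta>) * (n \<bullet> y) - 2 * z * (n \<bullet> n) / \<eta>"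
    unfolding \<zeta> by (simp add: inner_diff_right algebra_simps diff_divide_distrib)
  have "2 * \<eta> * Fz * (g \<bullet> \<zeta>) = 2 * Fz * (g \<bullet> (\<eta> *\<^sub>R \<zeta>))" by simp
  then have 2: "2 * \<eta> * Fz * (g \<bullet> \<zeta>) = 2 * Fz * (g \<bullet> y) - 2 * z * Fz * (g \<bullet> n)"
    unfolding \<zeta> by (simp add: inner_diff_right algebra_simps)
  have V: "(2 / \<eta>) * (n \<bullet> y) + 2 * Fz * (g \<bullet> y) = V \<bullet> y"
    by (simp add: V_def inner_add_left)
  have "f\<^sup>2 / N + 2 * f * e / N \<le> (f + e)\<^sup>2 / N"
    using N by (simp add: power2_sum add_divide_distrib)
  then have "f\<^sup>2 / N + 2 * f * e / N \<le> T" using T by linarith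
  then have 3: "2 * \<eta> * T \<ge> 2 * \<eta> * (f\<^sup>2 / N + 2 * f * e / N)" using \<eta> by (intro mult_left_mono) auto
  have "h\<^sup>2 * (z * L + 2 * (n \<bullet> \<zeta>) + 2 * \<eta> * T + 2 * \<eta> * Fv * z + 2 * \<eta> * Fz * (g \<bullet> \<zeta>))
      \<ge> h\<^sup>2 * (\<delta>0 + V \<bullet> y + 4 * \<eta> * f * e / N)"
    using zero_order 1 2 3 V by (intro mult_left_mono) (auto simp: algebra_simps)
  moreover have "?D = 2 * h * (y \<bullet> y) + h\<^sup>2 * (z * L + 2 * (n \<bullet> \<zeta>) + 2 * \<eta> * T + 2 * \<eta> * Fv * z + 2 * \<eta> * Fz * (g \<bullet> \<zeta>))
      - h\<^sup>2 * (e * (2 * \<eta> * (f + e) + 2 * (n \<bullet> g))) - 4 * e * h * \<eta> * (y \<bullet> g)"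
    by (simp add: algebra_simps)
  moreover have "h\<^sup>2 * (\<delta>0 + V \<bullet> y + 4 * \<eta> * f * e / N) - h\<^sup>2 * (e * (2 * \<eta> * (f + e) + 2 * (n \<bullet> g)))
     = h\<^sup>2 * \<delta>0 + h\<^sup>2 * (V \<bullet> y) + h\<^sup>2 * (e * q)"
    by (simp add: q_def algebra_simps)
  ultimately have D: "?D \<ge> 2 * h * (y \<bullet> y) + (h\<^sup>2 * \<delta>0 + h\<^sup>2 * (V \<bullet> y) + h\<^sup>2 * (e * q)) - 4 * e * h * \<eta> * (y \<bullet> g)"
    by linarith
  have "V \<bullet> y \<ge> - (B * norm y)"
  proof -
    have "\<bar>V \<bullet> y\<bar> \<le> norm V * norm y" by (rule Cauchy_Schwarz_ineq2)
    also have "\<dots> \<le> B * norm y" using B(1) by (intro mult_right_mono) (auto simp: V_def)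
    finally show ?thesis by linarith
  qed
  then have A1: "h\<^sup>2 * (V \<bullet> y) \<ge> h\<^sup>2 * (- (B * norm y))" by (intro mult_left_mono) auto
  have "e * q \<ge> - (\<bar>e\<bar> * B)"
  proof -
    have "\<bar>e * q\<bar> \<le> \<bar>e\<bar> * B" using B(2) by (simp add: abs_mult q_def mult_left_mono)
    then show ?thesis by linarith
  qed
  then have A2: "h\<^sup>2 * (e * q) \<ge> h\<^sup>2 * (- (\<bar>e\<bar> * B))" by (intro mult_left_mono) auto
  have A3: "4 * e * h * \<eta> * (y \<bullet> g) \<le> h * (\<bar>e\<bar> * B * norm y)"
  proof -
    have "e * (y \<bullet> g) \<le> \<bar>e\<bar> * \<bar>y \<bullet> g\<bar>" using abs_ge_self[of "e * (y \<bullet> g)"] by (simp add: abs_mult)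
    also have "\<dots> \<le> \<bar>e\<bar> * (norm y * norm g)" by (intro mult_left_mono Cauchy_Schwarz_ineq2) simp
    finally have "4 * \<eta> * (e * (y \<bullet> g)) \<le> 4 * \<eta> * (\<bar>e\<bar> * (norm y * norm g))"
      using \<eta> by (intro mult_left_mono) auto
    also have "\<dots> = (4 * \<eta> * norm g) * (\<bar>e\<bar> * norm y)" by simp
    also have "\<dots> \<le> B * (\<bar>e\<bar> * norm y)" using B(3) by (intro mult_right_mono) auto
    finally have "h * (4 * \<eta> * (e * (y \<bullet> g))) \<le> h * (B * (\<bar>e\<bar> * norm y))" using h by (intro mult_left_mono)
    then show ?thesis by (simp only: mult_ac)
  qed
  define Y where "Y = norm y"
  have Y: "y \<bullet> y = Y\<^sup>2" by (simp add: power2_norm_eq_inner Y_def)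
  \<comment> \<open>Two completed squares, each using up one copy of h |y|^2: the first absorbs the
    term linear in y, the second the product of y and e. The first one and the term h^2 |e| B each
    cost a quarter of \<delta>0 h^2, which leaves one half; the second costs a quarter of \<delta>0
    e^2.\<close>
  have "h * (Y - h * B / 2)\<^sup>2 \<ge> 0" "h * (Y - \<bar>e\<bar> * B / 2)\<^sup>2 \<ge> 0" using h by auto
  moreover have "h * (Y - h * B / 2)\<^sup>2 = h * Y\<^sup>2 - h\<^sup>2 * (B * Y) + h\<^sup>2 * (B\<^sup>2 * h) / 4"
    by (simp add: power2_eq_square field_simps)
  moreover have "h * (Y - \<bar>e\<bar> * B / 2)\<^sup>2 = h * Y\<^sup>2 - h * (\<bar>e\<bar> * B * Y) + e\<^sup>2 * (B\<^sup>2 * h) / 4"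
  proof -
    have "h * (Y - t * B / 2)\<^sup>2 = h * Y\<^sup>2 - h * (t * B * Y) + t\<^sup>2 * (B\<^sup>2 * h) / 4" for t
      by (simp add: power2_eq_square field_simps)
    from this[of "\<bar>e\<bar>"] show ?thesis by (simp only: power2_abs)
  qed
  moreover have "h\<^sup>2 * (B\<^sup>2 * h) \<le> h\<^sup>2 * \<delta>0" "e\<^sup>2 * (B\<^sup>2 * h) \<le> e\<^sup>2 * \<delta>0" "h\<^sup>2 * (4 * B * \<bar>e\<bar>) \<le> h\<^sup>2 * \<delta>0"
    using small by (auto intro!: mult_left_mono)
  moreover have "h\<^sup>2 * (- (B * norm y)) = - (h\<^sup>2 * (B * Y))" "h\<^sup>2 * (- (\<bar>e\<bar> * B)) = - (h\<^sup>2 * (4 * B * \<bar>e\<bar>)) / 4"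
    by (simp_all add: Y_def)
  ultimately have "2 * (h * Y\<^sup>2) + (h\<^sup>2 * \<delta>0 + h\<^sup>2 * (V \<bullet> y) + h\<^sup>2 * (e * q)) - 4 * e * h * \<eta> * (y \<bullet> g)
      \<ge> (h\<^sup>2 * \<delta>0) / 2 - (e\<^sup>2 * \<delta>0) / 4"
    using A1 A2 A3[folded Y_def] by linarith
  moreover have "2 * h * (y \<bullet> y) = 2 * (h * Y\<^sup>2)" by (simp add: Y)
  moreover have "\<delta>0 / 2 * h\<^sup>2 - \<delta>0 / 4 * e\<^sup>2 = (h\<^sup>2 * \<delta>0) / 2 - (e\<^sup>2 * \<delta>0) / 4"
    by (simp add: mult.commute)
  ultimately show ?thesis using D by linarith
qed

text \<open>The Cauchy-Schwarz inequality for the trace. Applied to the Hessian of \<open>v\<close>,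
  it bounds |D^2 v|^2 from below by (\<Delta>v)^2 / N.\<close>

lemma sum_diagonal_sq_le:
  fixes A :: "'a::euclidean_space \<Rightarrow> 'a \<Rightarrow> real"
  shows "(\<Sum>b\<in>Basis. A b b)\<^sup>2 / real DIM('a) \<le> (\<Sum>b\<in>Basis. \<Sum>c\<in>Basis. (A c b)\<^sup>2)"
proof -
  have "(\<Sum>b\<in>(Basis::'a set). A b b * 1)\<^sup>2 \<le> (\<Sum>b\<in>Basis. (A b b)\<^sup>2) * (\<Sum>b\<in>(Basis::'a set). 1\<^sup>2)"
    by (rule Cauchy_Schwarz_ineq_sum)
  then have "(\<Sum>b\<in>(Basis::'a set). A b b)\<^sup>2 / real DIM('a) \<le> (\<Sum>b\<in>Basis. (A b b)\<^sup>2)"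
    by (simp add: pos_divide_le_eq)
  also have "\<dots> \<le> (\<Sum>b\<in>Basis. \<Sum>c\<in>Basis. (A c b)\<^sup>2)"
  proof (rule sum_mono)
    fix b :: 'a assume "b \<in> Basis"
    then show "(A b b)\<^sup>2 \<le> (\<Sum>c\<in>Basis. (A c b)\<^sup>2)"
      using member_le_sum[of b Basis "\<lambda>c. (A c b)\<^sup>2"] by simp
  qed
  finally show ?thesis .
qed

text \<open>Here \<open>nn\<close>, \<open>gn\<close> and \<open>L\<close> stand for \<open>|\<nabla>\<eta>|\<^sup>2\<close>, \<open>\<nabla>v \<bullet> \<nabla>\<eta>\<close> and \<open>\<Delta>\<eta>\<close>, where \<open>\<eta> = \<theta>\<^sup>2\<close> is the cutoff.\<close>

lemma zero_order_bound:
  fixes v z c s q a \<delta> N R \<theta> k L V nn gn :: real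
  assumes pos: "v > 0" "z > 0" "c > 0" "R > 0" "N > 0" "\<delta> > 0" "a \<ge> 0" "k > 0"
    and \<delta>: "\<delta> \<le> a\<^sup>2 / N - a" "\<delta> \<le> 1 / N" and cross: "2 * a / N + s \<ge> 0"
    and \<theta>: "0 < \<theta>" "\<theta> \<le> 1" and L: "L \<ge> - (4 * N) / R\<^sup>2"
    and nn: "nn \<le> 16 * \<theta>\<^sup>2 / R\<^sup>2" and gn: "\<bar>gn\<bar> \<le> 4 * \<theta> * sqrt z / R"
    and vV: "v\<^sup>2 \<le> V" and k: "k \<le> \<theta>\<^sup>2 * z"
  defines "C1 \<equiv> 64 * (a + \<bar>q\<bar>)\<^sup>2 / \<delta> + 4 * N + 32"
  assumes big: "2 * C1 * V \<le> k * (\<delta> * R\<^sup>2)"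
  defines "f \<equiv> a * z / v + c * v powr s * z powr (q / 2)"
    and "Fv \<equiv> - a * z / v\<^sup>2 + c * s * v powr (s - 1) * z powr (q / 2)"
    and "Fz \<equiv> a / v + c * v powr s * (q / 2 * z powr (q / 2 - 1))"
  shows "k * C1 / R\<^sup>2 \<le> z * L - 2 * z * nn / \<theta>\<^sup>2 + 2 * \<theta>\<^sup>2 * (f\<^sup>2 / N + Fv * z) - 2 * z * Fz * gn"
proof -
  \<comment> \<open>In terms of \<open>P\<close> and \<open>Q\<close> the quantities
    \<open>f\<close>, \<open>Fv * z\<close> and \<open>z * Fz\<close> lose all their powers, and the
    main part becomes a quadratic form whose three coefficients are controlled by the assumptions on
    \<delta> and by \<open>cross\<close>.\<close>
  define P where "P = z / v"
  define Q where "Q = c * v powr s * z powr (q / 2)"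
  define A where "A = a + \<bar>q\<bar>"
  have P: "P > 0" and Q: "Q > 0" and A: "A \<ge> 0" using pos by (auto simp: P_def Q_def A_def)
  have f: "f = a * P + Q" by (simp add: f_def P_def Q_def)
  have Fv: "Fv * z = - a * P\<^sup>2 + s * (P * Q)"
    using pos by (simp add: Fv_def P_def Q_def powr_diff power2_eq_square field_simps)
  have "z powr (q / 2 - 1) = z powr (q / 2) / z"
    using pos by (subst powr_diff) simp
  then have Fz: "z * Fz = a * P + q / 2 * Q"
    using pos unfolding Fz_def P_def Q_def by (simp add: distrib_left mult_ac)
  have "f\<^sup>2 / N + Fv * z = (a\<^sup>2 / N - a) * P\<^sup>2 + (2 * a / N + s) * (P * Q) + 1 / N * Q\<^sup>2"
    unfolding f Fv by (simp add: power2_sum power_mult_distrib add_divide_distrib algebra_simps)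
  moreover have "(a\<^sup>2 / N - a) * P\<^sup>2 \<ge> \<delta> * P\<^sup>2" "1 / N * Q\<^sup>2 \<ge> \<delta> * Q\<^sup>2"
    using \<delta> by (auto intro!: mult_right_mono simp del: times_divide_eq_left)
  moreover have "(2 * a / N + s) * (P * Q) \<ge> 0" using cross P Q by simp
  ultimately have "f\<^sup>2 / N + Fv * z \<ge> \<delta> * P\<^sup>2 + \<delta> * Q\<^sup>2" by linarith
  then have main: "2 * \<theta>\<^sup>2 * (f\<^sup>2 / N + Fv * z) \<ge> 2 * \<theta>\<^sup>2 * (\<delta> * P\<^sup>2 + \<delta> * Q\<^sup>2)"
    by (intro mult_left_mono) auto
  have zFz: "\<bar>z * Fz\<bar> \<le> A * (P + Q)"
  proof -
    have "\<bar>z * Fz\<bar> \<le> \<bar>a * P\<bar> + \<bar>q / 2 * Q\<bar>" unfolding Fz by (rule abs_triangle_ineq)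
    also have "\<dots> = a * P + \<bar>q\<bar> / 2 * Q" using pos P Q by (simp add: abs_mult)
    also have "\<dots> \<le> A * P + A * Q"
      using pos P Q by (intro add_mono mult_right_mono) (auto simp: A_def)
    finally show ?thesis by (simp add: distrib_left)
  qed
  \<comment> \<open>Young's inequality, weighted so that only a fraction of \<delta>\<theta>^2 (P^2
    + Q^2) is spent. Used once for \<open>P\<close> and once for \<open>Q\<close>, it yields the
    summand of \<open>C1\<close> with the factor 64; the Laplacian of the cutoff contributes 4N, and
    the squared gradient of the cutoff contributes 2 * 16.\<close>
  have young: "8 * A * \<theta> * (sqrt z / R) * t \<le> \<delta> * \<theta>\<^sup>2 * t\<^sup>2 / 2 + 32 * A\<^sup>2 / \<delta> * (z / R\<^sup>2)" for t
  proof -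
    have "0 \<le> (\<delta> * \<theta> * t - 8 * A * (sqrt z / R))\<^sup>2 / (2 * \<delta>)" using pos by simp
    also have "\<dots> = \<delta> * \<theta>\<^sup>2 * t\<^sup>2 / 2 - 8 * A * \<theta> * (sqrt z / R) * t + 32 * A\<^sup>2 / \<delta> * (sqrt z / R)\<^sup>2"
      using pos by (simp add: power2_diff power_mult_distrib field_simps power2_eq_square)
    also have "(sqrt z / R)\<^sup>2 = z / R\<^sup>2" using pos by (simp add: power_divide)
    finally show ?thesis by linarith
  qed
  have "2 * z * Fz * gn \<le> 2 * (\<bar>z * Fz\<bar> * \<bar>gn\<bar>)"
    using abs_ge_self[of "z * Fz * gn"] by (simp add: abs_mult mult.assoc)
  also have "\<dots> \<le> 2 * ((A * (P + Q)) * (4 * \<theta> * sqrt z / R))"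
    using zFz gn A P Q by (intro mult_left_mono mult_mono) auto
  also have "\<dots> = 8 * A * \<theta> * (sqrt z / R) * P + 8 * A * \<theta> * (sqrt z / R) * Q"
    by (simp add: algebra_simps add_divide_distrib)
  also have "\<dots> \<le> (\<delta> * \<theta>\<^sup>2 * P\<^sup>2 / 2 + 32 * A\<^sup>2 / \<delta> * (z / R\<^sup>2)) + (\<delta> * \<theta>\<^sup>2 * Q\<^sup>2 / 2 + 32 * A\<^sup>2 / \<delta> * (z / R\<^sup>2))"
    by (intro add_mono young)
  finally have grad: "2 * z * Fz * gn \<le> \<delta> * \<theta>\<^sup>2 * P\<^sup>2 / 2 + \<delta> * \<theta>\<^sup>2 * Q\<^sup>2 / 2 + 64 * A\<^sup>2 / \<delta> * (z / R\<^sup>2)"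
    by (simp add: ac_simps)
  have "z * L \<ge> z * (- (4 * N) / R\<^sup>2)" using pos L by (intro mult_left_mono) auto
  then have lap: "z * L \<ge> - (4 * N * (z / R\<^sup>2))" by (simp add: algebra_simps)
  have "2 * z / \<theta>\<^sup>2 * nn \<le> 2 * z / \<theta>\<^sup>2 * (16 * \<theta>\<^sup>2 / R\<^sup>2)" using pos \<theta> nn by (intro mult_left_mono) auto
  then have nn': "2 * z * nn / \<theta>\<^sup>2 \<le> 32 * (z / R\<^sup>2)" using \<theta> by (simp add: field_simps)
  have "\<delta> * \<theta>\<^sup>2 * Q\<^sup>2 \<ge> 0" "\<delta> * \<theta>\<^sup>2 * P\<^sup>2 \<ge> 0" using pos by auto
  then have "z * L - 2 * z * nn / \<theta>\<^sup>2 + 2 * \<theta>\<^sup>2 * (f\<^sup>2 / N + Fv * z) - 2 * z * Fz * gn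
     \<ge> \<delta> * \<theta>\<^sup>2 * P\<^sup>2 - C1 * (z / R\<^sup>2)"
    using main grad lap nn' unfolding C1_def A_def[symmetric] by (simp add: algebra_simps)
  \<comment> \<open>Here it matters that w is large: one factor of z^2 in P^2 is bounded below
    through \<theta>^2 z \<ge> k, and 1/v^2 through the bound on v. Half of the result pays for the
    errors; the other half is the positive lower bound.\<close>
  moreover have "\<delta> * \<theta>\<^sup>2 * P\<^sup>2 \<ge> 2 * C1 * (z / R\<^sup>2)"
  proof -
    have C1: "C1 \<ge> 0" using pos by (simp add: C1_def)
    have "2 * C1 * v\<^sup>2 \<le> 2 * C1 * V" using C1 vV by (intro mult_left_mono) auto
    also have "\<dots> \<le> k * (\<delta> * R\<^sup>2)" by (rule big)
    also have "\<dots> \<le> (\<theta>\<^sup>2 * z) * (\<delta> * R\<^sup>2)" using k pos by (intro mult_right_mono) auto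
    finally have "2 * C1 * v\<^sup>2 * (z / (R\<^sup>2 * v\<^sup>2)) \<le> (\<theta>\<^sup>2 * z) * (\<delta> * R\<^sup>2) * (z / (R\<^sup>2 * v\<^sup>2))"
      using pos by (intro mult_right_mono) auto
    then show ?thesis using pos by (simp add: P_def power_divide field_simps power2_eq_square)
  qed
  moreover have "C1 * (z / R\<^sup>2) \<ge> k * C1 / R\<^sup>2"
  proof -
    have C1: "C1 \<ge> 0" using pos by (simp add: C1_def)
    have "\<theta>\<^sup>2 \<le> 1" using \<theta> by (simp add: power_le_one)
    then have "\<theta>\<^sup>2 * z \<le> 1 * z" using pos by (intro mult_right_mono) auto
    then have "k \<le> z" using k by simp
    then have "C1 / R\<^sup>2 * k \<le> C1 / R\<^sup>2 * z" using C1 by (intro mult_left_mono) auto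
    then show ?thesis by (simp add: mult.commute)
  qed
  ultimately show ?thesis by linarith
qed

section \<open>The quadratic cutoff of a ball and its square\<close>

definition cutoff :: "'a::euclidean_space \<Rightarrow> real \<Rightarrow> 'a \<Rightarrow> real" where
  "cutoff x0 R x = 1 - inverse (R\<^sup>2) * ((x - x0) \<bullet> (x - x0))"

lemma cutoff_bounds:
  assumes "R > 0" "x \<in> ball x0 R"
  shows "0 < cutoff x0 R x" "cutoff x0 R x \<le> 1"
proof -
  have "norm (x - x0) < R" using assms(2) by (simp add: dist_norm norm_minus_commute)
  then have "(norm (x - x0))\<^sup>2 < R\<^sup>2" by (intro power_strict_mono) auto
  then show "0 < cutoff x0 R x" "cutoff x0 R x \<le> 1"
    using assms(1) by (auto simp: cutoff_def power2_norm_eq_inner field_simps)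
qed

lemma cutoff_has_derivative:
  "(cutoff x0 R has_derivative (\<lambda>h. - 2 / R\<^sup>2 * ((x - x0) \<bullet> h))) (at x)"
  unfolding cutoff_def[abs_def] by (auto intro!: derivative_eq_intros simp: inner_commute divide_inverse)

lemma pd_cutoff: "pd (cutoff x0 R) b = (\<lambda>x. - 2 / R\<^sup>2 * (x \<bullet> b - x0 \<bullet> b))"
  by (rule ext) (simp add: pd_eqI[OF cutoff_has_derivative] inner_diff_left)

lemma Ck_on_cutoff: "Ck_on k UNIV (cutoff x0 R)"
proof (cases k)
  case 0
  then show ?thesis by (auto simp: cutoff_def[abs_def] intro!: continuous_intros)
next
  case (Suc j)
  have "Ck_on j UNIV (pd (cutoff x0 R) b)" for b
    unfolding pd_cutoff by (intro Ck_on_mult Ck_on_diff Ck_on_inner Ck_on_const open_UNIV)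
  moreover have "cutoff x0 R differentiable (at x)" for x
    by (rule differentiableI[OF cutoff_has_derivative])
  ultimately show ?thesis using Suc by simp
qed

text \<open>Squaring the cutoff gives |\<nabla>\<eta>|^2 \<le> 16 \<eta> / R^2, so that
  |\<nabla>\<eta>|^2 / \<eta> stays bounded up to the sphere. Only a lower bound for \<Delta>\<eta>
  is stated, because it gets multiplied by z \<ge> 0; it results from dropping a nonnegative term.
  Outside the closed ball \<eta> is positive again, so it serves as a cutoff only inside.\<close>

lemma cutoff_sq:
  fixes x0 x :: "'a::euclidean_space"
  assumes R: "R > 0" and x: "x \<in> ball x0 R"
  defines "\<eta> \<equiv> \<lambda>x. cutoff x0 R x * cutoff x0 R x"
  shows "Ck_on k UNIV \<eta>"
    "gradient \<eta> x = (- 4 * cutoff x0 R x / R\<^sup>2) *\<^sub>R (x - x0)"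
    "norm (gradient \<eta> x) \<le> 4 * cutoff x0 R x / R"
    "laplacian \<eta> x \<ge> - (4 * real DIM('a)) / R\<^sup>2"
proof -
  show C: "Ck_on k UNIV \<eta>" for k unfolding \<eta>_def by (intro Ck_on_mult Ck_on_cutoff open_UNIV)
  have dc: "cutoff x0 R differentiable (at y)" for y using cutoff_has_derivative by (rule differentiableI)
  have p: "pd \<eta> b = (\<lambda>y. - 4 / R\<^sup>2 * (cutoff x0 R y * (y \<bullet> b - x0 \<bullet> b)))" for b
    unfolding \<eta>_def by (rule ext) (simp add: pd_mult[OF dc dc] pd_cutoff)
  have d\<eta>: "\<eta> differentiable (at y)" for y using C[of "Suc 0"] by simp
  show g: "gradient \<eta> x = (- 4 * cutoff x0 R x / R\<^sup>2) *\<^sub>R (x - x0)"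
    by (rule euclidean_eqI) (simp add: gderiv_gradient(2)[OF d\<eta>, symmetric] p inner_diff_left)
  note \<theta> = cutoff_bounds[OF R x]
  have nx: "norm (x - x0) \<le> R" using x by (simp add: dist_norm norm_minus_commute)
  have "norm (gradient \<eta> x) = 4 * cutoff x0 R x / R\<^sup>2 * norm (x - x0)"
    unfolding g using \<theta> by simp
  also have "\<dots> \<le> 4 * cutoff x0 R x / R\<^sup>2 * R" using \<theta> nx by (intro mult_left_mono) auto
  also have "\<dots> = 4 * cutoff x0 R x / R" using R by (simp add: power2_eq_square)
  finally show "norm (gradient \<eta> x) \<le> 4 * cutoff x0 R x / R" .
  have lin: "(\<lambda>y::'a. y \<bullet> b - x0 \<bullet> b) differentiable (at x)" "pd (\<lambda>y. y \<bullet> b - x0 \<bullet> b) b x = 1" if "b \<in> Basis" for b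
  proof -
    have "((\<lambda>y::'a. y \<bullet> b - x0 \<bullet> b) has_derivative (\<lambda>h. h \<bullet> b)) (at x)" by (auto intro!: derivative_eq_intros)
    from differentiableI[OF this] pd_eqI[OF this, of b] that
    show "(\<lambda>y::'a. y \<bullet> b - x0 \<bullet> b) differentiable (at x)" "pd (\<lambda>y. y \<bullet> b - x0 \<bullet> b) b x = 1" by auto
  qed
  have pp: "pd (pd \<eta> b) b x = 8 / (R\<^sup>2 * R\<^sup>2) * ((x - x0) \<bullet> b)\<^sup>2 - 4 / R\<^sup>2 * cutoff x0 R x" if "b \<in> Basis" for b
  proof -
    have "pd (pd \<eta> b) b x = - 4 / R\<^sup>2 * (cutoff x0 R x * 1 + pd (cutoff x0 R) b x * (x \<bullet> b - x0 \<bullet> b))"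
      unfolding p using dc lin[OF that] by (subst pd_cmult) (auto simp: pd_mult)
    moreover have "- 4 / R\<^sup>2 * (\<theta> * 1 + (- 2 / R\<^sup>2 * t) * t) = 8 / (R\<^sup>2 * R\<^sup>2) * t\<^sup>2 - 4 / R\<^sup>2 * \<theta>" for \<theta> t
      using R by (simp add: field_simps power2_eq_square)
    ultimately show ?thesis unfolding pd_cutoff by (simp only: inner_diff_left)
  qed
  have "laplacian \<eta> x = (\<Sum>b\<in>(Basis::'a set). 8 / (R\<^sup>2 * R\<^sup>2) * ((x - x0) \<bullet> b)\<^sup>2) - 4 / R\<^sup>2 * cutoff x0 R x * real DIM('a)"
    unfolding laplacian_def by (simp add: pp sum_subtractf)
  moreover have "(\<Sum>b\<in>(Basis::'a set). 8 / (R\<^sup>2 * R\<^sup>2) * ((x - x0) \<bullet> b)\<^sup>2) \<ge> 0" by (intro sum_nonneg) simp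
  moreover have "4 / R\<^sup>2 * cutoff x0 R x * real DIM('a) \<le> 4 / R\<^sup>2 * 1 * real DIM('a)"
    using \<theta> by (intro mult_right_mono mult_left_mono) auto
  ultimately show "laplacian \<eta> x \<ge> - (4 * real DIM('a)) / R\<^sup>2" by simp
qed

text \<open>The divergence of the test field has integral zero, yet it is at least \<kappa>/2 (w -
  k)_+^2 - \<kappa>/4 E^2 on the set where w > k, which lies in \<open>K\<close>. On the left of the
  resulting inequality stands a fixed amount coming from a ball where w exceeds \<open>k\<close> by
  \<open>c\<close>; on the right stands only the error in the equation for \<open>v\<close>. Here
  \<open>f\<close> is the nonlinearity along \<open>v\<close>, with \<open>Fv\<close> and
  \<open>Fz\<close> as its partial derivatives.\<close>

lemma bernstein_integral:
  fixes v \<eta> f Fv Fz :: "'a::euclidean_space \<Rightarrow> real" and k \<kappa> B E c r :: real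
  defines "z \<equiv> \<lambda>x. \<Sum>b\<in>Basis. pd v b x * pd v b x"
  defines "w \<equiv> \<lambda>x. \<eta> x * z x" and "e \<equiv> \<lambda>x. laplacian v x - f x"
  assumes G: "open G" and K: "compact K" "K \<subseteq> G"
    and v: "Ck_on (Suc (Suc (Suc 0))) G v" and \<eta>: "Ck_on (Suc (Suc 0)) G \<eta>" and f: "Ck_on (Suc 0) G f"
    and pdf: "\<And>x b. x \<in> G \<Longrightarrow> pd f b x = Fv x * pd v b x + Fz x * pd z b x"
    and outside: "\<And>x. x \<in> G \<Longrightarrow> x \<notin> K \<Longrightarrow> w x \<le> k"
    and \<eta>pos: "\<And>x. x \<in> G \<Longrightarrow> w x > k \<Longrightarrow> \<eta> x > 0"
    and zero_order: "\<And>x. x \<in> G \<Longrightarrow> w x > k \<Longrightarrow>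
       \<kappa> \<le> z x * laplacian \<eta> x - 2 * z x * (gradient \<eta> x \<bullet> gradient \<eta> x) / \<eta> x
         + 2 * \<eta> x * ((f x)\<^sup>2 / real DIM('a) + Fv x * z x) - 2 * z x * Fz x * (gradient v x \<bullet> gradient \<eta> x)"
    and B: "\<And>x. x \<in> G \<Longrightarrow> w x > k \<Longrightarrow> norm ((2 / \<eta> x) *\<^sub>R gradient \<eta> x + (2 * Fz x) *\<^sub>R gradient v x) \<le> B"
       "\<And>x. x \<in> G \<Longrightarrow> w x > k \<Longrightarrow> \<bar>4 * \<eta> x * f x / real DIM('a) - 2 * \<eta> x * (f x + e x) - 2 * (gradient \<eta> x \<bullet> gradient v x)\<bar> \<le> B"
       "\<And>x. x \<in> G \<Longrightarrow> w x > k \<Longrightarrow> 4 * \<eta> x * norm (gradient v x) \<le> B"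
    and small: "\<And>x. x \<in> G \<Longrightarrow> w x > k \<Longrightarrow> B\<^sup>2 * (w x - k) \<le> \<kappa>" 
       "\<And>x. x \<in> G \<Longrightarrow> w x > k \<Longrightarrow> 4 * B * \<bar>e x\<bar> \<le> \<kappa>" "\<And>x. x \<in> G \<Longrightarrow> w x > k \<Longrightarrow> \<bar>e x\<bar> \<le> E"
    and ball: "ball x1 r \<subseteq> G" "\<And>x. x \<in> ball x1 r \<Longrightarrow> w x \<ge> k + c" and pos: "\<kappa> > 0" "c > 0"
  shows "2 * c\<^sup>2 * measure lborel (ball x1 r) \<le> E\<^sup>2 * measure lborel K"
proof -
  have zC: "Ck_on (Suc (Suc 0)) G z" unfolding z_def using v by (intro Ck_on_sum Ck_on_mult G) auto
  have wC: "Ck_on (Suc (Suc 0)) G w" unfolding w_def by (intro Ck_on_mult G \<eta> zC)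
  have lC: "Ck_on (Suc 0) G (laplacian v)" unfolding laplacian_def[abs_def] using v by (intro Ck_on_sum G) auto
  have eC: "Ck_on (Suc 0) G e" unfolding e_def by (intro Ck_on_diff G lC f)
  have v2: "Ck_on (Suc (Suc 0)) G v" by (rule Ck_on_SucD[OF v])
  have \<eta>1: "Ck_on (Suc 0) G \<eta>" by (rule Ck_on_SucD[OF \<eta>])
  define h where "h x = max 0 (w x - k)" for x
  define Y where "Y b x = (max 0 (w x - k))\<^sup>2 * (pd w b x - 2 * (e x * (\<eta> x * pd v b x)))" for b x
  \<comment> \<open>The field vanishes on \<open>G\<close> off \<open>K\<close>, where w is at most
    \<open>k\<close>, so its extension by zero is C^1 on the whole space and compactly
    supported.\<close>
  define X where "X b x = (if x \<in> G then Y b x else 0)" for b x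
  note div = divergence_test_field[OF G wC v2 eC \<eta>1, where k = k, folded Y_def[abs_def] h_def]
  have Xout: "X b x = 0" if "x \<notin> K" for b x
    using outside that by (auto simp: X_def Y_def)
  have XC: "Ck_on (Suc 0) UNIV (X b)" for b
  proof (rule Ck_on_extend[OF G compact_imp_closed[OF K(1)] K(2) Xout])
    show "Ck_on (Suc 0) G (X b)"
    proof (cases "G = {}")
      case False
      then obtain x where "x \<in> G" by blast
      from divergence_test_field(2)[OF G wC v2 eC \<eta>1 this, where k = k and b = b]
      have "Ck_on (Suc 0) G (Y b)" unfolding Y_def[abs_def] .
      moreover have "Ck_on (Suc 0) G (X b) \<longleftrightarrow> Ck_on (Suc 0) G (Y b)"
        by (rule Ck_on_cong[OF G]) (simp add: X_def)
      ultimately show ?thesis by blast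
    qed simp
  qed auto
  define S where "S x = (\<Sum>b\<in>Basis. pd (X b) b x)" for x
  have int: "integrable lborel S" unfolding S_def
    by (intro Bochner_Integration.integrable_sum integral_pd_eq_0(1)[OF XC K(1) Xout])
  have S0: "(\<integral>x. S x \<partial>lborel) = 0" unfolding S_def
    using integral_pd_eq_0[OF XC K(1) Xout] by simp
  have low: "S x \<ge> \<kappa> / 2 * c\<^sup>2 * indicator (ball x1 r) x - \<kappa> / 4 * E\<^sup>2 * indicator K x" for x
  proof (cases "x \<in> G")
    case False
    have "pd (X b) b x = 0" for b
      by (rule pd_zero_outside[OF compact_imp_closed[OF K(1)] Xout]) (use False K(2) in auto)
    then show ?thesis using False K(2) ball(1) by (auto simp: S_def indicator_def)
  next
    case x: True
    have dv: "v differentiable (at x)" and d\<eta>: "\<eta> differentiable (at x)" and dz: "z differentiable (at x)"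
      and df: "f differentiable (at x)" and de: "e differentiable (at x)" and dw: "w differentiable (at x)"
      and dl: "laplacian v differentiable (at x)"
      using v \<eta> zC f eC wC lC x by simp_all
    have "S x = (\<Sum>b\<in>Basis. pd (Y b) b x)"
      unfolding S_def by (intro sum.cong refl pd_cong_open(2)[OF G x]) (simp add: X_def)
    also have "\<dots> = 2 * h x * (gradient w x \<bullet> gradient w x)
      + (h x)\<^sup>2 * (laplacian w x - 2 * \<eta> x * (gradient v x \<bullet> gradient e x))
      - 2 * e x * ((h x)\<^sup>2 * \<eta> x * laplacian v x + (h x)\<^sup>2 * (gradient \<eta> x \<bullet> gradient v x) + 2 * h x * \<eta> x * (gradient w x \<bullet> gradient v x))"
      using div(1)[OF x] by (simp add: Y_def[abs_def] h_def)
    finally have S: "S x = \<dots>" .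
    show ?thesis
    proof (cases "w x > k")
      case False
      then have "h x = 0" by (simp add: h_def)
      moreover have "x \<notin> ball x1 r" using ball(2)[of x] False pos by auto
      ultimately show ?thesis using S pos by (simp add: indicator_def)
    next
      case wk: True
      then have xK: "x \<in> K" using outside[OF x] by fastforce
      have hx: "h x = w x - k" "h x > 0" using wk by (auto simp: h_def)
      have gw: "gradient w x = z x *\<^sub>R gradient \<eta> x + \<eta> x *\<^sub>R gradient z x"
        by (rule gradient_eqI[OF dw]) 
          (simp add: w_def pd_mult[OF d\<eta> dz] inner_add_left gderiv_gradient(2)[OF d\<eta>] gderiv_gradient(2)[OF dz] mult.commute)
      \<comment> \<open>The identity \<Delta>v = f + e is differentiated. No bound on \<nabla>e is
        available; it is kept as it stands and disappears in \<open>lw\<close>.\<close>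
      have ge: "gradient (laplacian v) x = Fv x *\<^sub>R gradient v x + Fz x *\<^sub>R gradient z x + gradient e x"
      proof (rule gradient_eqI[OF dl])
        fix b :: 'a
        have "pd e b x = pd (laplacian v) b x - pd f b x" unfolding e_def by (rule pd_diff[OF dl df])
        then show "pd (laplacian v) b x = (Fv x *\<^sub>R gradient v x + Fz x *\<^sub>R gradient z x + gradient e x) \<bullet> b"
          using pdf[OF x, of b] by (simp add: inner_add_left gderiv_gradient(2)[OF dv] gderiv_gradient(2)[OF dz] gderiv_gradient(2)[OF de])
      qed
      define T where "T = (\<Sum>b\<in>Basis. \<Sum>c\<in>Basis. (pd (pd v c) b x)\<^sup>2)"
      have vv: "gradient v x \<bullet> gradient v x = z x" by (simp add: inner_gradient[OF dv dv] z_def)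
      have "laplacian z x = 2 * T + 2 * (gradient v x \<bullet> gradient (laplacian v) x)"
        unfolding T_def inner_gradient[OF dv dl] unfolding z_def by (rule laplacian_gradient_sq(2)[OF G v x])
      then have lz: "laplacian z x = 2 * T + 2 * (Fv x * z x + Fz x * (gradient v x \<bullet> gradient z x) + gradient v x \<bullet> gradient e x)"
        unfolding ge by (simp add: inner_add_right vv)
      have lw: "laplacian w x - 2 * \<eta> x * (gradient v x \<bullet> gradient e x)
         = z x * laplacian \<eta> x + 2 * (gradient \<eta> x \<bullet> gradient z x) + 2 * \<eta> x * T + 2 * \<eta> x * Fv x * z x + 2 * \<eta> x * Fz x * (gradient v x \<bullet> gradient z x)"
        unfolding w_def laplacian_mult[OF G \<eta> zC x] lz by (simp add: algebra_simps)
      have le: "laplacian v x = f x + e x" by (simp add: e_def)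
      have T: "(f x + e x)\<^sup>2 / real DIM('a) \<le> T"
        unfolding le[symmetric] laplacian_def T_def by (rule sum_diagonal_sq_le)
      have "S x \<ge> \<kappa> / 2 * (h x)\<^sup>2 - \<kappa> / 4 * (e x)\<^sup>2"
        unfolding S lw unfolding le
        by (rule divergence_lower_bound[OF gw \<eta>pos[OF x wk] _ _ T zero_order[OF x wk] B(1)[OF x wk] B(2)[OF x wk] B(3)[OF x wk]])
          (use hx small[OF x wk] in auto)
      moreover have "\<kappa> / 2 * (h x)\<^sup>2 \<ge> \<kappa> / 2 * c\<^sup>2 * indicator (ball x1 r) x"
      proof (cases "x \<in> ball x1 r")
        case True
        then have "c \<le> h x" using ball(2) hx by fastforce
        then have "c\<^sup>2 \<le> (h x)\<^sup>2" using pos by (intro power_mono) auto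
        then show ?thesis using True pos by simp
      qed (use pos in simp)
      moreover have "(e x)\<^sup>2 \<le> E\<^sup>2" using small(3)[OF x wk] by (simp add: abs_le_square_iff[symmetric])
      then have "\<kappa> / 4 * (e x)\<^sup>2 \<le> \<kappa> / 4 * E\<^sup>2 * indicator K x" using pos xK by simp
      ultimately show ?thesis by linarith
    qed
  qed
  have fin: "emeasure lborel K < \<infinity>" "emeasure lborel (ball x1 r) < \<infinity>"
    using emeasure_bounded_finite[OF compact_imp_bounded[OF K(1)]] emeasure_bounded_finite[OF bounded_ball] by auto
  have Kb: "K \<in> sets lborel" using borel_compact[OF K(1)] by simp
  have i1: "integrable lborel (indicator (ball x1 r) :: 'a \<Rightarrow> real)" "integrable lborel (indicator K :: 'a \<Rightarrow> real)"
    using fin Kb by (auto intro!: integrable_real_indicator)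
  have "(\<integral>x. \<kappa> / 2 * c\<^sup>2 * indicator (ball x1 r) x - \<kappa> / 4 * E\<^sup>2 * indicator K x \<partial>lborel) \<le> (\<integral>x. S x \<partial>lborel)"
    using i1 int low by (intro integral_mono) auto
  then have "\<kappa> / 2 * c\<^sup>2 * measure lborel (ball x1 r) - \<kappa> / 4 * E\<^sup>2 * measure lborel K \<le> 0"
    using S0 i1 by simp
  then have "\<kappa> / 4 * (2 * c\<^sup>2 * measure lborel (ball x1 r) - E\<^sup>2 * measure lborel K) \<le> 0"
    by (simp add: algebra_simps)
  then show ?thesis using pos by (simp add: mult_le_0_iff)
qed

section \<open>Uniform limits under functions that are continuous on an open set\<close>

lemma uniform_limit_compose_open:
  fixes f :: "'i \<Rightarrow> 'x \<Rightarrow> 'b::{heine_borel}" and \<Phi> :: "'b \<Rightarrow> 'c::metric_space"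
  assumes lim: "uniform_limit K f g F" and cpt: "compact (g ` K)" and sub: "open D" "g ` K \<subseteq> D" and cont: "continuous_on D \<Phi>"
  shows "uniform_limit K (\<lambda>n x. \<Phi> (f n x)) (\<lambda>x. \<Phi> (g x)) F"
proof -
  obtain r where r: "r > 0" "(\<Union>y\<in>g ` K. cball y r) \<subseteq> D"
    using compact_subset_open_imp_cball_epsilon_subset[OF cpt sub] by blast
  define C where "C = (\<Union>y\<in>g ` K. cball y r)"
  have C: "compact C" unfolding C_def by (rule compact_minkowski_sum_cball[OF cpt])
  then have "uniformly_continuous_on C \<Phi>"
    using cont r(2) by (intro compact_uniformly_continuous) (auto simp: C_def intro: continuous_on_subset)
  \<comment> \<open>The values of the approximations eventually lie in a compact neighbourhood of
    the limit values, where \<Phi> is uniformly continuous even if it blows up at the boundary of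
    \<open>D\<close>.\<close>
  moreover have "\<forall>\<^sub>F n in F. \<forall>x\<in>K. f n x \<in> C"
    using uniform_limitD[OF lim r(1)]
    by eventually_elim (auto simp: C_def dist_commute intro!: less_imp_le)
  ultimately show ?thesis
    by (rule uniform_limit_compose_uniformly_continuous_on[OF lim]) (rule compact_imp_closed[OF C])
qed

lemma uniform_limit_compose_bounded:
  fixes f :: "'i \<Rightarrow> 'x \<Rightarrow> 'b::{heine_borel}" and \<Phi> :: "'b \<Rightarrow> real"
  assumes lim: "uniform_limit K f g F" and cpt: "compact (g ` K)" and sub: "open D" "g ` K \<subseteq> D" and cont: "continuous_on D \<Phi>"
  obtains B where "B > 0" "\<forall>\<^sub>F n in F. \<forall>x\<in>K. \<bar>\<Phi> (f n x)\<bar> \<le> B"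
proof -
  have "compact (\<Phi> ` g ` K)" using cont sub(2) cpt by (intro compact_continuous_image) (auto intro: continuous_on_subset)
  then obtain b where b: "\<forall>y\<in>\<Phi> ` g ` K. norm y \<le> b" using compact_imp_bounded bounded_iff by metis
  have "\<forall>\<^sub>F n in F. \<forall>x\<in>K. dist (\<Phi> (f n x)) (\<Phi> (g x)) < 1"
    using uniform_limitD[OF uniform_limit_compose_open[OF assms], of 1] by simp
  then have "\<forall>\<^sub>F n in F. \<forall>x\<in>K. \<bar>\<Phi> (f n x)\<bar> \<le> \<bar>b\<bar> + 1"
  proof (eventually_elim, intro ballI)
    fix n x assume *: "\<forall>x\<in>K. dist (\<Phi> (f n x)) (\<Phi> (g x)) < 1" "x \<in> K"
    then have "dist (\<Phi> (f n x)) (\<Phi> (g x)) < 1" "\<bar>\<Phi> (g x)\<bar> \<le> b" using b by auto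
    then show "\<bar>\<Phi> (f n x)\<bar> \<le> \<bar>b\<bar> + 1" by (simp add: dist_real_def)
  qed
  then show thesis using that[of "\<bar>b\<bar> + 1"] by simp
qed

section \<open>The transformed equation\<close>

lemma pd_powr:
  assumes "f differentiable (at x)" "f x > 0"
  shows "pd (\<lambda>x. f x powr \<alpha>) b x = \<alpha> * f x powr (\<alpha> - 1) * pd f b x"
proof -
  have "((\<lambda>t. t powr \<alpha>) has_real_derivative (\<alpha> * f x powr (\<alpha> - 1))) (at (f x))"
    using assms(2) by (auto intro!: derivative_eq_intros)
  then show ?thesis by (rule pd_compose[where \<phi> = "\<lambda>t. t powr \<alpha>" and f = f, OF assms(1)])
qed

lemma gradient_powr:
  fixes f :: "'a::euclidean_space \<Rightarrow> real"
  assumes "f differentiable (at x)" "f x > 0"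
  shows "gradient (\<lambda>x. f x powr \<alpha>) x = (\<alpha> * f x powr (\<alpha> - 1)) *\<^sub>R gradient f x"
proof (rule gradient_eqI)
  have "((\<lambda>t. t powr \<alpha>) has_real_derivative (\<alpha> * f x powr (\<alpha> - 1))) (at (f x))"
    using assms(2) by (auto intro!: derivative_eq_intros)
  from has_derivative_compose_real[where \<phi> = "\<lambda>t. t powr \<alpha>" and f = f, OF assms(1) this]
  show "(\<lambda>x. f x powr \<alpha>) differentiable (at x)" by (rule differentiableI)
qed (simp add: pd_powr[OF assms] gderiv_gradient(2)[OF assms(1)])

lemma laplacian_powr:
  assumes G: "open G" and f: "Ck_on (Suc (Suc 0)) G f" "\<And>y. y \<in> G \<Longrightarrow> f y > 0" and x: "x \<in> G"
  shows "laplacian (\<lambda>x. f x powr \<alpha>) x = \<alpha> * f x powr (\<alpha> - 1) * laplacian f x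
     + \<alpha> * (\<alpha> - 1) * f x powr (\<alpha> - 2) * (gradient f x \<bullet> gradient f x)"
proof -
  have d: "f differentiable (at y)" "pd f b differentiable (at y)" if "y \<in> G" for y b
    using f(1) that by simp_all
  have dp: "(\<lambda>x. f x powr \<beta>) differentiable (at y)" if "y \<in> G" for y \<beta>
    using Ck_on_powr[OF G f(2) f(1)] that by simp
  have *: "pd (pd (\<lambda>x. f x powr \<alpha>) b) b x = \<alpha> * f x powr (\<alpha> - 1) * pd (pd f b) b x
     + \<alpha> * (\<alpha> - 1) * f x powr (\<alpha> - 2) * (pd f b x * pd f b x)" for b
  proof -
    have "pd (pd (\<lambda>x. f x powr \<alpha>) b) b x = pd (\<lambda>y. \<alpha> * (f y powr (\<alpha> - 1) * pd f b y)) b x"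
      by (rule pd_cong_open(2)[OF G x]) (simp add: pd_powr[OF d(1) f(2)])
    also have "\<dots> = \<alpha> * (f x powr (\<alpha> - 1) * pd (pd f b) b x + (\<alpha> - 1) * f x powr (\<alpha> - 1 - 1) * pd f b x * pd f b x)"
      using d[OF x] dp[OF x] by (simp only: pd_cmult pd_mult differentiable_mult pd_powr[OF d(1)[OF x] f(2)[OF x]])
    also have "\<alpha> - 1 - 1 = \<alpha> - 2" by simp
    finally show ?thesis by (simp only: distrib_left mult_ac)
  qed
  have "laplacian (\<lambda>x. f x powr \<alpha>) x = (\<Sum>b\<in>Basis. \<alpha> * f x powr (\<alpha> - 1) * pd (pd f b) b x
     + \<alpha> * (\<alpha> - 1) * f x powr (\<alpha> - 2) * (pd f b x * pd f b x))"
    unfolding laplacian_def by (intro sum.cong refl *)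
  also have "\<dots> = \<alpha> * f x powr (\<alpha> - 1) * (\<Sum>b\<in>Basis. pd (pd f b) b x)
     + \<alpha> * (\<alpha> - 1) * f x powr (\<alpha> - 2) * (\<Sum>b\<in>Basis. pd f b x * pd f b x)"
    by (subst sum_distrib_left, subst sum_distrib_left, rule sum.distrib)
  also have "(\<Sum>b\<in>Basis. pd f b x * pd f b x) = gradient f x \<bullet> gradient f x"
    by (rule inner_gradient[OF d(1)[OF x] d(1)[OF x], symmetric])
  finally show ?thesis unfolding laplacian_def .
qed

lemma nonlinearity_chain_rule:
  fixes v z :: "'a::euclidean_space \<Rightarrow> real" and a c s q :: real
  assumes G: "open G" and v: "Ck_on (Suc 0) G v" "\<And>y. y \<in> G \<Longrightarrow> v y > 0"
    and z: "Ck_on (Suc 0) G z" "\<And>y. y \<in> G \<Longrightarrow> z y > 0"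
  defines "f \<equiv> \<lambda>x. a * z x / v x + c * v x powr s * z x powr (q / 2)"
  shows "Ck_on (Suc 0) G f"
    "x \<in> G \<Longrightarrow> pd f b x = (- a * z x / (v x)\<^sup>2 + c * s * v x powr (s - 1) * z x powr (q / 2)) * pd v b x
       + (a / v x + c * v x powr s * (q / 2 * z x powr (q / 2 - 1))) * pd z b x"
proof -
  define g where "g x = a * (z x * v x powr (- 1)) + c * (v x powr s * z x powr (q / 2))" for x
  have inv: "v x powr (- 1) = 1 / v x" if "x \<in> G" for x
    using powr_minus_divide[of "v x" 1] v(2)[OF that] by simp
  have fg: "f x = g x" if "x \<in> G" for x
    unfolding f_def g_def inv[OF that] by simp
  have "Ck_on (Suc 0) G g"
    unfolding g_def by (intro Ck_on_add Ck_on_mult Ck_on_const Ck_on_powr G v z)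
  then show "Ck_on (Suc 0) G f" using Ck_on_cong[where f = f and g = g, OF G fg] by blast
  assume x: "x \<in> G"
  have d: "v differentiable (at x)" "z differentiable (at x)" using v(1) z(1) x by simp_all
  have dp: "(\<lambda>x. v x powr \<beta>) differentiable (at x)" "(\<lambda>x. z x powr \<beta>) differentiable (at x)" for \<beta>
    using Ck_on_powr[OF G v(2,1)] Ck_on_powr[OF G z(2,1)] x by simp_all
  have "pd f b x = pd g b x" by (rule pd_cong_open(2)[OF G x fg])
  also have "\<dots> = a * (z x * (- 1 * v x powr (- 1 - 1) * pd v b x) + pd z b x * v x powr (- 1)) +
      c * (v x powr s * (q / 2 * z x powr (q / 2 - 1) * pd z b x) + s * v x powr (s - 1) * pd v b x * z x powr (q / 2))"
    unfolding g_def using d dp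
    by (simp only: pd_add pd_cmult pd_mult pd_powr[OF d(1) v(2)[OF x]] pd_powr[OF d(2) z(2)[OF x]] differentiable_add differentiable_mult differentiable_const)
  also have "v x powr (- 1 - 1) = 1 / (v x)\<^sup>2"
  proof -
    have "v x powr (- 1 - 1) = v x powr - 2" by simp
    also have "\<dots> = 1 / v x powr 2" by (rule powr_minus_divide)
    also have "v x powr 2 = (v x)\<^sup>2" using v(2)[OF x] by (simp add: powr_numeral)
    finally show ?thesis .
  qed
  also note inv[OF x]
  finally show "pd f b x = (- a * z x / (v x)\<^sup>2 + c * s * v x powr (s - 1) * z x powr (q / 2)) * pd v b x
       + (a / v x + c * v x powr s * (q / 2 * z x powr (q / 2 - 1))) * pd z b x"
    by (simp add: algebra_simps)
qed

section \<open>Uniform convergence of pairs and of gradients\<close>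

lemma uniform_limit_Pair:
  fixes f :: "'i \<Rightarrow> 'x \<Rightarrow> 'b::metric_space" and g :: "'i \<Rightarrow> 'x \<Rightarrow> 'c::metric_space"
  assumes "uniform_limit K f f' F" "uniform_limit K g g' F"
  shows "uniform_limit K (\<lambda>n x. (f n x, g n x)) (\<lambda>x. (f' x, g' x)) F"
proof (rule uniform_limitI)
  fix e :: real assume "e > 0"
  then have "\<forall>\<^sub>F n in F. \<forall>x\<in>K. dist (f n x) (f' x) < e / 2" "\<forall>\<^sub>F n in F. \<forall>x\<in>K. dist (g n x) (g' x) < e / 2"
    using uniform_limitD[OF assms(1), of "e / 2"] uniform_limitD[OF assms(2), of "e / 2"] by simp_all
  then show "\<forall>\<^sub>F n in F. \<forall>x\<in>K. dist (f n x, g n x) (f' x, g' x) < e"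
  proof (eventually_elim, intro ballI)
    fix n x assume *: "\<forall>x\<in>K. dist (f n x) (f' x) < e / 2" "\<forall>x\<in>K. dist (g n x) (g' x) < e / 2" "x \<in> K"
    have "dist (f n x, g n x) (f' x, g' x) \<le> dist (f n x) (f' x) + dist (g n x) (g' x)"
      unfolding dist_Pair_Pair by (rule sqrt_sum_squares_le_sum) auto
    also have "\<dots> < e" using * by fastforce
    finally show "dist (f n x, g n x) (f' x, g' x) < e" .
  qed
qed

lemma uniform_limit_gradient:
  fixes U :: "nat \<Rightarrow> 'a::euclidean_space \<Rightarrow> real"
  assumes "\<And>b. uniform_limit K (\<lambda>n. pd (U n) b) (pd u b) F"
    and d: "\<And>n x. x \<in> K \<Longrightarrow> U n differentiable (at x)" "\<And>x. x \<in> K \<Longrightarrow> u differentiable (at x)"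
  shows "uniform_limit K (\<lambda>n. gradient (U n)) (gradient u) F"
proof (rule uniform_limitI)
  fix e :: real assume e: "e > 0"
  define e' where "e' = e / (2 * real DIM('a))"
  have e': "e' > 0" "real DIM('a) * e' < e" using e by (auto simp: e'_def)
  have "\<forall>\<^sub>F n in F. \<forall>b\<in>Basis. \<forall>x\<in>K. dist (pd (U n) b x) (pd u b x) < e'"
    using uniform_limitD[OF assms(1) e'(1)] by (intro eventually_ball_finite) auto
  then show "\<forall>\<^sub>F n in F. \<forall>x\<in>K. dist (gradient (U n) x) (gradient u x) < e"
  proof (eventually_elim, intro ballI)
    fix n x assume *: "\<forall>b\<in>Basis. \<forall>x\<in>K. dist (pd (U n) b x) (pd u b x) < e'" and x: "x \<in> K"
    have "dist (gradient (U n) x) (gradient u x) \<le> (\<Sum>b\<in>Basis. \<bar>(gradient (U n) x - gradient u x) \<bullet> b\<bar>)"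
      unfolding dist_norm by (rule norm_le_l1)
    also have "\<dots> \<le> (\<Sum>b\<in>(Basis::'a set). e')"
    proof (rule sum_mono)
      fix b :: 'a assume "b \<in> Basis"
      then have "dist (pd (U n) b x) (pd u b x) < e'" using * x by blast
      then show "\<bar>(gradient (U n) x - gradient u x) \<bullet> b\<bar> \<le> e'"
        by (simp add: inner_diff_left gderiv_gradient(2)[OF d(1)[OF x]] gderiv_gradient(2)[OF d(2)[OF x]] dist_real_def)
    qed
    also have "\<dots> = real DIM('a) * e'" by simp
    also note e'(2)
    finally show "dist (gradient (U n) x) (gradient u x) < e" .
  qed
qed

text \<open>For t = u, n = |\<nabla>u| and v = u^(-\<sigma>) one has |\<nabla>v| = \<sigma>
  t^(-\<sigma>-1) n. The right sides are the two parts of \<Delta>v: the second derivative of the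
  power, and -\<sigma> u^(-\<sigma>-1) \<Delta>u. The exponent \<open>s\<close> is the one for which
  the powers of \<open>t\<close> balance, and \<sigma>^(1-q) compensates the factor \<sigma>^q
  contained in |\<nabla>v|^q.\<close>

lemma transformed_nonlinearity:
  fixes t n \<sigma> s p q :: real
  assumes pos: "t > 0" "n > 0" "\<sigma> > 0" and s: "\<sigma> * s = 1 + \<sigma> - p - (1 + \<sigma>) * q"
  shows "(1 + 1 / \<sigma>) * (\<sigma> * t powr (- \<sigma> - 1) * n)\<^sup>2 / t powr - \<sigma> = \<sigma> * (\<sigma> + 1) * t powr (- \<sigma> - 2) * n\<^sup>2"
    "\<sigma> powr (1 - q) * (t powr - \<sigma>) powr s * ((\<sigma> * t powr (- \<sigma> - 1) * n)\<^sup>2) powr (q / 2)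
      = \<sigma> * t powr (- \<sigma> - 1) * (t powr p * n powr q)"
proof -
  have "t powr (- \<sigma> - 1) * t powr (- \<sigma> - 1) = t powr (- \<sigma> - 2) * t powr - \<sigma>"
    by (simp add: powr_add[symmetric])
  then have 1: "(t powr (- \<sigma> - 1))\<^sup>2 / t powr - \<sigma> = t powr (- \<sigma> - 2)"
    using pos by (simp add: power2_eq_square)
  have "(1 + 1 / \<sigma>) * (\<sigma> * t powr (- \<sigma> - 1) * n)\<^sup>2 / t powr - \<sigma>
      = ((1 + 1 / \<sigma>) * \<sigma>\<^sup>2) * ((t powr (- \<sigma> - 1))\<^sup>2 / t powr - \<sigma>) * n\<^sup>2"
    by (simp add: power_mult_distrib)
  also have "(1 + 1 / \<sigma>) * \<sigma>\<^sup>2 = \<sigma> * (\<sigma> + 1)" using pos by (simp add: field_simps power2_eq_square)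
  finally show "(1 + 1 / \<sigma>) * (\<sigma> * t powr (- \<sigma> - 1) * n)\<^sup>2 / t powr - \<sigma> = \<sigma> * (\<sigma> + 1) * t powr (- \<sigma> - 2) * n\<^sup>2"
    unfolding 1 .
  define r where "r = \<sigma> * t powr (- \<sigma> - 1) * n"
  have r: "r > 0" using pos by (simp add: r_def)
  have "(r\<^sup>2) powr (q / 2) = (r powr 2) powr (q / 2)" using r by (simp add: powr_numeral)
  also have "\<dots> = r powr q" by (simp add: powr_powr)
  also have "\<dots> = \<sigma> powr q * t powr ((- \<sigma> - 1) * q) * n powr q"
    using pos by (simp add: r_def powr_mult powr_powr)
  finally have 2: "(r\<^sup>2) powr (q / 2) = \<sigma> powr q * t powr ((- \<sigma> - 1) * q) * n powr q" .
  have "\<sigma> powr (1 - q) * (t powr - \<sigma>) powr s * (r\<^sup>2) powr (q / 2)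
     = (\<sigma> powr (1 - q) * \<sigma> powr q) * (t powr (- \<sigma> * s) * t powr ((- \<sigma> - 1) * q)) * n powr q"
    unfolding 2 by (simp add: powr_powr)
  also have "\<sigma> powr (1 - q) * \<sigma> powr q = \<sigma>" using pos by (simp add: powr_add[symmetric])
  also have "t powr (- \<sigma> * s) * t powr ((- \<sigma> - 1) * q) = t powr ((- \<sigma> - 1) + p)"
  proof -
    have "- \<sigma> * s + (- \<sigma> - 1) * q = (- \<sigma> - 1) + p" using s by (simp add: algebra_simps)
    then show ?thesis by (simp only: powr_add[symmetric])
  qed
  also have "\<dots> = t powr (- \<sigma> - 1) * t powr p" by (rule powr_add)
  finally show "\<sigma> powr (1 - q) * (t powr - \<sigma>) powr s * ((\<sigma> * t powr (- \<sigma> - 1) * n)\<^sup>2) powr (q / 2)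
      = \<sigma> * t powr (- \<sigma> - 1) * (t powr p * n powr q)"
    unfolding r_def by (simp only: mult.assoc)
qed

text \<open>The argument on a single ball. If the maximum \<open>W\<close> of w =
  \<eta>|\<nabla>v|^2 exceeded the bound, \<open>bernstein_integral\<close>, applied to a
  sufficiently good approximation, would give 2V \<le> E^2 |K|, whereas \<open>E\<close> is chosen
  with E^2 |K| \<le> V and V > 0. At the centre \<eta> = 1, so \<open>W\<close> controls
  |\<nabla>v|^2 there.\<close>

lemma interior_gradient_estimate:
  fixes u :: "'a::euclidean_space \<Rightarrow> real" and p q \<sigma> \<delta> a s m R :: real
  defines "C1 \<equiv> 64 * (a + \<bar>q\<bar>)\<^sup>2 / \<delta> + 4 * real DIM('a) + 32"
  assumes \<sigma>: "\<sigma> > 0" and a: "a = 1 + 1 / \<sigma>" and s: "\<sigma> * s = 1 + \<sigma> - p - (1 + \<sigma>) * q"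
    and \<delta>: "\<delta> > 0" "\<delta> \<le> a\<^sup>2 / real DIM('a) - a" "\<delta> \<le> 1 / real DIM('a)"
    and cross: "2 * a / real DIM('a) + s \<ge> 0"
    and \<Omega>: "open \<Omega>" and sol: "positive_solution \<Omega> p q u"
    and m: "m > 0" "\<And>x. x \<in> \<Omega> \<Longrightarrow> u x \<ge> m" and R: "R > 0" "cball x0 R \<subseteq> \<Omega>"
  shows "(norm (gradient (\<lambda>y. u y powr - \<sigma>) x0))\<^sup>2 \<le> 16 * C1 * (m powr - \<sigma>)\<^sup>2 / (\<delta> * R\<^sup>2)"
proof -
  define N where "N = real DIM('a)"
  have N: "N > 0" by (simp add: N_def)
  have apos: "a \<ge> 0" using \<sigma> a by simp
  have C1: "C1 > 0" unfolding C1_def using \<delta>(1) by (intro add_nonneg_pos add_nonneg_nonneg) auto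
  define c where "c = \<sigma> powr (1 - q)"
  have c: "c > 0" using \<sigma> by (simp add: c_def)
  define M where "M = m powr - \<sigma>"
  have M: "M > 0" using m by (simp add: M_def)
  have uC: "Ck_on (Suc 0) \<Omega> u" and C1u: "C1_on \<Omega> u"
    using sol C1_on_imp_Ck_on by (auto simp: positive_solution_def)
  have upos: "u x > 0" if "x \<in> \<Omega>" for x using m(1) m(2)[OF that] by linarith
  have du: "u differentiable (at x)" if "x \<in> \<Omega>" for x using uC that by simp
  have uc: "continuous_on \<Omega> u" "continuous_on \<Omega> (gradient u)"
    using C1u Ck_on_imp_continuous[OF uC] by (auto simp: C1_on_def)
  \<comment> \<open>Every quantity in the argument (v, \<nabla>v, z, f, Fz, e) is a continuous
    function of the triple (u, \<nabla>u, \<Delta>u) on \<open>D0\<close>. Uniform convergence of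
    the triple thus transfers to all of them at once.\<close>
  define \<phi>v :: "real \<times> 'a \<times> real \<Rightarrow> real" where "\<phi>v Y = fst Y powr - \<sigma>" for Y
  define \<phi>g :: "real \<times> 'a \<times> real \<Rightarrow> 'a" where "\<phi>g Y = (- \<sigma> * fst Y powr (- \<sigma> - 1)) *\<^sub>R fst (snd Y)" for Y
  define \<phi>z where "\<phi>z Y = \<phi>g Y \<bullet> \<phi>g Y" for Y
  define \<phi>f where "\<phi>f Y = a * \<phi>z Y / \<phi>v Y + c * \<phi>v Y powr s * \<phi>z Y powr (q / 2)" for Y
  define \<phi>F where "\<phi>F Y = a / \<phi>v Y + c * \<phi>v Y powr s * (q / 2 * \<phi>z Y powr (q / 2 - 1))" for Y
  define \<phi>e where "\<phi>e Y = - \<sigma> * fst Y powr (- \<sigma> - 1) * snd (snd Y)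
     + - \<sigma> * (- \<sigma> - 1) * fst Y powr (- \<sigma> - 2) * (fst (snd Y) \<bullet> fst (snd Y)) - \<phi>f Y" for Y
  define D0 where "D0 = {Y :: real \<times> 'a \<times> real. fst Y > 0 \<and> fst (snd Y) \<noteq> 0}"
  have D0: "open D0"
    unfolding D0_def by (intro open_Collect_conj open_Collect_less open_Collect_neq continuous_intros)
  have pv: "\<phi>v Y > 0" "\<phi>z Y > 0" if "Y \<in> D0" for Y
    using that \<sigma> by (auto simp: D0_def \<phi>v_def \<phi>z_def \<phi>g_def)
  have cv: "continuous_on D0 \<phi>v" and cg: "continuous_on D0 \<phi>g"
    unfolding \<phi>v_def[abs_def] \<phi>g_def[abs_def] by (auto intro!: continuous_intros simp: D0_def)
  have cz: "continuous_on D0 \<phi>z" unfolding \<phi>z_def[abs_def] by (intro continuous_intros cg)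
  have nz: "\<forall>Y\<in>D0. \<phi>v Y \<noteq> 0" "\<forall>Y\<in>D0. \<phi>z Y \<noteq> 0" using pv by fastforce+
  have cf: "continuous_on D0 \<phi>f" unfolding \<phi>f_def[abs_def] by (intro continuous_intros cv cz nz)
  have cF: "continuous_on D0 \<phi>F" unfolding \<phi>F_def[abs_def] by (intro continuous_intros cv cz nz)
  have "continuous_on D0 (\<lambda>Y. fst Y powr \<beta>)" for \<beta>
    by (auto intro!: continuous_intros simp: D0_def)
  then have ce: "continuous_on D0 \<phi>e"
    unfolding \<phi>e_def[abs_def] by (intro continuous_intros cf) (auto simp: D0_def)
  have cgn: "continuous_on D0 (\<lambda>Y. norm (\<phi>g Y))" by (intro continuous_intros cg)
  \<comment> \<open>\<open>u\<close> itself has no classical Laplacian at hand; its slot is filled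
    with the value prescribed by the equation, which is also the limit of the Laplacians of the
    approximations.\<close>
  define Y where "Y x = (u x, gradient u x, - (u x powr p * norm (gradient u x) powr q))" for x
  define \<eta> where "\<eta> x = cutoff x0 R x * cutoff x0 R x" for x
  define w where "w x = \<eta> x * \<phi>z (Y x)" for x
  have wc: "continuous_on (cball x0 R) w"
  proof -
    have "continuous_on \<Omega> (\<lambda>x. \<phi>z (Y x))"
      unfolding \<phi>z_def \<phi>g_def Y_def fst_conv snd_conv using upos uc by (intro continuous_intros) fastforce+
    moreover have "continuous_on UNIV \<eta>"
      unfolding \<eta>_def using Ck_on_imp_continuous[OF Ck_on_cutoff[of 0 x0 R]] by (intro continuous_intros)
    ultimately show ?thesis
      unfolding w_def using R(2) by (intro continuous_intros) (auto intro: continuous_on_subset)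
  qed
  obtain x1 where x1: "x1 \<in> cball x0 R" "\<And>x. x \<in> cball x0 R \<Longrightarrow> w x \<le> w x1"
    using continuous_attains_sup[OF compact_cball _ wc] R(1) by (metis cball_eq_empty not_less less_imp_le)
  define W where "W = w x1"
  have "W \<le> 16 * C1 * M\<^sup>2 / (\<delta> * R\<^sup>2)"
  proof (rule ccontr)
    assume "\<not> W \<le> 16 * C1 * M\<^sup>2 / (\<delta> * R\<^sup>2)"
    then have big: "16 * C1 * M\<^sup>2 < W * (\<delta> * R\<^sup>2)"
      using \<delta>(1) R(1) by (simp add: not_le pos_divide_less_eq)
    have "0 < W * (\<delta> * R\<^sup>2)" using C1 M by (intro less_trans[OF _ big]) simp
    then have W: "W > 0" by (rule zero_less_mult_pos2) (use \<delta>(1) R(1) in simp)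
    \<comment> \<open>Halving \<open>W\<close> leaves room for the level and for the approximation.
      The number 16 in the bound is 2 * 2^2 * 2: the factor 2 demanded by
      \<open>zero_order_bound\<close>, the square of v \<le> 2M, and this halving.\<close>
    define k1 where "k1 = W / 2"
    have k1: "k1 > 0" using W by (simp add: k1_def)
    define \<delta>0 where "\<delta>0 = k1 * C1 / R\<^sup>2"
    have \<delta>0: "\<delta>0 > 0" using k1 C1 R(1) by (simp add: \<delta>0_def)
    \<comment> \<open>On this set the cutoff and the gradient of \<open>u\<close> are both nonzero:
      it stays inside the open ball, and its image under \<open>Y\<close> is a compact subset of
      \<open>D0\<close>. All uniform estimates for the approximations are made here.\<close>
    define K1 where "K1 = {x \<in> cball x0 R. w x \<ge> k1}"
    have sphere: "\<eta> x = 0" if "x \<in> cball x0 R" "x \<notin> ball x0 R" for x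
    proof -
      have "norm (x - x0) = R" using that by (simp add: dist_norm norm_minus_commute)
      then show ?thesis using R(1) by (simp add: \<eta>_def cutoff_def power2_norm_eq_inner[symmetric])
    qed
    have level: "compact {x \<in> cball x0 R. w x \<ge> t}" for t
    proof -
      have "{x \<in> cball x0 R. w x \<ge> t} = cball x0 R \<inter> w -` {t..}" by auto
      then show ?thesis
        using continuous_closed_preimage[OF wc closed_cball closed_atLeast, of t] bounded_cball
        by (metis bounded_Int compact_eq_bounded_closed)
    qed
    have K1c: "compact K1" unfolding K1_def by (rule level)
    have K1b: "x \<in> ball x0 R" "x \<in> \<Omega>" "\<eta> x > 0" "\<eta> x \<le> 1" "\<phi>z (Y x) \<ge> k1" "Y x \<in> D0" if "x \<in> K1" for x
    proof -
      have x: "x \<in> cball x0 R" "w x \<ge> k1" using that by (auto simp: K1_def)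
      show b: "x \<in> ball x0 R" using sphere[OF x(1)] x(2) k1 by (force simp: w_def)
      show O: "x \<in> \<Omega>" using x(1) R(2) by blast
      note \<theta> = cutoff_bounds[OF R(1) b]
      show \<eta>: "\<eta> x > 0" "\<eta> x \<le> 1" using \<theta> by (auto simp: \<eta>_def mult_le_one)
      have z0: "\<phi>z (Y x) \<ge> 0" by (simp add: \<phi>z_def)
      have "w x \<le> 1 * \<phi>z (Y x)" unfolding w_def using \<eta> z0 by (intro mult_right_mono) auto
      then show z: "\<phi>z (Y x) \<ge> k1" using x(2) by linarith
      then show "Y x \<in> D0" using k1 upos[OF O] by (auto simp: D0_def Y_def \<phi>z_def \<phi>g_def)
    qed
    have K1sub: "K1 \<subseteq> {y \<in> \<Omega>. gradient u y \<noteq> 0}"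
      using K1b(2,6) by (auto simp: D0_def Y_def)
    obtain U where U: "\<And>n k. Ck_on k UNIV (U n)" and limU: "uniform_limit K1 U u sequentially"
      "\<And>b. uniform_limit K1 (\<lambda>n. pd (U n) b) (pd u b) sequentially"
      "uniform_limit K1 (\<lambda>n x. \<Sum>b\<in>Basis. pd (pd (U n) b) b x) (\<lambda>x. - (u x powr p * norm (gradient u x) powr q)) sequentially"
    proof (rule smooth_approximation[OF \<Omega> sol K1c K1sub])
      fix U assume "\<And>n k. Ck_on k UNIV (U n)" "uniform_limit K1 U u sequentially"
        "\<And>b. uniform_limit K1 (\<lambda>n. pd (U n) b) (pd u b) sequentially"
        "uniform_limit K1 (\<lambda>n x. \<Sum>b\<in>Basis. pd (pd (U n) b) b x) (\<lambda>x. - (u x powr p * norm (gradient u x) powr q)) sequentially"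
      then show thesis by (rule that)
    qed
    have dU: "U n differentiable (at x)" for n x using U[of "Suc 0" n] by simp
    define Yn where "Yn n x = (U n x, gradient (U n) x, laplacian (U n) x)" for n x
    have limg: "uniform_limit K1 (\<lambda>n. gradient (U n)) (gradient u) sequentially"
      by (rule uniform_limit_gradient[OF limU(2) dU du]) (use K1b in auto)
    have limY: "uniform_limit K1 Yn Y sequentially"
      unfolding Yn_def[abs_def] Y_def[abs_def] laplacian_def by (intro uniform_limit_Pair limU limg)
    have YK: "compact (Y ` K1)" "Y ` K1 \<subseteq> D0"
    proof -
      have "continuous_on K1 u" "continuous_on K1 (gradient u)"
        using uc K1b(2) by (auto intro: continuous_on_subset)
      then have "continuous_on K1 Y"
        unfolding Y_def[abs_def] using K1sub upos by (intro continuous_intros) fastforce+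
      then show "compact (Y ` K1)" using K1c by (rule compact_continuous_image)
      show "Y ` K1 \<subseteq> D0" using K1b(6) by blast
    qed
    note close = uniform_limitD[OF uniform_limit_compose_open[OF limY YK(1) D0 YK(2)]]
    note bdd = uniform_limit_compose_bounded[OF limY YK(1) D0 YK(2)]
    obtain B1 where B1: "B1 > 0" "\<forall>\<^sub>F n in sequentially. \<forall>x\<in>K1. \<bar>\<phi>F (Yn n x)\<bar> \<le> B1" by (rule bdd[OF cF])
    obtain B2 where B2: "B2 > 0" "\<forall>\<^sub>F n in sequentially. \<forall>x\<in>K1. \<bar>norm (\<phi>g (Yn n x))\<bar> \<le> B2" by (rule bdd[OF cgn])
    obtain B3 where B3: "B3 > 0" "\<forall>\<^sub>F n in sequentially. \<forall>x\<in>K1. \<bar>\<phi>f (Yn n x)\<bar> \<le> B3" by (rule bdd[OF cf])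
    have "continuous_on (Y ` K1) \<phi>z" using cz YK(2) by (rule continuous_on_subset)
    then have "bounded (\<phi>z ` Y ` K1)" by (rule compact_imp_bounded[OF compact_continuous_image[OF _ YK(1)]])
    then obtain zb where zb': "zb > 0" "\<forall>y\<in>\<phi>z ` Y ` K1. norm y \<le> zb"
      unfolding bounded_pos by blast
    have zb: "zb > 0" "\<phi>z (Y x) \<le> zb" if "x \<in> K1" for x
    proof -
      have "norm (\<phi>z (Y x)) \<le> zb" using zb'(2) that by blast
      then show "zb > 0" "\<phi>z (Y x) \<le> zb" using zb'(1) by auto
    qed
    \<comment> \<open>On \<open>K1\<close> the product \<eta>z is at least \<open>k1\<close> while z
      is at most \<open>zb\<close>; this keeps the factor 2/\<eta> in
      \<open>bernstein_integral\<close> bounded.\<close>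
    define \<eta>0 where "\<eta>0 = k1 / zb"
    have \<eta>0: "\<eta>0 > 0" using k1 zb'(1) by (simp add: \<eta>0_def)
    have \<eta>low: "\<eta> x \<ge> \<eta>0" if "x \<in> K1" for x
    proof -
      have "k1 \<le> \<eta> x * \<phi>z (Y x)" using that by (simp add: K1_def w_def)
      also have "\<dots> \<le> \<eta> x * zb" using zb(2)[OF that] K1b(3)[OF that] by (intro mult_left_mono) auto
      finally show ?thesis using zb'(1) by (simp add: \<eta>0_def pos_divide_le_eq)
    qed
    \<comment> \<open>\<open>B\<close> depends on bounds over \<open>K1\<close> that hold for all
      late approximations, so it may be used to choose the level and the tolerance before an
      approximation is selected.\<close>
    define B where "B = 2 / \<eta>0 * (4 / R) + 2 * B1 * B2 + (4 * B3 + 2 * (B3 + 1) + 2 * (4 / R * B2)) + 4 * B2 + B3"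
    have B: "B > 0" "2 / \<eta>0 * (4 / R) + 2 * B1 * B2 \<le> B" "4 * B3 + 2 * (B3 + 1) + 2 * (4 / R * B2) \<le> B" "4 * B2 \<le> B"
      using \<eta>0 R(1) B1(1) B2(1) B3(1) by (auto simp: B_def add_nonneg_nonneg intro!: add_pos_pos)
    \<comment> \<open>The level is k = W - \<mu>. The approximate w exceeds \<open>W\<close> by less
      than \<mu>/4, so (w - k)_+ is at most 2\<mu>; the second entry makes this small enough for
      absorption, and the first keeps \<open>k\<close> and the set \<open>K\<close> well above
      \<open>k1\<close>.\<close>
    define \<mu> where "\<mu> = min (W / 4) (\<delta>0 / (2 * B\<^sup>2))"
    have \<mu>: "\<mu> > 0" "\<mu> \<le> W / 4" "B\<^sup>2 * (2 * \<mu>) \<le> \<delta>0"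
    proof -
      show "\<mu> > 0" "\<mu> \<le> W / 4" using W \<delta>0 B(1) by (auto simp: \<mu>_def)
      have "\<mu> \<le> \<delta>0 / (2 * B\<^sup>2)" by (simp add: \<mu>_def)
      then show "B\<^sup>2 * (2 * \<mu>) \<le> \<delta>0" using B(1) by (simp add: pos_le_divide_eq mult_ac)
    qed
    define k where "k = W - \<mu>"
    \<comment> \<open>The inclusions K \<subseteq> G \<subseteq> K1 divide the roles:
      \<open>K1\<close> carries the uniform estimates, the open set \<open>G\<close> the
      differential calculus, and \<open>K\<close> contains the support of the test field. The margin
      \<mu>/2 in \<open>K\<close> exceeds the error \<mu>/4 of the approximate w, so outside
      \<open>K\<close> that function stays below \<open>k\<close>.\<close>
    define G where "G = {x \<in> ball x0 R. w x > k1}"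
    define K where "K = {x \<in> cball x0 R. w x \<ge> k - \<mu> / 2}"
    have wcb: "continuous_on (ball x0 R) w" using wc by (rule continuous_on_subset) auto
    have openw: "open {x \<in> ball x0 R. w x > t}" for t
    proof -
      have "{x \<in> ball x0 R. w x > t} = ball x0 R \<inter> w -` {t<..}" by auto
      then show ?thesis using continuous_open_preimage[OF wcb open_ball open_greaterThan, of t] by simp
    qed
    have G: "open G" unfolding G_def by (rule openw)
    have GK1: "G \<subseteq> K1" by (auto simp: G_def K1_def)
    have K: "compact K" unfolding K_def by (rule level)
    have KG: "K \<subseteq> G"
    proof
      fix x assume x: "x \<in> K"
      then have *: "x \<in> cball x0 R" "w x > k1" using \<mu> W by (auto simp: K_def k_def k1_def)
      then have "x \<in> ball x0 R" using sphere[OF *(1)] k1 by (force simp: w_def)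
      then show "x \<in> G" using * by (simp add: G_def)
    qed
    have "W > W - \<mu> / 4" using \<mu>(1) by simp
    moreover have "x1 \<in> ball x0 R" using sphere[OF x1(1)] W by (force simp: w_def W_def)
    ultimately have "x1 \<in> {x \<in> ball x0 R. w x > W - \<mu> / 4}" by (simp add: W_def)
    \<comment> \<open>Around the maximum point w > W - \<mu>/4, so the approximate w is at least W -
      \<mu>/2 = k + \<mu>/2 on this ball. This is the ball of \<open>bernstein_integral\<close>,
      with c = \<mu>/2.\<close>
    then obtain r where r: "r > 0" "ball x1 r \<subseteq> {x \<in> ball x0 R. w x > W - \<mu> / 4}"
      using openw open_contains_ball by metis
    define V where "V = (\<mu> / 2)\<^sup>2 * measure lborel (ball x1 r)"
    have V: "V > 0" using \<mu>(1) content_ball_pos[OF r(1)] by (simp add: V_def)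
    \<comment> \<open>Chosen so that E^2 times the measure of \<open>K\<close> is at most
      \<open>V\<close>, which contradicts the inequality 2V \<le> E^2 |K|; the summand 1 covers the
      case of measure zero.\<close>
    define E where "E = sqrt (V / (measure lborel K + 1))"
    have mK: "measure lborel K + 1 > 0" by (simp add: add_nonneg_pos)
    have E: "E > 0" "E\<^sup>2 * measure lborel K \<le> V"
    proof -
      show "E > 0" using V mK by (simp add: E_def)
      have "E\<^sup>2 * (measure lborel K + 1) = V" using V mK by (simp add: E_def)
      then have "E\<^sup>2 * measure lborel K + E\<^sup>2 = V" by (simp add: distrib_left)
      then show "E\<^sup>2 * measure lborel K \<le> V" using zero_le_power2[of E] by linarith
    qed
    define \<epsilon> where "\<epsilon> = min E (min 1 (\<delta>0 / (4 * B)))"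
    have \<epsilon>: "\<epsilon> > 0" "\<epsilon> \<le> E" "\<epsilon> \<le> 1" "4 * B * \<epsilon> \<le> \<delta>0"
    proof -
      show "\<epsilon> > 0" "\<epsilon> \<le> E" "\<epsilon> \<le> 1" using E \<delta>0 B(1) by (auto simp: \<epsilon>_def)
      have "\<epsilon> \<le> \<delta>0 / (4 * B)" by (simp add: \<epsilon>_def)
      then show "4 * B * \<epsilon> \<le> \<delta>0" using B(1) by (simp add: pos_le_divide_eq mult_ac)
    qed
    have "\<forall>\<^sub>F n in sequentially. (\<forall>x\<in>K1. \<bar>\<phi>F (Yn n x)\<bar> \<le> B1) \<and> (\<forall>x\<in>K1. \<bar>norm (\<phi>g (Yn n x))\<bar> \<le> B2) \<and> (\<forall>x\<in>K1. \<bar>\<phi>f (Yn n x)\<bar> \<le> B3)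
       \<and> (\<forall>x\<in>K1. dist (U n x) (u x) < m) \<and> (\<forall>x\<in>K1. dist (\<phi>v (Yn n x)) (\<phi>v (Y x)) < M)
       \<and> (\<forall>x\<in>K1. dist (\<phi>z (Yn n x)) (\<phi>z (Y x)) < \<mu> / 4) \<and> (\<forall>x\<in>K1. dist (\<phi>e (Yn n x)) (\<phi>e (Y x)) < \<epsilon>)"
      by (intro eventually_conj B1 B2 B3 uniform_limitD[OF limU(1) m(1)] close[OF cv M] close[OF cz] close[OF ce \<epsilon>(1)]) (use \<mu>(1) in simp)
    then obtain n where "(\<forall>x\<in>K1. \<bar>\<phi>F (Yn n x)\<bar> \<le> B1) \<and> (\<forall>x\<in>K1. \<bar>norm (\<phi>g (Yn n x))\<bar> \<le> B2) \<and> (\<forall>x\<in>K1. \<bar>\<phi>f (Yn n x)\<bar> \<le> B3)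
       \<and> (\<forall>x\<in>K1. dist (U n x) (u x) < m) \<and> (\<forall>x\<in>K1. dist (\<phi>v (Yn n x)) (\<phi>v (Y x)) < M)
       \<and> (\<forall>x\<in>K1. dist (\<phi>z (Yn n x)) (\<phi>z (Y x)) < \<mu> / 4) \<and> (\<forall>x\<in>K1. dist (\<phi>e (Yn n x)) (\<phi>e (Y x)) < \<epsilon>)"
      using eventually_happens'[OF sequentially_bot] by blast
    then have nB: "\<And>x. x \<in> K1 \<Longrightarrow> \<bar>\<phi>F (Yn n x)\<bar> \<le> B1" "\<And>x. x \<in> K1 \<Longrightarrow> norm (\<phi>g (Yn n x)) \<le> B2" "\<And>x. x \<in> K1 \<Longrightarrow> \<bar>\<phi>f (Yn n x)\<bar> \<le> B3"
      and nU: "\<And>x. x \<in> K1 \<Longrightarrow> \<bar>U n x - u x\<bar> < m" and nv: "\<And>x. x \<in> K1 \<Longrightarrow> \<bar>\<phi>v (Yn n x) - \<phi>v (Y x)\<bar> < M"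
      and nz: "\<And>x. x \<in> K1 \<Longrightarrow> \<bar>\<phi>z (Yn n x) - \<phi>z (Y x)\<bar> < \<mu> / 4" and ne: "\<And>x. x \<in> K1 \<Longrightarrow> \<bar>\<phi>e (Yn n x) - \<phi>e (Y x)\<bar> < \<epsilon>"
      by (simp_all add: dist_real_def)
    have Upos: "U n x > 0" if "x \<in> G" for x
      using nU[of x] m(2)[OF K1b(2)[of x]] that GK1 by fastforce
    define v where "v x = U n x powr - \<sigma>" for x
    define z where "z x = (\<Sum>b\<in>Basis. pd v b x * pd v b x)" for x
    have UC: "Ck_on j G (U n)" for j by (rule Ck_on_subset[OF U]) simp
    have vC: "Ck_on j G v" for j unfolding v_def by (intro Ck_on_powr G Upos UC)
    have dv: "v differentiable (at x)" if "x \<in> G" for x using vC[of "Suc 0"] that by simp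
    have v\<phi>: "v x = \<phi>v (Yn n x)" for x by (simp add: v_def \<phi>v_def Yn_def)
    have g\<phi>: "gradient v x = \<phi>g (Yn n x)" if "x \<in> G" for x
      unfolding v_def[abs_def] by (simp add: gradient_powr[OF dU Upos[OF that]] \<phi>g_def Yn_def)
    have z\<phi>: "z x = \<phi>z (Yn n x)" if "x \<in> G" for x
      unfolding z_def \<phi>z_def g\<phi>[OF that, symmetric] by (rule inner_gradient[OF dv dv, symmetric]) (use that in auto)
    define f where "f x = a * z x / v x + c * v x powr s * z x powr (q / 2)" for x
    define Fv where "Fv x = - a * z x / (v x)\<^sup>2 + c * s * v x powr (s - 1) * z x powr (q / 2)" for x
    define Fz where "Fz x = a / v x + c * v x powr s * (q / 2 * z x powr (q / 2 - 1))" for x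
    define e where "e x = laplacian v x - f x" for x
    have f\<phi>: "f x = \<phi>f (Yn n x)" "Fz x = \<phi>F (Yn n x)" if "x \<in> G" for x
      by (simp_all add: f_def Fz_def \<phi>f_def \<phi>F_def z\<phi>[OF that] v\<phi>)
    have e\<phi>: "e x = \<phi>e (Yn n x)" if "x \<in> G" for x
    proof -
      have "laplacian v x = - \<sigma> * U n x powr (- \<sigma> - 1) * laplacian (U n) x
          + - \<sigma> * (- \<sigma> - 1) * U n x powr (- \<sigma> - 2) * (gradient (U n) x \<bullet> gradient (U n) x)"
        unfolding v_def[abs_def] by (rule laplacian_powr[where f = "U n" and \<alpha> = "- \<sigma>", OF G UC Upos that])
      then show ?thesis
        unfolding e_def \<phi>e_def f\<phi>(1)[OF that] by (simp add: Yn_def)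
    qed
    have vpos: "v x > 0" if "x \<in> G" for x using Upos[OF that] by (simp add: v_def)
    have zpos: "z x > 0" if "x \<in> G" for x
    proof -
      have "x \<in> K1" using that GK1 by blast
      from nz[OF this] K1b(5)[OF this] \<mu>(2) W show ?thesis
        unfolding z\<phi>[OF that] k1_def by linarith
    qed
    \<comment> \<open>This is the transformed equation in pointwise form: the error expression
      vanishes at the limit triple, so for the approximations it is smaller than \<epsilon>.\<close>
    have \<phi>e0: "\<phi>e (Y x) = 0" if "x \<in> K1" for x
    proof -
      have t: "u x > 0" "norm (gradient u x) > 0" using K1b(6)[OF that] by (simp_all add: D0_def Y_def)
      have z: "\<phi>z (Y x) = (\<sigma> * u x powr (- \<sigma> - 1) * norm (gradient u x))\<^sup>2"
        by (simp add: \<phi>z_def \<phi>g_def Y_def dot_square_norm power_mult_distrib power2_eq_square)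
      have y: "\<phi>v (Y x) = u x powr - \<sigma>" "fst (Y x) = u x" "fst (snd (Y x)) = gradient u x"
          "snd (snd (Y x)) = - (u x powr p * norm (gradient u x) powr q)"
        by (simp_all add: \<phi>v_def Y_def)
      show ?thesis
        unfolding \<phi>e_def \<phi>f_def z c_def a y
          transformed_nonlinearity[OF t \<sigma> s] dot_square_norm
        by (simp add: algebra_simps)
    qed
    have eE: "\<bar>e x\<bar> < \<epsilon>" if "x \<in> G" for x
      using ne[of x] \<phi>e0[of x] e\<phi>[OF that] that GK1 by auto
    have zC: "Ck_on (Suc 0) G z" unfolding z_def using vC[of "Suc (Suc 0)"] by (intro Ck_on_sum Ck_on_mult G) auto
    note chain = nonlinearity_chain_rule[OF G vC vpos zC zpos, where a = a and c = c and s = s and q = q, folded f_def[abs_def] Fv_def Fz_def]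
    have w\<phi>: "\<bar>\<eta> x * z x - w x\<bar> < \<mu> / 4" if "x \<in> G" for x
    proof -
      have K1x: "x \<in> K1" using that GK1 by blast
      have "\<bar>\<eta> x * z x - w x\<bar> = \<eta> x * \<bar>\<phi>z (Yn n x) - \<phi>z (Y x)\<bar>"
        using K1b(3)[OF K1x] by (simp add: w_def z\<phi>[OF that] abs_mult right_diff_distrib[symmetric])
      also have "\<dots> \<le> 1 * \<bar>\<phi>z (Yn n x) - \<phi>z (Y x)\<bar>" using K1b(4)[OF K1x] by (intro mult_right_mono) auto
      also have "\<dots> < \<mu> / 4" using nz[OF K1x] by simp
      finally show ?thesis .
    qed
    have \<eta>C: "Ck_on j UNIV \<eta>" for j unfolding \<eta>_def by (intro Ck_on_mult Ck_on_cutoff open_UNIV)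
    have n\<eta>: "norm (gradient \<eta> x) \<le> 4 * cutoff x0 R x / R" "norm (gradient \<eta> x) \<le> 4 / R" if "x \<in> G" for x
    proof -
      have b: "x \<in> ball x0 R" using that by (simp add: G_def)
      show 1: "norm (gradient \<eta> x) \<le> 4 * cutoff x0 R x / R"
        using cutoff_sq(3)[OF R(1) b] by (simp add: \<eta>_def[abs_def])
      have "4 * cutoff x0 R x / R \<le> 4 * 1 / R"
        using cutoff_bounds(2)[OF R(1) b] R(1) by (intro divide_right_mono) auto
      then show "norm (gradient \<eta> x) \<le> 4 / R" using 1 by simp
    qed
    have "2 * (\<mu> / 2)\<^sup>2 * measure lborel (ball x1 r) \<le> E\<^sup>2 * measure lborel K"
    proof (rule bernstein_integral[where v = v and \<eta> = \<eta> and f = f and Fv = Fv and Fz = Fz and k = k and \<kappa> = \<delta>0 and B = B,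
          folded z_def e_def, OF G K KG vC _ chain])
      show "Ck_on (Suc (Suc 0)) G \<eta>" by (rule Ck_on_subset[OF \<eta>C]) simp
      show "\<delta>0 > 0" "0 < \<mu> / 2" using \<delta>0 \<mu> by auto
      show "ball x1 r \<subseteq> G" using r(2) \<mu> W by (auto simp: G_def k1_def)
      then show "k + \<mu> / 2 \<le> \<eta> x * z x" if "x \<in> ball x1 r" for x
      proof -
        have "W - \<mu> / 4 < w x" "\<bar>\<eta> x * z x - w x\<bar> < \<mu> / 4"
          using w\<phi>[of x] r(2) that \<open>ball x1 r \<subseteq> G\<close> by blast+
        then show ?thesis unfolding k_def by linarith
      qed
      fix x assume x: "x \<in> G"
      then have xK1: "x \<in> K1" and xb: "x \<in> ball x0 R" using GK1 by (auto simp: G_def)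
      note \<theta> = cutoff_bounds[OF R(1) xb]
      show "\<eta> x * z x \<le> k" if "x \<notin> K"
      proof -
        have "w x < k - \<mu> / 2" using that xb by (auto simp: K_def)
        then show ?thesis using w\<phi>[OF x] \<mu>(1) by linarith
      qed
      show \<eta>x: "\<eta> x > 0" by (rule K1b(3)[OF xK1])
      show "B\<^sup>2 * (\<eta> x * z x - k) \<le> \<delta>0"
      proof -
        have "w x \<le> W" using x1(2)[of x] xb by (simp add: W_def)
        then have "\<eta> x * z x - k \<le> 2 * \<mu>"
          using w\<phi>[OF x] \<mu>(1) unfolding k_def by linarith
        then have "B\<^sup>2 * (\<eta> x * z x - k) \<le> B\<^sup>2 * (2 * \<mu>)" by (intro mult_left_mono) auto
        then show ?thesis using \<mu>(3) by linarith
      qed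
      show "\<bar>e x\<bar> \<le> E" using eE[OF x] \<epsilon> by simp
      show "4 * B * \<bar>e x\<bar> \<le> \<delta>0"
      proof -
        have "4 * B * \<bar>e x\<bar> \<le> 4 * B * \<epsilon>" using eE[OF x] B(1) by (intro mult_left_mono) auto
        then show ?thesis using \<epsilon>(4) by linarith
      qed
      show "4 * \<eta> x * norm (gradient v x) \<le> B"
      proof -
        have "4 * \<eta> x * norm (gradient v x) \<le> 4 * 1 * B2"
          using K1b(4)[OF xK1] \<eta>x nB(2)[OF xK1] by (intro mult_mono) (auto simp: g\<phi>[OF x])
        then show ?thesis using B(4) by simp
      qed
      have ng: "\<bar>gradient \<eta> x \<bullet> gradient v x\<bar> \<le> 4 / R * B2"
      proof -
        have "\<bar>gradient \<eta> x \<bullet> gradient v x\<bar> \<le> norm (gradient \<eta> x) * norm (gradient v x)" by (rule Cauchy_Schwarz_ineq2)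
        also have "\<dots> \<le> 4 / R * B2" using n\<eta>(2)[OF x] nB(2)[OF xK1] R(1) by (intro mult_mono) (auto simp: g\<phi>[OF x])
        finally show ?thesis .
      qed
      show "\<bar>4 * \<eta> x * f x / real DIM('a) - 2 * \<eta> x * (f x + e x) - 2 * (gradient \<eta> x \<bullet> gradient v x)\<bar> \<le> B"
      proof -
        have 1: "\<bar>\<eta> x * f x\<bar> \<le> B3"
          using mult_mono[OF K1b(4)[OF xK1] nB(3)[OF xK1]] \<eta>x by (simp add: abs_mult f\<phi>(1)[OF x])
        have 2: "\<bar>\<eta> x * f x / N\<bar> \<le> B3"
        proof -
          have "1 \<le> N" using DIM_positive[where 'a='a] by (simp add: N_def Suc_le_eq)
          then have "\<bar>\<eta> x * f x\<bar> / N \<le> \<bar>\<eta> x * f x\<bar> / 1" by (intro divide_left_mono) auto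
          then show ?thesis using N 1 by simp
        qed
        have 3: "\<bar>\<eta> x * e x\<bar> \<le> 1"
          using mult_mono[OF K1b(4)[OF xK1], of "\<bar>e x\<bar>" 1] eE[OF x] \<epsilon>(3) \<eta>x by (simp add: abs_mult)
        have "\<bar>4 * A - 2 * A' - 2 * D - 2 * D'\<bar> \<le> b"
          if "\<bar>A'\<bar> \<le> b1" "\<bar>A\<bar> \<le> b1" "\<bar>D\<bar> \<le> 1" "\<bar>D'\<bar> \<le> b2" "4 * b1 + 2 * (b1 + 1) + 2 * b2 \<le> b"
          for A A' D D' b1 b2 b :: real
          using that unfolding abs_le_iff by auto
        from this[OF 1 2 3 ng B(3)]
        have "\<bar>4 * (\<eta> x * f x / N) - 2 * (\<eta> x * f x) - 2 * (\<eta> x * e x) - 2 * (gradient \<eta> x \<bullet> gradient v x)\<bar> \<le> B" .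
        moreover have "4 * \<eta> x * f x / real DIM('a) - 2 * \<eta> x * (f x + e x) - 2 * (gradient \<eta> x \<bullet> gradient v x)
          = 4 * (\<eta> x * f x / N) - 2 * (\<eta> x * f x) - 2 * (\<eta> x * e x) - 2 * (gradient \<eta> x \<bullet> gradient v x)"
          by (simp add: N_def algebra_simps)
        ultimately show ?thesis by (simp only:)
      qed
      show "norm ((2 / \<eta> x) *\<^sub>R gradient \<eta> x + (2 * Fz x) *\<^sub>R gradient v x) \<le> B"
      proof -
        have "norm ((2 / \<eta> x) *\<^sub>R gradient \<eta> x + (2 * Fz x) *\<^sub>R gradient v x)
           \<le> 2 / \<eta> x * norm (gradient \<eta> x) + 2 * \<bar>Fz x\<bar> * norm (gradient v x)"
          using \<eta>x by (intro norm_triangle_le) (simp add: abs_mult)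
        also have "\<dots> \<le> 2 / \<eta>0 * (4 / R) + 2 * B1 * B2"
          using \<eta>low[OF xK1] \<eta>0 n\<eta>(2)[OF x] nB(1,2)[OF xK1] B1(1) \<eta>x
          by (intro add_mono mult_mono divide_left_mono mult_pos_pos) (auto simp: g\<phi>[OF x] f\<phi>(2)[OF x])
        finally show ?thesis using B(2) by linarith
      qed
      assume wk: "k < \<eta> x * z x"
      show "\<delta>0 \<le> z x * laplacian \<eta> x - 2 * z x * (gradient \<eta> x \<bullet> gradient \<eta> x) / \<eta> x
         + 2 * \<eta> x * ((f x)\<^sup>2 / real DIM('a) + Fv x * z x) - 2 * z x * Fz x * (gradient v x \<bullet> gradient \<eta> x)"
      proof -
        have \<eta>sq: "\<eta> x = (cutoff x0 R x)\<^sup>2" by (simp add: \<eta>_def power2_eq_square)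
        have zz: "norm (gradient v x) = sqrt (z x)"
          by (simp add: z\<phi>[OF x] \<phi>z_def g\<phi>[OF x] norm_eq_sqrt_inner)
        show ?thesis
          unfolding \<delta>0_def C1_def f_def Fv_def Fz_def \<eta>sq
        proof (rule zero_order_bound[where V = "(2 * M)\<^sup>2"])
          show "0 < v x" "0 < z x" "0 < c" "0 < R" "0 < real DIM('a)" "0 < \<delta>" "0 \<le> a" "0 < k1"
            using vpos[OF x] zpos[OF x] c R(1) \<delta>(1) apos k1 by simp_all
          show "\<delta> \<le> a\<^sup>2 / real DIM('a) - a" "\<delta> \<le> 1 / real DIM('a)" "0 \<le> 2 * a / real DIM('a) + s"
            by (rule \<delta> cross)+
          show "0 < cutoff x0 R x" "cutoff x0 R x \<le> 1" by (rule \<theta>)+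
          show "- (4 * real DIM('a)) / R\<^sup>2 \<le> laplacian \<eta> x"
            using cutoff_sq(4)[OF R(1) xb] by (simp add: \<eta>_def[abs_def])
          have "gradient \<eta> x \<bullet> gradient \<eta> x = (norm (gradient \<eta> x))\<^sup>2" by (simp add: power2_norm_eq_inner)
          also have "\<dots> \<le> (4 * cutoff x0 R x / R)\<^sup>2" by (rule power_mono[OF n\<eta>(1)[OF x]]) simp
          finally show "gradient \<eta> x \<bullet> gradient \<eta> x \<le> 16 * (cutoff x0 R x)\<^sup>2 / R\<^sup>2"
            by (simp add: power_divide power_mult_distrib)
          have "\<bar>gradient v x \<bullet> gradient \<eta> x\<bar> \<le> norm (gradient v x) * norm (gradient \<eta> x)" by (rule Cauchy_Schwarz_ineq2)
          also have "\<dots> \<le> sqrt (z x) * (4 * cutoff x0 R x / R)" unfolding zz by (rule mult_left_mono[OF n\<eta>(1)[OF x]]) (use zpos[OF x] in simp)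
          finally show "\<bar>gradient v x \<bullet> gradient \<eta> x\<bar> \<le> 4 * cutoff x0 R x * sqrt (z x) / R" by (simp add: mult_ac)
          have "\<phi>v (Y x) \<le> M"
            unfolding \<phi>v_def Y_def M_def fst_conv using m(1) m(2)[OF K1b(2)[OF xK1]] \<sigma> by (intro powr_mono2') auto
          then have "v x \<le> 2 * M" using nv[OF xK1] by (simp add: v\<phi>)
          \<comment> \<open>The lower bound on \<open>u\<close> gives v \<le> M in the limit, and
            the approximation adds less than another \<open>M\<close>.\<close>
          then show "(v x)\<^sup>2 \<le> (2 * M)\<^sup>2" using vpos[OF x] by (intro power_mono) auto
          show "k1 \<le> (cutoff x0 R x)\<^sup>2 * z x" using wk \<mu>(2) W unfolding \<eta>sq by (simp add: k_def k1_def)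
          have "2 * C1 * (2 * M)\<^sup>2 \<le> k1 * (\<delta> * R\<^sup>2)" using big by (simp add: k1_def power_mult_distrib)
          then show "2 * (64 * (a + \<bar>q\<bar>)\<^sup>2 / \<delta> + 4 * real DIM('a) + 32) * (2 * M)\<^sup>2 \<le> k1 * (\<delta> * R\<^sup>2)" unfolding C1_def .
        qed
      qed
    qed
    then have "2 * V \<le> E\<^sup>2 * measure lborel K" by (simp only: V_def mult.assoc)
    then show False using V E(2) by linarith
  qed
  moreover have "w x0 \<le> W" unfolding W_def using R(1) by (intro x1(2)) simp
  moreover have "w x0 = (norm (gradient (\<lambda>y. u y powr - \<sigma>) x0))\<^sup>2"
  proof -
    have "x0 \<in> \<Omega>" using R by auto
    then have "gradient (\<lambda>y. u y powr - \<sigma>) x0 = \<phi>g (Y x0)"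
      by (simp add: \<phi>g_def Y_def gradient_powr[OF du upos])
    then show ?thesis
      by (simp add: w_def \<eta>_def cutoff_def \<phi>z_def power2_norm_eq_inner)
  qed
  ultimately show ?thesis unfolding M_def by linarith
qed

section \<open>From balls to the distance to the boundary\<close>

lemma ball_infdist_frontier_subset:
  fixes x :: "'a::euclidean_space"
  assumes "x \<in> \<Omega>"
  shows "ball x (infdist x (frontier \<Omega>)) \<subseteq> \<Omega>"
proof (rule ccontr)
  let ?d = "infdist x (frontier \<Omega>)"
  assume not: "\<not> ball x ?d \<subseteq> \<Omega>"
  then have "x \<in> ball x ?d" by (metis ball_empty centre_in_ball empty_subsetI not_le)
  then have "ball x ?d \<inter> \<Omega> \<noteq> {}" using assms by blast
  \<comment> \<open>A ball is connected, so if it meets both \<Omega> and its complement it meets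
    the frontier, against the choice of the radius.\<close>
  then have "ball x ?d \<inter> frontier \<Omega> \<noteq> {}"
    using connected_Int_frontier[OF connected_ball] not by blast
  then obtain y where "y \<in> frontier \<Omega>" "dist x y < ?d" by auto
  then show False using infdist_le[of y "frontier \<Omega>" x] by simp
qed

text \<open>Squaring the bound gives 2 \<sigma>^2 + \<sigma> < 1/N, hence \<sigma> < 1/N. For a = 1
  + 1/\<sigma> this means a > N, the condition for a^2/N - a to be positive.\<close>

lemma dimension_less_inverse_sigma:
  fixes \<sigma> N :: real
  assumes "N > 0" "\<sigma> > 0" "\<sigma> < 1 / 4 * (sqrt ((N + 8) / N) - 1)"
  shows "N < 1 / \<sigma>"
proof -
  have "4 * \<sigma> + 1 < sqrt ((N + 8) / N)" using assms(3) by simp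
  then have "(4 * \<sigma> + 1)\<^sup>2 < (sqrt ((N + 8) / N))\<^sup>2" using assms(2) by (intro power_strict_mono) auto
  also have "(sqrt ((N + 8) / N))\<^sup>2 = 1 + 8 / N" using assms(1) by (simp add: add_divide_distrib)
  finally have "16 * \<sigma>\<^sup>2 + 8 * \<sigma> < 8 / N" by (simp add: power2_eq_square algebra_simps)
  moreover have "8 / N = 8 * (1 / N)" by simp
  ultimately have "\<sigma> < 1 / N" using zero_le_power2[of \<sigma>] by linarith
  then show ?thesis using assms(1,2) by (simp add: field_simps)
qed

text \<open>The interior estimate has the form |\<nabla>v| R \<le> A for every closed ball of radius
  R inside \<Omega>, with \<open>A\<close> independent of R. It remains to let R approach the
  distance to the boundary, or infinity on the whole space.\<close>

theorem theorem1p4: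
  fixes p q \<sigma> :: real
  assumes "CARD('n::finite) \<ge> 2"
    and "0 < \<sigma>"
    and "\<sigma> < 1 / 4 * (sqrt ((real CARD('n) + 8) / real CARD('n)) - 1)"
    and "p + (1 + \<sigma>) * q < (real CARD('n) + 2) / real CARD('n) + \<sigma>"
  shows "\<exists>C>0. \<forall>(\<Omega> :: (real ^ 'n) set) (u :: real ^ 'n \<Rightarrow> real) (m :: real).
    open \<Omega> \<and> connected \<Omega> \<and> \<Omega> \<noteq> {} \<and>
    positive_solution \<Omega> p q u \<and> m > 0 \<and> (\<forall>x\<in>\<Omega>. u x \<ge> m) \<longrightarrow>
    (\<forall>x\<in>\<Omega>. norm (gradient (\<lambda>y. u y powr (- \<sigma>)) x)
        \<le> C * m powr (- \<sigma>) * inv_dist_boundary \<Omega> x)"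
proof -
  define N where "N = real CARD('n)"
  have N: "N > 0" and DIM: "real DIM(real ^ 'n) = N" by (simp_all add: N_def)
  define a where "a = 1 + 1 / \<sigma>"
  define s where "s = (1 + \<sigma> - p - (1 + \<sigma>) * q) / \<sigma>"
  have s: "\<sigma> * s = 1 + \<sigma> - p - (1 + \<sigma>) * q" using assms(2) by (simp add: s_def)
  have aN: "a > N" using dimension_less_inverse_sigma[OF N assms(2) assms(3)[folded N_def]] by (simp add: a_def)
  define \<delta> where "\<delta> = min (a\<^sup>2 / N - a) (1 / N)"
  have "N * a < a * a" using aN N by (intro mult_strict_right_mono) auto
  then have "a < a\<^sup>2 / N" using N by (simp add: power2_eq_square pos_less_divide_eq mult.commute)
  then have \<delta>: "\<delta> > 0" "\<delta> \<le> a\<^sup>2 / N - a" "\<delta> \<le> 1 / N" using N by (auto simp: \<delta>_def)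
  \<comment> \<open>After multiplication by \<sigma> the left side is 2/N + 2\<sigma>/N + \<sigma>s,
    and the hypothesis on p + (1 + \<sigma>) q says precisely that \<sigma>s > -2/N.\<close>
  have cross: "2 * a / N + s \<ge> 0"
  proof -
    have "(N + 2) / N = 1 + 2 / N" using N by (simp add: add_divide_distrib)
    then have "\<sigma> * s > - (2 / N)" using assms(4) unfolding s N_def by simp
    moreover have "\<sigma> * (2 * a / N) = 2 / N * \<sigma> + 2 / N" using assms(2) N by (simp add: a_def field_simps)
    moreover have "2 / N * \<sigma> > 0" using N assms(2) by simp
    ultimately have "\<sigma> * (2 * a / N + s) > 0" unfolding distrib_left by linarith
    then show ?thesis using assms(2) by (simp add: zero_less_mult_iff)
  qed
  define C1 where "C1 = 64 * (a + \<bar>q\<bar>)\<^sup>2 / \<delta> + 4 * N + 32"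
  have C1: "C1 > 0" unfolding C1_def using \<delta>(1) N by (intro add_nonneg_pos add_nonneg_nonneg) auto
  define C where "C = sqrt (16 * C1 / \<delta>)"
  have C: "C > 0" using C1 \<delta>(1) by (simp add: C_def)
  show ?thesis
  proof (intro exI[of _ C] conjI C allI impI ballI)
    fix \<Omega> :: "(real ^ 'n) set" and u :: "real ^ 'n \<Rightarrow> real" and m :: real and x
    assume *: "open \<Omega> \<and> connected \<Omega> \<and> \<Omega> \<noteq> {} \<and> positive_solution \<Omega> p q u \<and> m > 0 \<and> (\<forall>x\<in>\<Omega>. u x \<ge> m)"
      and x: "x \<in> \<Omega>"
    define g where "g = norm (gradient (\<lambda>y. u y powr (- \<sigma>)) x)"
    define A where "A = C * m powr (- \<sigma>)"
    have A: "A > 0" using C * by (simp add: A_def)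
    have est: "g * R \<le> A" if R: "R > 0" "cball x R \<subseteq> \<Omega>" for R
    proof -
      have "g\<^sup>2 \<le> 16 * C1 * (m powr - \<sigma>)\<^sup>2 / (\<delta> * R\<^sup>2)"
        unfolding g_def C1_def DIM[symmetric]
        by (rule interior_gradient_estimate[OF assms(2) a_def s])
          (use * R \<delta> cross in \<open>simp_all add: N_def\<close>)
      also have "\<dots> = (A / R)\<^sup>2"
        using C1 \<delta>(1) by (simp add: A_def C_def power_divide power_mult_distrib)
      finally have "g \<le> A / R" by (rule power2_le_imp_le) (use A R in simp)
      then show ?thesis using R by (simp add: pos_le_divide_eq)
    qed
    have g0: "g \<ge> 0" by (simp add: g_def)
    show "norm (gradient (\<lambda>y. u y powr (- \<sigma>)) x) \<le> C * m powr (- \<sigma>) * inv_dist_boundary \<Omega> x"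
    proof (cases "\<Omega> = UNIV")
      case True
      have "g = 0"
      proof (rule ccontr)
        assume "g \<noteq> 0"
        \<comment> \<open>On the whole space every radius is admissible; this one would turn the
          estimate into 2A \<le> A.\<close>
        then have "g * (2 * A / g) \<le> A" using g0 A True by (intro est) simp_all
        then show False using \<open>g \<noteq> 0\<close> A by simp
      qed
      then show ?thesis using True by (simp add: g_def inv_dist_boundary_def)
    next
      case False
      define d where "d = infdist x (frontier \<Omega>)"
      have "frontier \<Omega> \<noteq> {}" using frontier_eq_empty[of \<Omega>] False x by auto
      moreover have "x \<notin> frontier \<Omega>" using x * by (simp add: frontier_def interior_open)
      ultimately have d: "d > 0"
        unfolding d_def by (intro infdist_pos_not_in_closed frontier_closed)
      have sub: "ball x d \<subseteq> \<Omega>" unfolding d_def by (rule ball_infdist_frontier_subset[OF x])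
      have "g * d \<le> A"
      proof (rule ccontr)
        assume "\<not> g * d \<le> A"
        then have gd: "g * d > A" by simp
        then have g: "g > 0" using g0 A by (cases "g = 0") auto
        have "A / g < d" using gd g by (simp add: pos_divide_less_eq mult.commute)
        \<comment> \<open>\<open>est\<close> needs a closed ball inside \<Omega>, whereas only the
          open ball of radius \<open>d\<close> is known to lie there; hence a radius strictly below
          \<open>d\<close>.\<close>
        then obtain R where R: "A / g < R" "R < d" using dense by blast
        moreover have "A / g > 0" using A g by simp
        ultimately have R0: "R > 0" by linarith
        have "cball x R \<subseteq> ball x d" using R(2) by (simp add: cball_subset_ball_iff)
        then have "cball x R \<subseteq> \<Omega>" using sub by (rule subset_trans)
        then have "g * R \<le> A" by (rule est[OF R0])
        then show False using R(1) g by (simp add: pos_divide_less_eq mult.commute)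
      qed
      then have "g \<le> A * (1 / d)" using d by (simp add: pos_le_divide_eq)
      then show ?thesis using False by (simp add: g_def A_def inv_dist_boundary_def d_def)
    qed
  qed
qed

end
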